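(* Fix a qudit dimension $d$ and a set $\Lambda$ of sites with distance function. Two Clifford QCAs with the same stabilizer group (or the same flipper group) are always equivalent if and only if every separated Clifford QCA is trivial.
   Context: $\Lambda$ is equipped with a distance function $\Lambda\times\Lambda\to\mathbb{R}_{\ge0}$; each site $i$ carries $q_i$ qudits of dimension $d$ with generalized Pauli operators $X_i,Z_i$ (for each qudit at the site). A Clifford QCA $\alpha$ is a locality-preserving automorphism (there is $r$ such that each operator is mapped to one supported in the $r$-neighbourhood of its support) of the algebra of local operators mapping Pauli operators to Pauli operators up to phase. Its stabilizer group is $\alpha(\langle Z_i\rangle_{i\in\Lambda})$ and its flipper group is $\alpha(\langle X_i\rangle_{i\in\Lambda})$, where $\langle Z_i\rangle$ (resp. $\langle X_i\rangle$) is the group generated by all $Z_i$ (resp. $X_i$) and phases. $\alpha$ is separated if $\alpha(\langle X_i\rangle)=\langle X_i\rangle$ and $\alpha(\langle Z_i\rangle)=\langle Z_i\rangle$; modulo phases it is then given by a symplectic matrix $\begin{pmatrix}\Theta&0\\0&(\Theta^T)^{-1}\end{pmatrix}$. Modulo phases, a Clifford QCA is a symplectic automorphism of $P=\bigoplus_{i\in\Lambda}\mathbb{Z}_d^{2q_i}$ which is band-diagonal (matrix elements between $i,j$ vanish when the distance of $i,j$ exceeds some $r$). The trivial Clifford QCAs are those that, possibly after stabilization, lie in the group generated by (a) single-layer Clifford circuits, i.e. symplectic automorphisms block-diagonal with respect to a partition of $\Lambda$ into blocks of uniformly bounded diameter, and (b) band-diagonal permutations of qudits (acting by the same permutation matrix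 on $X$ and $Z$). Stabilization means extending a QCA by the identity on additional on-site qudits. Two Clifford QCAs $\alpha,\beta$ are equivalent if $\beta^{-1}\circ\alpha$ is trivial. *)

theory Defs
  imports
    "HOL-Analysis.Abstract_Metric_Spaces"
    "HOL-Library.Poly_Mapping"
    "HOL-Library.Product_Plus"
    "HOL-Library.Disjoint_Sets"
    "HOL-Combinatorics.Permutations"
    "HOL-Algebra.Bij"
    "HOL-Algebra.Generated_Groups"
    "Berlekamp_Zassenhaus.Finite_Field"
begin

text \<open>
  The qudit dimension is \<open>d = CARD('d)\<close>; the class \<^class>\<open>nontriv\<close> says \<open>d \<ge> 2\<close>, and
  \<open>'d mod_ring\<close> is the ring of integers modulo \<open>d\<close>. The sites form a set \<open>\<Lambda>\<close> with distance \<open>D\<close>,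
  and site \<open>i\<close> carries the qudits \<open>(i,0), \<dots>, (i, q i - 1)\<close>.
\<close>

type_synonym 'l qudit = "'l \<times> nat"

definition qudits :: "'l set \<Rightarrow> ('l \<Rightarrow> nat) \<Rightarrow> 'l qudit set" where
  "qudits \<Lambda> q = (SIGMA i:\<Lambda>. {..<q i})"


section \<open>The algebra of local operators\<close>

text \<open>
  A configuration \<open>c\<close> labels the basis vector \<open>|c\<rangle>\<close> of the tensor product of all the qudits, with
  all but finitely many qudits in the state \<open>|0\<rangle>\<close>. An operator is given by its matrix
  \<open>A c c' = \<langle>c|A|c'\<rangle>\<close> in this basis; entries at arguments that are not configurations
  of the system at hand are \<open>0\<close>.
\<close>

type_synonym ('l, 'd) config = "'l qudit \<Rightarrow>\<^sub>0 'd mod_ring"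
type_synonym ('l, 'd) oper = "('l, 'd) config \<Rightarrow> ('l, 'd) config \<Rightarrow> complex"

definition configs :: "'l qudit set \<Rightarrow> ('l, 'd::nontriv) config set" where
  "configs Q = {c. Poly_Mapping.keys c \<subseteq> Q}"

definition agree_on :: "'l set \<Rightarrow> ('l, 'd::nontriv) config \<Rightarrow> ('l, 'd) config \<Rightarrow> bool" where
  "agree_on F c c' \<longleftrightarrow>
     (\<forall>i\<in>F. \<forall>k. Poly_Mapping.lookup c (i, k) = Poly_Mapping.lookup c' (i, k))"

text \<open>
  \<open>A\<close> is supported on the set of sites \<open>F\<close> iff it has the form \<open>A\<^sub>F \<otimes> 1\<close>: it is diagonal
  off \<open>F\<close>, and its matrix elements depend only on the restrictions to \<open>F\<close>.
\<close>

definition supported_on :: "'l qudit set \<Rightarrow> 'l set \<Rightarrow> ('l, 'd::nontriv) oper \<Rightarrow> bool" where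
  "supported_on Q F A \<longleftrightarrow>
     (\<forall>c\<in>configs Q. \<forall>c'\<in>configs Q. A c c' \<noteq> 0 \<longrightarrow> agree_on (- F) c c') \<and>
     (\<forall>b\<in>configs Q. \<forall>b'\<in>configs Q. \<forall>c\<in>configs Q. \<forall>c'\<in>configs Q.
        agree_on F b c \<and> agree_on F b' c' \<and> agree_on (- F) b b' \<and> agree_on (- F) c c'
        \<longrightarrow> A b b' = A c c')"

definition local_ops :: "'l set \<Rightarrow> ('l \<Rightarrow> nat) \<Rightarrow> ('l, 'd::nontriv) oper set" where
  "local_ops \<Lambda> q =
     {A. (\<forall>c c'. A c c' \<noteq> 0 \<longrightarrow> c \<in> configs (qudits \<Lambda> q) \<and> c' \<in> configs (qudits \<Lambda> q)) \<and>
         (\<exists>F. finite F \<and> F \<subseteq> \<Lambda> \<and> supported_on (qudits \<Lambda> q) F A)}"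

definition op_one :: "'l qudit set \<Rightarrow> ('l, 'd::nontriv) oper" where
  "op_one Q = (\<lambda>c c'. if c \<in> configs Q \<and> c = c' then 1 else 0)"

definition op_add :: "('l, 'd::nontriv) oper \<Rightarrow> ('l, 'd) oper \<Rightarrow> ('l, 'd) oper" where
  "op_add A B = (\<lambda>c c'. A c c' + B c c')"

definition op_scale :: "complex \<Rightarrow> ('l, 'd::nontriv) oper \<Rightarrow> ('l, 'd) oper" where
  "op_scale \<gamma> A = (\<lambda>c c'. \<gamma> * A c c')"

text \<open>For local operators only finitely many terms of the following sum are nonzero.\<close>

definition op_mult :: "('l, 'd::nontriv) oper \<Rightarrow> ('l, 'd) oper \<Rightarrow> ('l, 'd) oper" where
  "op_mult A B = (\<lambda>c c'. Sum_any (\<lambda>b. A c b * B b c'))"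

definition op_adj :: "('l, 'd::nontriv) oper \<Rightarrow> ('l, 'd) oper" where
  "op_adj A = (\<lambda>c c'. cnj (A c' c))"

definition local_monoid :: "'l set \<Rightarrow> ('l \<Rightarrow> nat) \<Rightarrow> ('l, 'd::nontriv) oper monoid" where
  "local_monoid \<Lambda> q =
     \<lparr>carrier = local_ops \<Lambda> q, mult = op_mult, one = op_one (qudits \<Lambda> q)\<rparr>"


section \<open>Pauli operators\<close>

definition root_pow :: "'d::nontriv mod_ring \<Rightarrow> complex" where
  "root_pow a = cis (2 * pi * of_int (to_int_mod_ring a) / of_nat CARD('d))"

definition pairing :: "('l, 'd::nontriv) config \<Rightarrow> ('l, 'd) config \<Rightarrow> 'd mod_ring" where
  "pairing a b = (\<Sum>k\<in>Poly_Mapping.keys a. Poly_Mapping.lookup a k * Poly_Mapping.lookup b k)"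

text \<open>
  Elements of the direct sum \<open>P\<close> are pairs \<open>(x, z)\<close> of finitely supported exponent vectors; they
  label the Pauli operator \<open>X\<^sup>x Z\<^sup>z : |c\<rangle> \<mapsto> \<omega>\<^bsup>z\<cdot>c\<^esup> |c + x\<rangle>\<close>, where \<open>\<omega> = exp (2 \<pi> i / d)\<close>.
\<close>

type_synonym ('l, 'd) pvec = "('l, 'd) config \<times> ('l, 'd) config"

definition pauli_space :: "'l qudit set \<Rightarrow> ('l, 'd::nontriv) pvec set" where
  "pauli_space Q = configs Q \<times> configs Q"

definition pauli :: "'l qudit set \<Rightarrow> ('l, 'd::nontriv) pvec \<Rightarrow> ('l, 'd) oper" where
  "pauli Q u = (\<lambda>c c'. if c' \<in> configs Q \<and> c = c' + fst u then root_pow (pairing (snd u) c') else 0)"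

definition pauli_X :: "'l qudit set \<Rightarrow> 'l qudit \<Rightarrow> ('l, 'd::nontriv) oper" where
  "pauli_X Q k = pauli Q (Poly_Mapping.single k 1, 0)"

definition pauli_Z :: "'l qudit set \<Rightarrow> 'l qudit \<Rightarrow> ('l, 'd::nontriv) oper" where
  "pauli_Z Q k = pauli Q (0, Poly_Mapping.single k 1)"

definition pauli_ops :: "'l qudit set \<Rightarrow> ('l, 'd::nontriv) oper set" where
  "pauli_ops Q = {op_scale \<gamma> (pauli Q u) | \<gamma> u. cmod \<gamma> = 1 \<and> u \<in> pauli_space Q}"

definition phases :: "'l qudit set \<Rightarrow> ('l, 'd::nontriv) oper set" where
  "phases Q = {op_scale \<gamma> (op_one Q) | \<gamma>. cmod \<gamma> = 1}"

definition X_group :: "'l set \<Rightarrow> ('l \<Rightarrow> nat) \<Rightarrow> ('l, 'd::nontriv) oper set" where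
  "X_group \<Lambda> q = generate (units_of (local_monoid \<Lambda> q))
     (pauli_X (qudits \<Lambda> q) ` qudits \<Lambda> q \<union> phases (qudits \<Lambda> q))"

definition Z_group :: "'l set \<Rightarrow> ('l \<Rightarrow> nat) \<Rightarrow> ('l, 'd::nontriv) oper set" where
  "Z_group \<Lambda> q = generate (units_of (local_monoid \<Lambda> q))
     (pauli_Z (qudits \<Lambda> q) ` qudits \<Lambda> q \<union> phases (qudits \<Lambda> q))"


section \<open>Clifford QCAs\<close>

definition algebra_aut ::
  "'l set \<Rightarrow> ('l \<Rightarrow> nat) \<Rightarrow> (('l, 'd::nontriv) oper \<Rightarrow> ('l, 'd) oper) \<Rightarrow> bool" where
  "algebra_aut \<Lambda> q \<alpha> \<longleftrightarrow>
     bij_betw \<alpha> (local_ops \<Lambda> q) (local_ops \<Lambda> q) \<and>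
     (\<forall>A\<in>local_ops \<Lambda> q. \<forall>B\<in>local_ops \<Lambda> q.
        \<alpha> (op_add A B) = op_add (\<alpha> A) (\<alpha> B) \<and> \<alpha> (op_mult A B) = op_mult (\<alpha> A) (\<alpha> B)) \<and>
     (\<forall>A\<in>local_ops \<Lambda> q. (\<forall>\<gamma>. \<alpha> (op_scale \<gamma> A) = op_scale \<gamma> (\<alpha> A)) \<and> \<alpha> (op_adj A) = op_adj (\<alpha> A))"

definition neighbourhood :: "'l set \<Rightarrow> ('l \<Rightarrow> 'l \<Rightarrow> real) \<Rightarrow> real \<Rightarrow> 'l set \<Rightarrow> 'l set" where
  "neighbourhood \<Lambda> D r F = {j\<in>\<Lambda>. \<exists>i\<in>F. D i j \<le> r}"

definition locality_preserving ::
  "'l set \<Rightarrow> ('l \<Rightarrow> 'l \<Rightarrow> real) \<Rightarrow> ('l \<Rightarrow> nat) \<Rightarrow> (('l, 'd::nontriv) oper \<Rightarrow> ('l, 'd) oper) \<Rightarrow> bool" where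
  "locality_preserving \<Lambda> D q \<alpha> \<longleftrightarrow>
     (\<exists>r. \<forall>A\<in>local_ops \<Lambda> q. \<forall>F\<subseteq>\<Lambda>. supported_on (qudits \<Lambda> q) F A \<longrightarrow>
        supported_on (qudits \<Lambda> q) (neighbourhood \<Lambda> D r F) (\<alpha> A))"

definition clifford_qca ::
  "'l set \<Rightarrow> ('l \<Rightarrow> 'l \<Rightarrow> real) \<Rightarrow> ('l \<Rightarrow> nat) \<Rightarrow> (('l, 'd::nontriv) oper \<Rightarrow> ('l, 'd) oper) \<Rightarrow> bool" where
  "clifford_qca \<Lambda> D q \<alpha> \<longleftrightarrow>
     algebra_aut \<Lambda> q \<alpha> \<and> locality_preserving \<Lambda> D q \<alpha> \<and>
     \<alpha> ` pauli_ops (qudits \<Lambda> q) \<subseteq> pauli_ops (qudits \<Lambda> q)"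

definition stabilizer_group ::
  "'l set \<Rightarrow> ('l \<Rightarrow> nat) \<Rightarrow> (('l, 'd::nontriv) oper \<Rightarrow> ('l, 'd) oper) \<Rightarrow> ('l, 'd) oper set" where
  "stabilizer_group \<Lambda> q \<alpha> = \<alpha> ` Z_group \<Lambda> q"

definition flipper_group ::
  "'l set \<Rightarrow> ('l \<Rightarrow> nat) \<Rightarrow> (('l, 'd::nontriv) oper \<Rightarrow> ('l, 'd) oper) \<Rightarrow> ('l, 'd) oper set" where
  "flipper_group \<Lambda> q \<alpha> = \<alpha> ` X_group \<Lambda> q"

definition separated ::
  "'l set \<Rightarrow> ('l \<Rightarrow> nat) \<Rightarrow> (('l, 'd::nontriv) oper \<Rightarrow> ('l, 'd) oper) \<Rightarrow> bool" where
  "separated \<Lambda> q \<alpha> \<longleftrightarrow> \<alpha> ` X_group \<Lambda> q = X_group \<Lambda> q \<and> \<alpha> ` Z_group \<Lambda> q = Z_group \<Lambda> q"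


section \<open>Trivial Clifford QCAs\<close>

text \<open>The action of a Clifford QCA on \<open>P\<close>, i.e. modulo phases, as an element of \<open>Bij P\<close>.\<close>

definition mod_phases ::
  "'l set \<Rightarrow> ('l \<Rightarrow> nat) \<Rightarrow> (('l, 'd::nontriv) oper \<Rightarrow> ('l, 'd) oper)
     \<Rightarrow> ('l, 'd) pvec \<Rightarrow> ('l, 'd) pvec" where
  "mod_phases \<Lambda> q \<alpha> = (\<lambda>u\<in>pauli_space (qudits \<Lambda> q).
     THE v. v \<in> pauli_space (qudits \<Lambda> q) \<and>
       (\<exists>\<gamma>. cmod \<gamma> = 1 \<and> \<alpha> (pauli (qudits \<Lambda> q) u) = op_scale \<gamma> (pauli (qudits \<Lambda> q) v)))"

text \<open>\<open>pauli u * pauli v = \<omega> ^ symp_form u v * pauli v * pauli u\<close>\<close>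

definition symp_form :: "('l, 'd::nontriv) pvec \<Rightarrow> ('l, 'd) pvec \<Rightarrow> 'd mod_ring" where
  "symp_form u v = pairing (snd u) (fst v) - pairing (fst u) (snd v)"

text \<open>Additive maps are automatically linear over the integers modulo \<open>d\<close>.\<close>

definition symplectic_aut :: "'l qudit set \<Rightarrow> (('l, 'd::nontriv) pvec \<Rightarrow> ('l, 'd) pvec) \<Rightarrow> bool" where
  "symplectic_aut Q S \<longleftrightarrow>
     S \<in> Bij (pauli_space Q) \<and>
     (\<forall>u\<in>pauli_space Q. \<forall>v\<in>pauli_space Q.
        S (u + v) = S u + S v \<and> symp_form (S u) (S v) = symp_form u v)"

definition single_layer_circuits ::
  "'l set \<Rightarrow> ('l \<Rightarrow> 'l \<Rightarrow> real) \<Rightarrow> ('l \<Rightarrow> nat) \<Rightarrow> (('l, 'd::nontriv) pvec \<Rightarrow> ('l, 'd) pvec) set" where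
  "single_layer_circuits \<Lambda> D q =
     {S. symplectic_aut (qudits \<Lambda> q) S \<and>
         (\<exists>\<B> r. partition_on \<Lambda> \<B> \<and> (\<forall>B\<in>\<B>. \<forall>i\<in>B. \<forall>j\<in>B. D i j \<le> r) \<and>
            (\<forall>B\<in>\<B>. S ` pauli_space (qudits B q) \<subseteq> pauli_space (qudits B q)))}"

definition permute_qudits ::
  "'l qudit set \<Rightarrow> ('l qudit \<Rightarrow> 'l qudit) \<Rightarrow> ('l, 'd::nontriv) pvec \<Rightarrow> ('l, 'd) pvec" where
  "permute_qudits Q \<pi> = (\<lambda>u\<in>pauli_space Q.
     (Poly_Mapping.map_key (inv_into UNIV \<pi>) (fst u), Poly_Mapping.map_key (inv_into UNIV \<pi>) (snd u)))"

definition qudit_permutations ::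
  "'l set \<Rightarrow> ('l \<Rightarrow> 'l \<Rightarrow> real) \<Rightarrow> ('l \<Rightarrow> nat) \<Rightarrow> (('l, 'd::nontriv) pvec \<Rightarrow> ('l, 'd) pvec) set" where
  "qudit_permutations \<Lambda> D q =
     {permute_qudits (qudits \<Lambda> q) \<pi> | \<pi>. \<pi> permutes qudits \<Lambda> q \<and>
        (\<exists>r. \<forall>k\<in>qudits \<Lambda> q. D (fst k) (fst (\<pi> k)) \<le> r)}"

text \<open>
  Stabilization adds \<open>e i\<close> qudits at each site \<open>i\<close>; the extension \<open>T\<close> acts as \<open>S\<close> on the
  original qudits and as the identity on the added ones.
\<close>

definition stabilization ::
  "'l set \<Rightarrow> ('l \<Rightarrow> nat) \<Rightarrow> ('l \<Rightarrow> nat) \<Rightarrow> (('l, 'd::nontriv) pvec \<Rightarrow> ('l, 'd) pvec)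
     \<Rightarrow> (('l, 'd) pvec \<Rightarrow> ('l, 'd) pvec) \<Rightarrow> bool" where
  "stabilization \<Lambda> q e S T \<longleftrightarrow>
     (\<forall>u\<in>pauli_space (qudits \<Lambda> q).
        \<forall>w\<in>pauli_space (qudits \<Lambda> (\<lambda>i. q i + e i) - qudits \<Lambda> q). T (u + w) = S u + w)"

definition trivial_qca ::
  "'l set \<Rightarrow> ('l \<Rightarrow> 'l \<Rightarrow> real) \<Rightarrow> ('l \<Rightarrow> nat) \<Rightarrow> (('l, 'd::nontriv) oper \<Rightarrow> ('l, 'd) oper) \<Rightarrow> bool" where
  "trivial_qca \<Lambda> D q \<alpha> \<longleftrightarrow>
     (\<exists>e. let q' = (\<lambda>i. q i + e i) in
        \<exists>T \<in> generate (BijGroup (pauli_space (qudits \<Lambda> q')))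
               (single_layer_circuits \<Lambda> D q' \<union> qudit_permutations \<Lambda> D q').
          stabilization \<Lambda> q e (mod_phases \<Lambda> q \<alpha>) T)"

definition equivalent_qca ::
  "'l set \<Rightarrow> ('l \<Rightarrow> 'l \<Rightarrow> real) \<Rightarrow> ('l \<Rightarrow> nat) \<Rightarrow> (('l, 'd::nontriv) oper \<Rightarrow> ('l, 'd) oper)
     \<Rightarrow> (('l, 'd) oper \<Rightarrow> ('l, 'd) oper) \<Rightarrow> bool" where
  "equivalent_qca \<Lambda> D q \<alpha> \<beta> \<longleftrightarrow> trivial_qca \<Lambda> D q (inv_into (local_ops \<Lambda> q) \<beta> \<circ> \<alpha>)"

end

theory Submission
  imports Defs "HOL-Library.Real_Mod"
begin

text \<open>
  If two automata with equal stabilizer groups are always equivalent, then a separated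
  automaton, which has the stabilizer group of the identity, is equivalent to the identity and
  hence trivial; likewise for flipper groups. The content is the converse.

  Let \<open>\<alpha>\<close> and \<open>\<beta>\<close> have the same stabilizer group. Modulo phases, \<open>\<beta>\<^sup>-\<^sup>1 \<alpha>\<close> is a local
  symplectic automorphism \<open>S\<close> of \<open>P\<close> which maps the vectors \<open>(0, z)\<close> to such vectors, so \<open>S\<close> has the
  triangular form \<open>S (x, z) = (\<Theta> x, C x + (\<Theta>\<^sup>T)\<^sup>-\<^sup>1 z)\<close>. It is therefore the shear
  \<open>(x, z) \<mapsto> (x, z + A x)\<close> with \<open>A = \<Theta>\<^sup>T C\<close>, followed by \<open>\<Theta> \<oplus> (\<Theta>\<^sup>T)\<^sup>-\<^sup>1\<close>, and \<open>A\<close> is symmetric because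
  \<open>S\<close> preserves the form. Two things remain.

  The diagonal factor comes from an actual separated automaton, namely the one that permutes
  the basis vectors by \<open>|c\<rangle> \<mapsto> |\<Theta> c\<rangle>\<close> (\<open>separated_qca_exists\<close>). It is trivial by hypothesis.

  The shear is trivial as well (\<open>trivial_local_shear\<close>). Its sites may have unboundedly many
  neighbours, so its two-qudit gates cannot simply be sorted into finitely many layers. Instead
  write \<open>A = B + B\<^sup>T + E\<close> with \<open>E\<close> diagonal; the shear by \<open>E\<close> is a single layer of one-qudit gates. For
  \<open>B + B\<^sup>T\<close> add a copy \<open>x'\<close> of the whole system. The gates with the quadratic form \<open>x \<cdot> x'\<close> act on
  single sites. The separated map \<open>x' \<mapsto> x' + B x\<close> turns this form into \<open>x \<cdot> x' + x \<cdot> B x\<close>, and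
  undoing the gates of \<open>x \<cdot> x'\<close> leaves exactly the shear by \<open>B + B\<^sup>T\<close> on the original qudits. So
  this shear is a product of on-site gates and separated maps on the doubled system, and the
  latter are trivial by the hypothesis, which covers every number of qudits per site.

  Flipper groups are reduced to stabilizer groups by conjugation with the on-site Fourier
  transform, which exchanges the roles of \<open>X\<close> and \<open>Z\<close>.

  To get from operators to \<open>P\<close>, one needs that a Clifford automaton acts on \<open>P\<close> bijectively
  (\<open>clifford_mod_phases_symplectic\<close>) and that its inverse is again local
  (\<open>local_symplectic_inverse\<close>).
\<close>

(* Qudits are pairs; quantifiers over them are not to be split into two. *)
declare split_paired_All [simp del] split_paired_Ex [simp del]

section \<open>The character of the ring of integers modulo d\<close>

lemma of_int_to_int_mod_ring: "of_int (to_int_mod_ring a) = (a :: 'd::nontriv mod_ring)"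
  by (simp add: of_int_of_int_mod_ring)

lemma of_nat_nat_to_int_mod_ring: "of_nat (nat (to_int_mod_ring v)) = (v :: 'd::nontriv mod_ring)"
proof -
  have "to_int_mod_ring v \<ge> 0" using range_to_int_mod_ring[where 'a = 'd] by auto
  then have "(of_nat (nat (to_int_mod_ring v)) :: 'd mod_ring) = of_int (to_int_mod_ring v)"
    by simp
  then show ?thesis by (simp add: of_int_to_int_mod_ring)
qed

lemma root_pow_of_int:
  "root_pow (of_int n :: 'd::nontriv mod_ring) = cis (2 * pi * of_int n / of_nat CARD('d))"
proof -
  let ?d = "int CARD('d)"
  have m: "to_int_mod_ring (of_int n :: 'd mod_ring) = n mod ?d"
    unfolding of_int_of_int_mod_ring by transfer simp
  have "n = ?d * (n div ?d) + n mod ?d" by simp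
  then have "real_of_int n = real CARD('d) * real_of_int (n div ?d) + real_of_int (n mod ?d)"
    by (metis of_int_add of_int_mult of_int_of_nat_eq)
  then have "2 * pi * of_int n / of_nat CARD('d)
      = 2 * pi * of_int (n div ?d) + 2 * pi * of_int (n mod ?d) / of_nat CARD('d)"
    by (simp add: field_simps)
  then show ?thesis
    unfolding root_pow_def m by (simp flip: cis_mult)
qed

lemma root_pow_add: "root_pow (a + b) = root_pow a * root_pow (b :: 'd::nontriv mod_ring)"
proof -
  have "root_pow (of_int (to_int_mod_ring a) + of_int (to_int_mod_ring b) :: 'd mod_ring)
      = root_pow (of_int (to_int_mod_ring a) :: 'd mod_ring)
        * root_pow (of_int (to_int_mod_ring b) :: 'd mod_ring)"
    unfolding of_int_add[symmetric] root_pow_of_int cis_mult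
    by (simp add: ring_distribs add_divide_distrib)
  then show ?thesis by (simp add: of_int_to_int_mod_ring)
qed

lemma root_pow_0 [simp]: "root_pow (0 :: 'd::nontriv mod_ring) = 1"
  by (simp add: root_pow_def)

lemma norm_root_pow [simp]: "cmod (root_pow a) = 1"
  by (simp add: root_pow_def)

lemma root_pow_nonzero [simp]: "root_pow a \<noteq> 0"
  by (simp add: root_pow_def)

lemma root_pow_eq_1_iff: "root_pow (a :: 'd::nontriv mod_ring) = 1 \<longleftrightarrow> a = 0"
proof
  assume "root_pow a = 1"
  then obtain n :: int
    where n: "2 * pi * of_int (to_int_mod_ring a) / of_nat CARD('d) = of_int n * (2 * pi)"
    unfolding root_pow_def cis_eq_1_iff by auto
  have "real_of_int (to_int_mod_ring a) = real_of_int n * real CARD('d)"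
    using n by (simp add: field_simps)
  then have eq: "to_int_mod_ring a = n * int CARD('d)"
    by (metis of_int_eq_iff of_int_mult of_int_of_nat_eq)
  have "to_int_mod_ring a \<in> {0..<int CARD('d)}"
    using range_to_int_mod_ring[where 'a = 'd] by blast
  then have "to_int_mod_ring a = to_int_mod_ring a mod int CARD('d)" by simp
  then have "to_int_mod_ring a = 0" by (simp add: eq)
  then show "a = 0" by simp
qed simp

lemma root_pow_inject: "root_pow a = root_pow b \<longleftrightarrow> a = (b :: 'd::nontriv mod_ring)"
proof
  assume "root_pow a = root_pow b"
  moreover have "root_pow a = root_pow (a - b) * root_pow b"
    by (simp flip: root_pow_add)
  ultimately have "root_pow (a - b) = 1" by simp
  then show "a = b" by (simp add: root_pow_eq_1_iff)
qed simp

section \<open>Configurations and the pairing\<close>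

lemma configs_0 [simp]: "0 \<in> configs Q"
  by (simp add: configs_def)

lemma configs_add [intro]: "x \<in> configs Q \<Longrightarrow> y \<in> configs Q \<Longrightarrow> x + y \<in> configs Q"
  using Poly_Mapping.keys_add[of x y] by (auto simp: configs_def)

lemma configs_uminus [intro]: "x \<in> configs Q \<Longrightarrow> - x \<in> configs Q"
  by (simp add: configs_def)

lemma configs_diff [intro]: "x \<in> configs Q \<Longrightarrow> y \<in> configs Q \<Longrightarrow> x - y \<in> configs Q"
  using configs_add[of x Q "- y"] configs_uminus by auto

lemma configs_add_cancel: "y \<in> configs Q \<Longrightarrow> x + y \<in> configs Q \<longleftrightarrow> x \<in> configs Q"
  using configs_diff[of "x + y" Q y] by auto

lemma configs_diff_cancel: "y \<in> configs Q \<Longrightarrow> x - y \<in> configs Q \<longleftrightarrow> x \<in> configs Q"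
  using configs_add[of "x - y" Q y] by auto

lemma configs_sum [intro]: "(\<And>k. k \<in> K \<Longrightarrow> f k \<in> configs Q) \<Longrightarrow> sum f K \<in> configs Q"
  by (induction K rule: infinite_finite_induct) auto

lemma configs_single [simp]: "Poly_Mapping.single k v \<in> configs Q \<longleftrightarrow> k \<in> Q \<or> v = 0"
  by (auto simp: configs_def)

lemma configs_mono: "x \<in> configs Q \<Longrightarrow> Q \<subseteq> Q' \<Longrightarrow> x \<in> configs Q'"
  by (auto simp: configs_def)

lemma configs_lookup: "x \<in> configs Q \<longleftrightarrow> (\<forall>k. k \<notin> Q \<longrightarrow> Poly_Mapping.lookup x k = 0)"
  by (auto simp: configs_def in_keys_iff)

lemma poly_mapping_expand:
  fixes x :: "'a \<Rightarrow>\<^sub>0 'b::comm_monoid_add"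
  shows "(\<Sum>k\<in>Poly_Mapping.keys x. Poly_Mapping.single k (Poly_Mapping.lookup x k)) = x"
  by (rule poly_mapping_eqI)
    (auto simp: lookup_sum lookup_single when_def in_keys_iff sum.delta' cong: if_cong)

lemma pairing_superset:
  assumes "finite K" "Poly_Mapping.keys a \<subseteq> K"
  shows "pairing a b = (\<Sum>k\<in>K. Poly_Mapping.lookup a k * Poly_Mapping.lookup b k)"
  unfolding pairing_def using assms
  by (intro sum.mono_neutral_left) (auto simp: in_keys_iff)

lemma pairing_commute: "pairing a b = pairing b a"
  by (simp add: pairing_superset[of "Poly_Mapping.keys a \<union> Poly_Mapping.keys b"] mult.commute)

lemma pairing_add_left: "pairing (a + b) c = pairing a c + pairing b c"
  using Poly_Mapping.keys_add[of a b]
  by (simp add: pairing_superset[of "Poly_Mapping.keys a \<union> Poly_Mapping.keys b"]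
      lookup_add distrib_right sum.distrib)

lemma pairing_add_right: "pairing c (a + b) = pairing c a + pairing c b"
  by (metis pairing_add_left pairing_commute)

lemma pairing_0 [simp]: "pairing 0 a = 0" "pairing a 0 = 0"
  by (simp_all add: pairing_def)

lemma pairing_uminus: "pairing (- a) c = - pairing a c" "pairing c (- a) = - pairing c a"
  by (simp_all add: pairing_def sum_negf)

lemma pairing_diff_left: "pairing (a - b) c = pairing a c - pairing b c"
  by (metis diff_conv_add_uminus pairing_add_left pairing_uminus(1))

lemma pairing_sum_left: "pairing (sum f K) c = (\<Sum>k\<in>K. pairing (f k) c)"
  by (induction K rule: infinite_finite_induct) (simp_all add: pairing_add_left)

lemma pairing_single_right [simp]:
  "pairing a (Poly_Mapping.single k v) = Poly_Mapping.lookup a k * v"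
  by (simp add: pairing_def lookup_single when_def in_keys_iff sum.delta' if_distrib cong: if_cong)

lemma pairing_single_left [simp]:
  "pairing (Poly_Mapping.single k v) a = v * Poly_Mapping.lookup a k"
  by (simp add: pairing_commute[of "Poly_Mapping.single k v"] mult.commute)

lemma pairing_nonzero_keys:
  assumes "pairing a b \<noteq> 0"
  shows "\<exists>k. k \<in> Poly_Mapping.keys a \<and> k \<in> Poly_Mapping.keys b"
proof (rule ccontr)
  assume "\<not> ?thesis"
  then have "pairing a b = 0"
    unfolding pairing_def by (intro sum.neutral) (auto simp: in_keys_iff)
  with assms show False by simp
qed

text \<open>
  Test vectors supported on \<open>Q\<close> suffice for vectors supported on \<open>Q\<close>: the unit vectors read off
  the entries.
\<close>
lemma pairing_nondegenerate:
  assumes "a \<in> configs Q" "b \<in> configs Q" "\<And>y. y \<in> configs Q \<Longrightarrow> pairing a y = pairing b y"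
  shows "a = b"
proof (rule poly_mapping_eqI)
  fix k
  show "Poly_Mapping.lookup a k = Poly_Mapping.lookup b k"
  proof (cases "k \<in> Q")
    case True
    then show ?thesis using assms(3)[of "Poly_Mapping.single k 1"] by simp
  next
    case False
    then show ?thesis using assms(1,2) by (simp add: configs_lookup)
  qed
qed

text \<open>
  Every residue is a sum of ones, so additivity alone gives linearity.
\<close>
lemma additive_single:
  fixes h :: "('l, 'd::nontriv) config \<Rightarrow> 'd mod_ring"
  assumes add: "\<And>x y. x \<in> configs Q \<Longrightarrow> y \<in> configs Q \<Longrightarrow> h (x + y) = h x + h y" and "k \<in> Q"
  shows "h (Poly_Mapping.single k v) = v * h (Poly_Mapping.single k 1)"
proof -
  have h0: "h 0 = 0" using add[of 0 0] by simp
  have nat: "h (Poly_Mapping.single k (of_nat n)) = of_nat n * h (Poly_Mapping.single k 1)" for n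
  proof (induction n)
    case (Suc n)
    have "Poly_Mapping.single k (of_nat (Suc n) :: 'd mod_ring)
        = Poly_Mapping.single k 1 + Poly_Mapping.single k (of_nat n)"
      by (simp add: single_add)
    then show ?case using Suc add \<open>k \<in> Q\<close> by (simp add: distrib_right)
  qed (simp add: h0)
  show ?thesis using nat[of "nat (to_int_mod_ring v)"] by (simp only: of_nat_nat_to_int_mod_ring)
qed

lemma additive_sum:
  fixes h :: "('l, 'd::nontriv) config \<Rightarrow> 'b::ab_group_add"
  assumes add: "\<And>x y. x \<in> configs Q \<Longrightarrow> y \<in> configs Q \<Longrightarrow> h (x + y) = h x + h y"
    and "\<And>k. k \<in> K \<Longrightarrow> f k \<in> configs Q"
  shows "h (sum f K) = (\<Sum>k\<in>K. h (f k))"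
proof -
  have h0: "h 0 = 0" using add[of 0 0] by simp
  show ?thesis using assms(2)
    by (induction K rule: infinite_finite_induct) (auto simp: h0 add configs_sum)
qed

lemma additive_expand:
  fixes h :: "('l, 'd::nontriv) config \<Rightarrow> 'b::ab_group_add"
  assumes add: "\<And>x y. x \<in> configs Q \<Longrightarrow> y \<in> configs Q \<Longrightarrow> h (x + y) = h x + h y"
    and "x \<in> configs Q"
  shows "h x = (\<Sum>k\<in>Poly_Mapping.keys x. h (Poly_Mapping.single k (Poly_Mapping.lookup x k)))"
proof -
  have "h (\<Sum>k\<in>Poly_Mapping.keys x. Poly_Mapping.single k (Poly_Mapping.lookup x k))
      = (\<Sum>k\<in>Poly_Mapping.keys x. h (Poly_Mapping.single k (Poly_Mapping.lookup x k)))"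
    using assms by (intro additive_sum[OF add]) (auto simp: configs_def)
  then show ?thesis by (simp add: poly_mapping_expand)
qed

text \<open>
  Vanishing on all but finitely many unit vectors makes the representing vector finitely
  supported. An additive functional such as the sum of all coordinates is not of this form when
  \<open>Q\<close> is infinite.
\<close>
lemma additive_functional_is_pairing:
  fixes h :: "('l, 'd::nontriv) config \<Rightarrow> 'd mod_ring"
  assumes add: "\<And>x y. x \<in> configs Q \<Longrightarrow> y \<in> configs Q \<Longrightarrow> h (x + y) = h x + h y"
    and fin: "finite K" "K \<subseteq> Q" and off: "\<And>k. k \<in> Q - K \<Longrightarrow> h (Poly_Mapping.single k 1) = 0"
  shows "\<exists>z\<in>configs Q. \<forall>x\<in>configs Q. h x = pairing z x"
proof
  let ?z = "\<Sum>k\<in>K. Poly_Mapping.single k (h (Poly_Mapping.single k 1))"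
  show "?z \<in> configs Q" using fin by (intro configs_sum) auto
  have z: "Poly_Mapping.lookup ?z k = h (Poly_Mapping.single k 1)" if "k \<in> Q" for k
    using that off[of k] fin(1)
    by (auto simp: lookup_sum lookup_single when_def sum.delta' cong: if_cong)
  show "\<forall>x\<in>configs Q. h x = pairing ?z x"
  proof
    fix x :: "('l, 'd) config" assume x: "x \<in> configs Q"
    have "h x = (\<Sum>k\<in>Poly_Mapping.keys x. h (Poly_Mapping.single k (Poly_Mapping.lookup x k)))"
      by (rule additive_expand[OF add x])
    also have "\<dots> = (\<Sum>k\<in>Poly_Mapping.keys x.
        Poly_Mapping.lookup x k * h (Poly_Mapping.single k 1))"
      using x by (intro sum.cong refl additive_single[OF add]) (auto simp: configs_def)
    also have "\<dots> = pairing x ?z"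
      unfolding pairing_def using x by (intro sum.cong refl) (auto simp: z configs_def subset_iff)
    finally show "h x = pairing ?z x" by (simp add: pairing_commute)
  qed
qed

definition restr :: "'k set \<Rightarrow> ('k \<Rightarrow>\<^sub>0 'b::comm_monoid_add) \<Rightarrow> ('k \<Rightarrow>\<^sub>0 'b)" where
  "restr K x = (\<Sum>k\<in>Poly_Mapping.keys x \<inter> K. Poly_Mapping.single k (Poly_Mapping.lookup x k))"

lemma lookup_restr: "Poly_Mapping.lookup (restr K x) k = (if k \<in> K then Poly_Mapping.lookup x k else 0)"
  by (auto simp: restr_def lookup_sum lookup_single when_def in_keys_iff sum.delta' cong: if_cong)

lemma keys_restr: "Poly_Mapping.keys (restr K x) = Poly_Mapping.keys x \<inter> K"
  by (auto simp: in_keys_iff lookup_restr split: if_splits)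

lemma restr_add: "restr K (x + y) = restr K x + restr K y"
  by (rule poly_mapping_eqI) (simp add: lookup_restr lookup_add)

lemma restr_configs [simp]: "restr Q x \<in> configs Q"
  by (simp add: configs_lookup lookup_restr)

lemma restr_configs_mono: "x \<in> configs Q' \<Longrightarrow> restr Q x \<in> configs Q'"
  by (simp add: configs_lookup lookup_restr)

lemma restr_id: "x \<in> configs Q \<Longrightarrow> restr Q x = x"
  by (rule poly_mapping_eqI) (simp add: configs_lookup lookup_restr)

lemma restr_disjoint: "x \<in> configs Q' \<Longrightarrow> Q \<inter> Q' = {} \<Longrightarrow> restr Q x = 0"
  by (rule poly_mapping_eqI) (auto simp: configs_lookup lookup_restr)

lemma pairing_restr: "pairing (restr K x) y = pairing x (restr K y)"
proof -
  have "pairing (restr K x) y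
      = (\<Sum>k\<in>Poly_Mapping.keys x. Poly_Mapping.lookup (restr K x) k * Poly_Mapping.lookup y k)"
    by (intro pairing_superset) (auto simp: keys_restr)
  also have "\<dots> = pairing x (restr K y)"
    unfolding pairing_def by (intro sum.cong refl) (simp add: lookup_restr)
  finally show ?thesis .
qed


section \<open>Adjoint pairs of local maps\<close>

text \<open>
  The entries of the linear maps below form infinite matrices with finitely supported columns.
  Having an adjoint means that the rows are finitely supported as well. By nondegeneracy of the
  pairing, the existence of an adjoint already implies additivity.
\<close>
definition adj_on ::
  "'l qudit set \<Rightarrow> (('l, 'd::nontriv) config \<Rightarrow> ('l, 'd) config) \<Rightarrow> (('l, 'd) config \<Rightarrow> ('l, 'd) config) \<Rightarrow> bool"
where
  "adj_on Q f g \<longleftrightarrow>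
     (\<forall>x\<in>configs Q. f x \<in> configs Q \<and> g x \<in> configs Q) \<and>
     (\<forall>x\<in>configs Q. \<forall>y\<in>configs Q. pairing (f x) y = pairing x (g y))"

lemma adj_onI:
  assumes "\<And>x. x \<in> configs Q \<Longrightarrow> f x \<in> configs Q" "\<And>x. x \<in> configs Q \<Longrightarrow> g x \<in> configs Q"
    "\<And>x y. x \<in> configs Q \<Longrightarrow> y \<in> configs Q \<Longrightarrow> pairing (f x) y = pairing x (g y)"
  shows "adj_on Q f g"
  using assms by (auto simp: adj_on_def)

lemma adj_on_sym: "adj_on Q f g \<Longrightarrow> adj_on Q g f"
  unfolding adj_on_def by (metis pairing_commute)

lemma adj_on_closed: "adj_on Q f g \<Longrightarrow> x \<in> configs Q \<Longrightarrow> f x \<in> configs Q"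
  by (simp add: adj_on_def)

lemma adj_on_pairing:
  "adj_on Q f g \<Longrightarrow> x \<in> configs Q \<Longrightarrow> y \<in> configs Q \<Longrightarrow> pairing (f x) y = pairing x (g y)"
  by (simp add: adj_on_def)

lemma adj_on_add:
  assumes "adj_on Q f g" "x \<in> configs Q" "y \<in> configs Q"
  shows "f (x + y) = f x + f y"
  using assms
  by (intro pairing_nondegenerate[of _ Q])
    (auto simp: adj_on_def pairing_add_left configs_add)

lemma adj_on_0: "adj_on Q f g \<Longrightarrow> f 0 = 0"
  using adj_on_add[of Q f g 0 0] by simp

lemma adj_on_uminus:
  assumes "adj_on Q f g" "x \<in> configs Q"
  shows "f (- x) = - f x"
  using adj_on_add[OF assms configs_uminus[OF assms(2)]] adj_on_0[OF assms(1)]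
  by (simp add: eq_neg_iff_add_eq_0 add.commute)

lemma adj_on_diff:
  assumes "adj_on Q f g" "x \<in> configs Q" "y \<in> configs Q"
  shows "f (x - y) = f x - f y"
  using adj_on_add[OF assms(1,2) configs_uminus[OF assms(3)]] adj_on_uminus[OF assms(1,3)]
  by simp

lemma adj_on_id: "adj_on Q (\<lambda>x. x) (\<lambda>x. x)"
  by (simp add: adj_on_def)

lemma adj_on_comp: "adj_on Q f g \<Longrightarrow> adj_on Q f' g' \<Longrightarrow> adj_on Q (\<lambda>x. f (f' x)) (\<lambda>x. g' (g x))"
  by (simp add: adj_on_def)

lemma adj_on_plus:
  "adj_on Q f g \<Longrightarrow> adj_on Q f' g' \<Longrightarrow> adj_on Q (\<lambda>x. f x + f' x) (\<lambda>x. g x + g' x)"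
  by (auto simp: adj_on_def pairing_add_left pairing_add_right)

lemma adj_on_minus: "adj_on Q f g \<Longrightarrow> adj_on Q (\<lambda>x. - f x) (\<lambda>x. - g x)"
  by (auto simp: adj_on_def pairing_uminus)

text \<open>
  For additive maps this says that the matrix is band-diagonal. In terms of supports, locality
  of sums and of compositions needs no matrix calculations.
\<close>
definition local_map ::
  "('l \<Rightarrow> 'l \<Rightarrow> real) \<Rightarrow> 'l qudit set \<Rightarrow> (('l, 'd::nontriv) config \<Rightarrow> ('l, 'd) config) \<Rightarrow> bool" where
  "local_map D Q f \<longleftrightarrow>
     (\<exists>r. \<forall>x\<in>configs Q. \<forall>l\<in>Poly_Mapping.keys (f x). \<exists>k\<in>Poly_Mapping.keys x. D (fst k) (fst l) \<le> r)"

lemma local_map_common_radius: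
  assumes "local_map D Q f" "local_map D Q g"
  obtains r where
    "\<And>x l. x \<in> configs Q \<Longrightarrow> l \<in> Poly_Mapping.keys (f x) \<Longrightarrow> \<exists>k\<in>Poly_Mapping.keys x. D (fst k) (fst l) \<le> r"
    "\<And>x l. x \<in> configs Q \<Longrightarrow> l \<in> Poly_Mapping.keys (g x) \<Longrightarrow> \<exists>k\<in>Poly_Mapping.keys x. D (fst k) (fst l) \<le> r"
proof -
  obtain r s where
    r: "\<And>x l. x \<in> configs Q \<Longrightarrow> l \<in> Poly_Mapping.keys (f x) \<Longrightarrow> \<exists>k\<in>Poly_Mapping.keys x. D (fst k) (fst l) \<le> r" and
    s: "\<And>x l. x \<in> configs Q \<Longrightarrow> l \<in> Poly_Mapping.keys (g x) \<Longrightarrow> \<exists>k\<in>Poly_Mapping.keys x. D (fst k) (fst l) \<le> s"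
    using assms unfolding local_map_def by metis
  show ?thesis
    by (rule that[of "max r s"]; meson r s max.coboundedI1 max.coboundedI2)
qed

lemma local_map_plus:
  assumes "local_map D Q f" "local_map D Q g"
  shows "local_map D Q (\<lambda>x. f x + g x)"
  using local_map_common_radius[OF assms] Poly_Mapping.keys_add unfolding local_map_def by (metis UnE subsetD)

lemma local_map_minus: "local_map D Q f \<Longrightarrow> local_map D Q (\<lambda>x. - f x)"
  unfolding local_map_def by simp

lemma qudits_site: "k \<in> qudits \<Lambda> q \<Longrightarrow> fst k \<in> \<Lambda>"
  by (auto simp: qudits_def)

lemma configs_keys: "x \<in> configs Q \<Longrightarrow> k \<in> Poly_Mapping.keys x \<Longrightarrow> k \<in> Q"
  by (auto simp: configs_def)

context Metric_space
begin

lemma local_map_id: "local_map d (qudits M q) (\<lambda>x. x)"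
  unfolding local_map_def
proof (intro exI ballI)
  fix x :: "('a, 'd::nontriv) config" and l
  assume "x \<in> configs (qudits M q)" "l \<in> Poly_Mapping.keys x"
  then have "fst l \<in> M" using configs_keys qudits_site by metis
  then show "\<exists>k\<in>Poly_Mapping.keys x. d (fst k) (fst l) \<le> 0"
    using \<open>l \<in> Poly_Mapping.keys x\<close> by (intro bexI[of _ l]) auto
qed

lemma local_map_comp:
  assumes f: "local_map d (qudits M q) f" and g: "local_map d (qudits M q) g"
    and cl: "\<And>x. x \<in> configs (qudits M q) \<Longrightarrow> f x \<in> configs (qudits M q)"
      "\<And>x. x \<in> configs (qudits M q) \<Longrightarrow> g x \<in> configs (qudits M q)"
  shows "local_map d (qudits M q) (\<lambda>x. f (g x))"
proof -
  let ?Q = "qudits M q"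
  obtain r where
    rf: "\<And>x l. x \<in> configs ?Q \<Longrightarrow> l \<in> Poly_Mapping.keys (f x) \<Longrightarrow> \<exists>k\<in>Poly_Mapping.keys x. d (fst k) (fst l) \<le> r" and
    rg: "\<And>x l. x \<in> configs ?Q \<Longrightarrow> l \<in> Poly_Mapping.keys (g x) \<Longrightarrow> \<exists>k\<in>Poly_Mapping.keys x. d (fst k) (fst l) \<le> r"
    using local_map_common_radius[OF f g] by metis
  show ?thesis
    unfolding local_map_def
  proof (intro exI ballI)
    fix x l assume x: "x \<in> configs ?Q" and l: "l \<in> Poly_Mapping.keys (f (g x))"
    obtain m where m: "m \<in> Poly_Mapping.keys (g x)" "d (fst m) (fst l) \<le> r"
      using rf[OF cl(2)[OF x] l] by blast
    obtain k where k: "k \<in> Poly_Mapping.keys x" "d (fst k) (fst m) \<le> r"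
      using rg[OF x m(1)] by blast
    have "fst k \<in> M" "fst m \<in> M" "fst l \<in> M"
      using k(1) m(1) l x cl by (meson configs_keys qudits_site)+
    then have "d (fst k) (fst l) \<le> r + r" using triangle[of "fst k" "fst m" "fst l"] k m by simp
    then show "\<exists>k\<in>Poly_Mapping.keys x. d (fst k) (fst l) \<le> r + r" using k by blast
  qed
qed

end


section \<open>Pauli operators in the algebra of local operators\<close>

text \<open>
  All matrices on the system, local or not. The product of such a matrix with a Pauli operator
  is a sum with at most one nonzero term.
\<close>
definition mats :: "'l qudit set \<Rightarrow> ('l, 'd::nontriv) oper set" where
  "mats Q = {A. \<forall>c c'. A c c' \<noteq> 0 \<longrightarrow> c \<in> configs Q \<and> c' \<in> configs Q}"

lemma local_ops_mats: "A \<in> local_ops \<Lambda> q \<Longrightarrow> A \<in> mats (qudits \<Lambda> q)"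
  by (auto simp: local_ops_def mats_def)

lemma pauli_space_iff: "u \<in> pauli_space Q \<longleftrightarrow> fst u \<in> configs Q \<and> snd u \<in> configs Q"
  by (cases u) (simp add: pauli_space_def)

lemma pauli_space_pair [simp]: "(x, z) \<in> pauli_space Q \<longleftrightarrow> x \<in> configs Q \<and> z \<in> configs Q"
  by (simp add: pauli_space_iff)

lemma pauli_space_add [intro]: "u \<in> pauli_space Q \<Longrightarrow> v \<in> pauli_space Q \<Longrightarrow> u + v \<in> pauli_space Q"
  by (auto simp: pauli_space_iff)

lemma pauli_space_0 [simp]: "0 \<in> pauli_space Q"
  by (simp add: pauli_space_iff)

lemma op_scale_1 [simp]: "op_scale 1 A = A"
  by (simp add: op_scale_def)

lemma op_scale_scale [simp]: "op_scale a (op_scale b A) = op_scale (a * b) A"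
  by (simp add: op_scale_def mult.assoc)

lemma op_one_pauli: "op_one Q = pauli Q 0"
  by (auto simp: op_one_def pauli_def fun_eq_iff)

lemma pauli_mats: "u \<in> pauli_space Q \<Longrightarrow> op_scale a (pauli Q u) \<in> mats Q"
  by (auto simp: mats_def op_scale_def pauli_def pauli_space_iff split: if_splits)

lemma op_mult_pauli_left:
  assumes "u \<in> pauli_space Q" "B \<in> mats Q"
  shows "op_mult (op_scale a (pauli Q u)) B c c' =
    a * root_pow (pairing (snd u) (c - fst u)) * B (c - fst u) c'"
proof -
  have "op_scale a (pauli Q u) c b * B b c' =
      (a * root_pow (pairing (snd u) b) * B b c' when b = c - fst u)" for b
    using assms(2) by (auto simp: op_scale_def pauli_def mats_def when_def)
  then show ?thesis unfolding op_mult_def by simp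
qed

lemma op_mult_pauli_right:
  assumes "u \<in> pauli_space Q" "B \<in> mats Q"
  shows "op_mult B (op_scale a (pauli Q u)) c c' =
    a * root_pow (pairing (snd u) c') * B c (c' + fst u)"
proof -
  have "B c b * op_scale a (pauli Q u) b c' =
      (a * root_pow (pairing (snd u) c') * B c b when b = c' + fst u)" for b
    using assms configs_add_cancel[of "fst u" Q c']
    by (auto simp: op_scale_def pauli_def mats_def when_def pauli_space_iff)
  then show ?thesis unfolding op_mult_def by simp
qed

lemma pauli_mult:
  assumes "u \<in> pauli_space Q" "v \<in> pauli_space Q"
  shows "op_mult (op_scale a (pauli Q u)) (op_scale b (pauli Q v)) =
    op_scale (a * b * root_pow (pairing (snd u) (fst v))) (pauli Q (u + v))"
proof (intro ext)
  fix c c'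
  have "c - fst u = c' + fst v \<longleftrightarrow> c = c' + (fst u + fst v)"
    by (auto simp: algebra_simps)
  then show "op_mult (op_scale a (pauli Q u)) (op_scale b (pauli Q v)) c c' =
    op_scale (a * b * root_pow (pairing (snd u) (fst v))) (pauli Q (u + v)) c c'"
    unfolding op_mult_pauli_left[OF assms(1) pauli_mats[OF assms(2)]]
    by (auto simp: op_scale_def pauli_def pairing_add_left pairing_add_right root_pow_add
        algebra_simps)
qed

text \<open>
  In the column of the zero vector the only nonzero entry of a multiple of \<open>X\<^sup>x Z\<^sup>z\<close> is the factor,
  in row \<open>x\<close>. Comparing with the entries at \<open>(x + y, y)\<close> then yields the characters
  \<open>y \<mapsto> \<omega>\<^bsup>z\<cdot>y\<^esup>\<close>.
\<close>
lemma pauli_phase_inject: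
  assumes eq: "op_scale a (pauli Q u) = op_scale b (pauli Q v)" and "a \<noteq> 0"
    and uv: "u \<in> pauli_space Q" "v \<in> pauli_space Q"
  shows "u = v \<and> a = b"
proof -
  have e: "op_scale a (pauli Q u) (c' + fst u) c' = op_scale b (pauli Q v) (c' + fst u) c'" for c'
    by (simp add: eq)
  have "op_scale b (pauli Q v) (fst u) 0 \<noteq> 0"
    using e[of 0] \<open>a \<noteq> 0\<close> by (simp add: op_scale_def pauli_def)
  then have fst: "fst u = fst v" by (auto simp: op_scale_def pauli_def split: if_splits)
  with e[of 0] have ab: "a = b" by (simp add: op_scale_def pauli_def)
  have "pairing (snd u) y = pairing (snd v) y" if "y \<in> configs Q" for y
    using e[of y] that fst ab \<open>a \<noteq> 0\<close> by (simp add: op_scale_def pauli_def root_pow_inject)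
  then have "snd u = snd v" using uv pairing_nondegenerate[of "snd u" Q "snd v"]
    by (auto simp: pauli_space_iff)
  with fst ab show ?thesis by (simp add: prod_eq_iff)
qed

lemma agree_on_keys: "agree_on F c c' \<longleftrightarrow> (\<forall>k\<in>Poly_Mapping.keys (c - c'). fst k \<notin> F)"
proof -
  have "agree_on F c c' \<longleftrightarrow>
      (\<forall>k. fst k \<in> F \<longrightarrow> Poly_Mapping.lookup c k = Poly_Mapping.lookup c' k)"
    unfolding agree_on_def by (metis fst_conv prod.collapse)
  then show ?thesis by (auto simp: in_keys_iff lookup_minus)
qed

lemma agree_on_Compl_keys: "agree_on (- F) c c' \<longleftrightarrow> (\<forall>k\<in>Poly_Mapping.keys (c - c'). fst k \<in> F)"
  by (simp add: agree_on_keys)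

lemma agree_on_eq: "agree_on F c c' \<Longrightarrow> agree_on (- F) c c' \<Longrightarrow> c = c'"
  by (rule poly_mapping_eqI) (auto simp: agree_on_def split_paired_All)

text \<open>
  If \<open>b\<close>, \<open>b'\<close> and \<open>c\<close>, \<open>c'\<close> agree off \<open>G\<close> and the pairs have the same restrictions to \<open>G\<close>, then either
  both pairs agree off the smaller set \<open>F\<close>, or neither does and both entries are \<open>0\<close>.
\<close>
lemma supported_on_mono:
  fixes A :: "('l, 'd::nontriv) oper"
  assumes sup: "supported_on Q F A" and "F \<subseteq> G"
  shows "supported_on Q G A"
  unfolding supported_on_def
proof (intro conjI ballI impI)
  have diag: "agree_on (- F) c c'" if "c \<in> configs Q" "c' \<in> configs Q" "A c c' \<noteq> 0" for c c'
    using sup that unfolding supported_on_def by blast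
  have dep: "A b b' = A c c'"
    if "b \<in> configs Q" "b' \<in> configs Q" "c \<in> configs Q" "c' \<in> configs Q"
      "agree_on F b c" "agree_on F b' c'" "agree_on (- F) b b'" "agree_on (- F) c c'"
    for b b' c c' :: "('l, 'd) config"
    using sup that unfolding supported_on_def by blast
  {
    fix c c' assume "c \<in> configs Q" "c' \<in> configs Q" "A c c' \<noteq> 0"
    then show "agree_on (- G) c c'" using diag[of c c'] \<open>F \<subseteq> G\<close> by (auto simp: agree_on_def)
  }
  fix b b' c c' :: "('l, 'd) config"
  assume *: "b \<in> configs Q" "b' \<in> configs Q" "c \<in> configs Q" "c' \<in> configs Q"
    and **: "agree_on G b c \<and> agree_on G b' c' \<and> agree_on (- G) b b' \<and> agree_on (- G) c c'"
  have F: "agree_on F b c" "agree_on F b' c'" using ** \<open>F \<subseteq> G\<close> by (auto simp: agree_on_def)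
  have "agree_on (- F) b b' \<longleftrightarrow> agree_on (- F) c c'"
    using ** unfolding agree_on_def by (metis ComplD ComplI)
  then show "A b b' = A c c'" using dep[OF * F] diag * by metis
qed

lemma pauli_supported:
  assumes "u \<in> pauli_space Q" "fst ` Poly_Mapping.keys (fst u) \<subseteq> F" "fst ` Poly_Mapping.keys (snd u) \<subseteq> F"
  shows "supported_on Q F (op_scale a (pauli Q u))"
  unfolding supported_on_def
proof (intro conjI ballI impI)
  fix c c' :: "('a, 'b) config" assume "op_scale a (pauli Q u) c c' \<noteq> 0"
  then have "c = c' + fst u" by (auto simp: op_scale_def pauli_def split: if_splits)
  then show "agree_on (- F) c c'" using assms by (auto simp: agree_on_Compl_keys)
next
  fix b b' c c' :: "('a, 'b) config"
  assume *: "b' \<in> configs Q" "c' \<in> configs Q"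
    and **: "agree_on F b c \<and> agree_on F b' c' \<and> agree_on (- F) b b' \<and> agree_on (- F) c c'"
  have u: "agree_on (- F) (fst u) 0" using assms by (auto simp: agree_on_Compl_keys)
  have "b = b' + fst u \<longleftrightarrow> c = c' + fst u"
  proof -
    have "b = b' + fst u \<longleftrightarrow> agree_on F b (b' + fst u) \<and> agree_on (- F) b (b' + fst u)"
      using agree_on_eq by (auto simp: agree_on_def)
    also have "\<dots> \<longleftrightarrow> agree_on F c (c' + fst u) \<and> agree_on (- F) c (c' + fst u)"
      using ** u by (auto simp: agree_on_def lookup_add)
    also have "\<dots> \<longleftrightarrow> c = c' + fst u"
      using agree_on_eq by (auto simp: agree_on_def)
    finally show ?thesis .
  qed
  moreover have "pairing (snd u) b' = pairing (snd u) c'"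
    unfolding pairing_def
  proof (intro sum.cong refl)
    fix k assume "k \<in> Poly_Mapping.keys (snd u)"
    then have "fst k \<in> F" using assms by auto
    then have "Poly_Mapping.lookup b' k = Poly_Mapping.lookup c' k"
      using ** by (metis agree_on_def prod.collapse)
    then show "Poly_Mapping.lookup (snd u) k * Poly_Mapping.lookup b' k
      = Poly_Mapping.lookup (snd u) k * Poly_Mapping.lookup c' k" by simp
  qed
  ultimately show "op_scale a (pauli Q u) b b' = op_scale a (pauli Q u) c c'"
    using * by (simp add: op_scale_def pauli_def)
qed

text \<open>
  The entry at \<open>(x, 0)\<close> does not vanish, so \<open>x\<close> lies over \<open>F\<close>. For a unit vector \<open>e\<close> at a qudit off \<open>F\<close>,
  the entries at \<open>(x + e, e)\<close> and \<open>(x, 0)\<close> have to agree, so \<open>z\<close> has no component at that qudit.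
\<close>
lemma supported_pauliD:
  assumes sup: "supported_on Q F (op_scale a (pauli Q u))" and "a \<noteq> 0" and u: "u \<in> pauli_space Q"
  shows "fst ` Poly_Mapping.keys (fst u) \<subseteq> F" "fst ` Poly_Mapping.keys (snd u) \<subseteq> F"
proof -
  have ne: "op_scale a (pauli Q u) (fst u) 0 \<noteq> 0"
    using \<open>a \<noteq> 0\<close> by (simp add: op_scale_def pauli_def)
  then have ag: "agree_on (- F) (fst u) 0"
    using sup u unfolding supported_on_def pauli_space_iff by (meson configs_0)
  then show F1: "fst ` Poly_Mapping.keys (fst u) \<subseteq> F" by (auto simp: agree_on_Compl_keys)
  show "fst ` Poly_Mapping.keys (snd u) \<subseteq> F"
  proof safe
    fix i m assume k: "(i, m) \<in> Poly_Mapping.keys (snd u)"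
    show "fst (i, m) \<in> F"
    proof (rule ccontr)
      assume nF: "fst (i, m) \<notin> F"
      let ?e = "Poly_Mapping.single (i, m) 1 :: ('a, 'b) config"
      have e: "?e \<in> configs Q" using k u configs_keys[of "snd u" Q "(i, m)"]
        by (simp add: pauli_space_iff)
      have "agree_on F (?e + fst u) (fst u)" "agree_on F ?e 0" "agree_on (- F) (?e + fst u) ?e"
        using nF ag by (auto simp: agree_on_def lookup_add lookup_single when_def)
      then have "op_scale a (pauli Q u) (?e + fst u) ?e = op_scale a (pauli Q u) (fst u) 0"
        using sup ag u e configs_0 configs_add unfolding supported_on_def pauli_space_iff by metis
      then have "root_pow (pairing (snd u) ?e) = 1"
        using e \<open>a \<noteq> 0\<close> by (simp add: op_scale_def pauli_def)
      then show False using k by (simp add: root_pow_eq_1_iff in_keys_iff)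
    qed
  qed
qed

lemma pauli_local:
  assumes "u \<in> pauli_space (qudits \<Lambda> q)"
  shows "op_scale a (pauli (qudits \<Lambda> q) u) \<in> local_ops \<Lambda> q"
proof -
  let ?F = "fst ` (Poly_Mapping.keys (fst u) \<union> Poly_Mapping.keys (snd u))"
  have "supported_on (qudits \<Lambda> q) ?F (op_scale a (pauli (qudits \<Lambda> q) u))"
    by (rule pauli_supported[OF assms]) auto
  moreover have "finite ?F" by simp
  moreover have "?F \<subseteq> \<Lambda>"
    using assms unfolding pauli_space_iff by (auto dest: configs_keys qudits_site)
  ultimately show ?thesis
    using pauli_mats[OF assms, of a] unfolding local_ops_def mats_def mem_Collect_eq by meson
qed

lemma op_scale_local:
  fixes A :: "('l, 'd::nontriv) oper"
  assumes "A \<in> local_ops \<Lambda> q"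
  shows "op_scale a A \<in> local_ops \<Lambda> q"
proof -
  obtain F where F: "finite F" "F \<subseteq> \<Lambda>" "supported_on (qudits \<Lambda> q) F A"
    using assms by (auto simp: local_ops_def)
  have "supported_on (qudits \<Lambda> q) F (op_scale a A)"
    unfolding supported_on_def op_scale_def
  proof (intro conjI ballI impI)
    fix c c' assume "c \<in> configs (qudits \<Lambda> q)" "c' \<in> configs (qudits \<Lambda> q)" "a * A c c' \<noteq> 0"
    moreover from this have "A c c' \<noteq> 0" by auto
    ultimately show "agree_on (- F) c c'" using F(3) unfolding supported_on_def by blast
  next
    fix b b' c c' :: "('l, 'd) config"
    assume "b \<in> configs (qudits \<Lambda> q)" "b' \<in> configs (qudits \<Lambda> q)"
      "c \<in> configs (qudits \<Lambda> q)" "c' \<in> configs (qudits \<Lambda> q)"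
      "agree_on F b c \<and> agree_on F b' c' \<and> agree_on (- F) b b' \<and> agree_on (- F) c c'"
    then have "A b b' = A c c'" using F(3) unfolding supported_on_def by blast
    then show "a * A b b' = a * A c c'" by simp
  qed
  then show ?thesis using assms F unfolding local_ops_def op_scale_def by auto
qed

text \<open>
  On a finite set \<open>G\<close> of sites that contains the supports of both factors, the product with a
  Pauli operator shifts one index inside \<open>G\<close> and multiplies by a phase depending on coordinates
  inside \<open>G\<close> only.
\<close>
lemma op_mult_pauli_local:
  fixes A :: "('l, 'd::nontriv) oper"
  assumes A: "A \<in> local_ops \<Lambda> q" and u: "u \<in> pauli_space (qudits \<Lambda> q)"
  shows "op_mult (op_scale a (pauli (qudits \<Lambda> q) u)) A \<in> local_ops \<Lambda> q"
    and "op_mult A (op_scale a (pauli (qudits \<Lambda> q) u)) \<in> local_ops \<Lambda> q"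
proof -
  let ?Q = "qudits \<Lambda> q"
  let ?P = "op_scale a (pauli ?Q u)"
  obtain F where F: "finite F" "F \<subseteq> \<Lambda>" "supported_on ?Q F A"
    using A by (auto simp: local_ops_def)
  define G where "G = F \<union> fst ` (Poly_Mapping.keys (fst u) \<union> Poly_Mapping.keys (snd u))"
  have G: "finite G" "G \<subseteq> \<Lambda>"
    using F u unfolding G_def pauli_space_iff by (auto dest: configs_keys qudits_site)
  have sup: "supported_on ?Q G A" using supported_on_mono[OF F(3)] by (auto simp: G_def)
  have ux: "fst u \<in> configs ?Q" using u by (simp add: pauli_space_iff)
  have uG: "agree_on (- G) (fst u) 0" unfolding agree_on_Compl_keys by (auto simp: G_def)
  have z: "pairing (snd u) b = pairing (snd u) c" if "agree_on G b c" for b c :: "('l, 'd) config"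
    unfolding pairing_def
  proof (intro sum.cong refl)
    fix k assume "k \<in> Poly_Mapping.keys (snd u)"
    then have "fst k \<in> G" by (auto simp: G_def)
    then have "Poly_Mapping.lookup b k = Poly_Mapping.lookup c k"
      using that by (metis agree_on_def prod.collapse)
    then show "Poly_Mapping.lookup (snd u) k * Poly_Mapping.lookup b k
      = Poly_Mapping.lookup (snd u) k * Poly_Mapping.lookup c k" by simp
  qed
  have mA: "A \<in> mats ?Q" using A by (rule local_ops_mats)
  have L: "op_mult ?P A c c' = a * root_pow (pairing (snd u) (c - fst u)) * A (c - fst u) c'" for c c'
    by (rule op_mult_pauli_left[OF u mA])
  have R: "op_mult A ?P c c' = a * root_pow (pairing (snd u) c') * A c (c' + fst u)" for c c'
    by (rule op_mult_pauli_right[OF u mA])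
  have s1: "agree_on (- G) c c'" if "A c c' \<noteq> 0" for c c'
    using sup that mA unfolding supported_on_def mats_def by blast
  have s2: "A b b' = A c c'"
    if "b \<in> configs ?Q" "b' \<in> configs ?Q" "c \<in> configs ?Q" "c' \<in> configs ?Q"
      "agree_on G b c" "agree_on G b' c'" "agree_on (- G) b b'" "agree_on (- G) c c'"
    for b b' c c' :: "('l, 'd) config"
    using sup that unfolding supported_on_def by blast
  have "op_mult ?P A \<in> mats ?Q"
    using mA configs_diff_cancel[OF ux] unfolding mats_def mem_Collect_eq L by auto
  moreover have "supported_on ?Q G (op_mult ?P A)"
    unfolding supported_on_def
  proof (intro conjI ballI impI)
    fix c c' assume "op_mult ?P A c c' \<noteq> 0"
    then have "agree_on (- G) (c - fst u) c'" unfolding L by (intro s1) auto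
    then show "agree_on (- G) c c'" using uG by (auto simp: agree_on_def lookup_minus)
  next
    fix b b' c c' :: "('l, 'd) config"
    assume *: "b \<in> configs ?Q" "b' \<in> configs ?Q" "c \<in> configs ?Q" "c' \<in> configs ?Q"
      and **: "agree_on G b c \<and> agree_on G b' c' \<and> agree_on (- G) b b' \<and> agree_on (- G) c c'"
    have g: "agree_on G (b - fst u) (c - fst u)" "agree_on (- G) (b - fst u) b'"
      "agree_on (- G) (c - fst u) c'"
      using ** uG by (auto simp: agree_on_def lookup_minus)
    have "A (b - fst u) b' = A (c - fst u) c'"
      using * ** ux g by (intro s2) auto
    then show "op_mult ?P A b b' = op_mult ?P A c c'" unfolding L using z[OF g(1)] by simp
  qed
  ultimately show "op_mult ?P A \<in> local_ops \<Lambda> q"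
    using G unfolding local_ops_def mats_def mem_Collect_eq by meson
  have "op_mult A ?P \<in> mats ?Q"
    using mA configs_add_cancel[OF ux] unfolding mats_def mem_Collect_eq R by auto
  moreover have "supported_on ?Q G (op_mult A ?P)"
    unfolding supported_on_def
  proof (intro conjI ballI impI)
    fix c c' assume "op_mult A ?P c c' \<noteq> 0"
    then have "agree_on (- G) c (c' + fst u)" unfolding R by (intro s1) auto
    then show "agree_on (- G) c c'" using uG by (auto simp: agree_on_def lookup_add)
  next
    fix b b' c c' :: "('l, 'd) config"
    assume *: "b \<in> configs ?Q" "b' \<in> configs ?Q" "c \<in> configs ?Q" "c' \<in> configs ?Q"
      and **: "agree_on G b c \<and> agree_on G b' c' \<and> agree_on (- G) b b' \<and> agree_on (- G) c c'"
    have g: "agree_on G (b' + fst u) (c' + fst u)" "agree_on (- G) b (b' + fst u)"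
      "agree_on (- G) c (c' + fst u)"
      using ** uG by (auto simp: agree_on_def lookup_add)
    have "A b (b' + fst u) = A c (c' + fst u)"
      using * ** ux g by (intro s2) auto
    then show "op_mult A ?P b b' = op_mult A ?P c c'" unfolding R using z[of b' c'] ** by simp
  qed
  ultimately show "op_mult A ?P \<in> local_ops \<Lambda> q"
    using G unfolding local_ops_def mats_def mem_Collect_eq by meson
qed


section \<open>The groups generated by the X or the Z operators\<close>

lemma norm_one_cnj: "cmod a = 1 \<Longrightarrow> cnj a * a = 1"
  by (metis complex_norm_square mult.commute of_real_1 one_power2)

text \<open>
  The inverse is unique since left multiplication by a Pauli operator permutes the rows up to
  phases, so every entry of the other factor can be recovered from the product. The condition on
  \<open>z \<cdot> x\<close> removes the phase from \<open>(X\<^sup>x Z\<^sup>z)\<^sup>-\<^sup>1\<close>.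
\<close>
lemma pauli_inverse:
  assumes u: "u \<in> pauli_space (qudits \<Lambda> q)" and a: "cmod a = 1" and sq: "pairing (snd u) (fst u) = 0"
  shows "op_scale a (pauli (qudits \<Lambda> q) u) \<in> carrier (units_of (local_monoid \<Lambda> q))"
    and "inv\<^bsub>units_of (local_monoid \<Lambda> q)\<^esub> (op_scale a (pauli (qudits \<Lambda> q) u)) =
      op_scale (cnj a) (pauli (qudits \<Lambda> q) (- u))"
proof -
  let ?Q = "qudits \<Lambda> q" and ?M = "local_monoid \<Lambda> q"
  let ?x = "op_scale a (pauli ?Q u)" and ?y = "op_scale (cnj a) (pauli ?Q (- u))"
  have mu: "- u \<in> pauli_space ?Q" using u by (auto simp: pauli_space_iff)
  have xy: "op_mult ?x ?y = op_one ?Q" "op_mult ?y ?x = op_one ?Q"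
    using norm_one_cnj[OF a] sq
    by (simp_all add: pauli_mult[OF u mu] pauli_mult[OF mu u] pairing_uminus op_one_pauli mult.commute)
  have loc: "?x \<in> local_ops \<Lambda> q" "?y \<in> local_ops \<Lambda> q"
    using pauli_local u mu by blast+
  have un: "?x \<in> Units ?M" "?y \<in> Units ?M"
    using xy loc unfolding Units_def local_monoid_def by auto
  then show "?x \<in> carrier (units_of ?M)" by (simp add: units_of_def)
  have "y = ?y" if y: "y \<in> local_ops \<Lambda> q" "op_mult ?x y = op_one ?Q" for y
  proof (intro ext)
    fix c c'
    have "op_mult ?x y (c + fst u) c' = op_mult ?x ?y (c + fst u) c'" using y xy by simp
    then show "y c c' = ?y c c'"
      using op_mult_pauli_left[OF u local_ops_mats[OF y(1)], of a "c + fst u" c']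
        op_mult_pauli_left[OF u local_ops_mats[OF loc(2)], of a "c + fst u" c'] a
      by auto
  qed
  then show "inv\<^bsub>units_of ?M\<^esub> ?x = ?y"
    unfolding m_inv_def using un xy
    by (intro the_equality) (auto simp: units_of_def local_monoid_def Units_def)
qed

text \<open>
  The two cases of interest are \<open>emb x = (x, 0)\<close> and \<open>emb z = (0, z)\<close>. In both, the operators on the
  image of \<open>emb\<close> multiply without phases (\<open>iso\<close>), so \<open>emb\<close> turns sums into products and every vector is
  a sum of unit vectors.
\<close>
lemma generate_pauli:
  fixes emb :: "('l, 'd::nontriv) config \<Rightarrow> ('l, 'd) pvec"
  assumes emb_add: "\<And>x y. emb (x + y) = emb x + emb y"
    and emb_space: "\<And>Q x. x \<in> configs Q \<Longrightarrow> emb x \<in> pauli_space Q"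
    and iso: "\<And>x y. pairing (snd (emb x)) (fst (emb y)) = 0"
  shows "generate (units_of (local_monoid \<Lambda> q))
      ((\<lambda>k. pauli (qudits \<Lambda> q) (emb (Poly_Mapping.single k 1))) ` qudits \<Lambda> q \<union> phases (qudits \<Lambda> q))
    = {op_scale a (pauli (qudits \<Lambda> q) (emb x)) | a x. cmod a = 1 \<and> x \<in> configs (qudits \<Lambda> q)}"
    (is "generate ?M ?H = ?R")
proof
  let ?Q = "qudits \<Lambda> q"
  have emb0: "emb 0 = 0" using emb_add[of 0 0] by simp
  have emb_neg: "emb (- x) = - emb x" for x
    using emb_add[of x "- x"] by (simp add: emb0 eq_neg_iff_add_eq_0 add.commute)
  have mult: "x \<otimes>\<^bsub>?M\<^esub> y = op_mult x y" for x y by (simp add: units_of_def local_monoid_def)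
  have unit: "\<one>\<^bsub>?M\<^esub> = pauli ?Q (emb 0)"
    unfolding units_of_one emb0 by (simp add: local_monoid_def op_one_pauli)
  have prod: "op_mult (op_scale a (pauli ?Q (emb x))) (op_scale b (pauli ?Q (emb y)))
      = op_scale (a * b) (pauli ?Q (emb (x + y)))" if "x \<in> configs ?Q" "y \<in> configs ?Q" for a b x y
    using that by (simp add: pauli_mult emb_space emb_add iso)
  have H: "h \<in> ?R" if "h \<in> ?H" for h
    using that
  proof
    assume "h \<in> (\<lambda>k. pauli ?Q (emb (Poly_Mapping.single k 1))) ` ?Q"
    then obtain k where "k \<in> ?Q" "h = op_scale 1 (pauli ?Q (emb (Poly_Mapping.single k 1)))" by auto
    then show ?thesis by fastforce
  next
    assume "h \<in> phases ?Q"
    then obtain a where "cmod a = 1" "h = op_scale a (pauli ?Q (emb 0))"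
      by (auto simp: phases_def op_one_pauli emb0)
    then show ?thesis using configs_0 by blast
  qed
  show "generate ?M ?H \<subseteq> ?R"
  proof
    fix h assume "h \<in> generate ?M ?H"
    then show "h \<in> ?R"
    proof induction
      case one
      have "\<one>\<^bsub>?M\<^esub> = op_scale 1 (pauli ?Q (emb 0))" using unit by simp
      then show ?case using configs_0 norm_one by blast
    next
      case (incl h)
      then show ?case by (rule H)
    next
      case (inv h)
      then obtain a x where h: "h = op_scale a (pauli ?Q (emb x))" "cmod a = 1" "x \<in> configs ?Q"
        using H by blast
      have "inv\<^bsub>?M\<^esub> h = op_scale (cnj a) (pauli ?Q (emb (- x)))"
        unfolding h(1) emb_neg by (rule pauli_inverse(2)[OF emb_space[OF h(3)] h(2) iso])
      moreover have "cmod (cnj a) = 1" "- x \<in> configs ?Q" using h by auto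
      ultimately show ?case by blast
    next
      case (eng h1 h2)
      then obtain a x b y where h: "h1 = op_scale a (pauli ?Q (emb x))" "cmod a = 1" "x \<in> configs ?Q"
        "h2 = op_scale b (pauli ?Q (emb y))" "cmod b = 1" "y \<in> configs ?Q" by auto
      have "h1 \<otimes>\<^bsub>?M\<^esub> h2 = op_scale (a * b) (pauli ?Q (emb (x + y)))"
        unfolding mult h(1,4) by (rule prod[OF h(3,6)])
      moreover have "cmod (a * b) = 1" "x + y \<in> configs ?Q" using h by (auto simp: norm_mult)
      ultimately show ?case by blast
    qed
  qed
  show "?R \<subseteq> generate ?M ?H"
  proof
    have plus: "pauli ?Q (emb (x + y)) \<in> generate ?M ?H"
      if "pauli ?Q (emb x) \<in> generate ?M ?H" "pauli ?Q (emb y) \<in> generate ?M ?H"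
        "x \<in> configs ?Q" "y \<in> configs ?Q" for x y
      using generate.eng[OF that(1,2)] prod[OF that(3,4), of 1 1] by (simp add: mult)
    have zero: "pauli ?Q (emb 0) \<in> generate ?M ?H"
      using generate.one[of ?M ?H] by (simp add: unit)
    have nat: "pauli ?Q (emb (Poly_Mapping.single k (of_nat n))) \<in> generate ?M ?H" if "k \<in> ?Q" for k n
    proof (induction n)
      case (Suc n)
      have "pauli ?Q (emb (Poly_Mapping.single k 1)) \<in> generate ?M ?H"
        using that by (intro generate.incl) blast
      from plus[OF this Suc] that show ?case by (simp add: single_add)
    qed (simp add: zero)
    have single: "pauli ?Q (emb (Poly_Mapping.single k v)) \<in> generate ?M ?H" if "k \<in> ?Q" for k v
      using nat[OF that, of "nat (to_int_mod_ring v)"] by (simp only: of_nat_nat_to_int_mod_ring)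
    have sum: "pauli ?Q (emb (\<Sum>k\<in>K. Poly_Mapping.single k (v k))) \<in> generate ?M ?H"
      if "finite K" "K \<subseteq> ?Q" for K v
      using that
    proof (induction K)
      case (insert k K)
      then show ?case
        using plus[OF single, of k "\<Sum>k\<in>K. Poly_Mapping.single k (v k)" "v k"]
          configs_sum[of K "\<lambda>k. Poly_Mapping.single k (v k)" ?Q] by auto
    qed (simp add: zero)
    fix h assume "h \<in> ?R"
    then obtain a x where h: "h = op_scale a (pauli ?Q (emb x))" "cmod a = 1" "x \<in> configs ?Q"
      by blast
    have "pauli ?Q (emb x) \<in> generate ?M ?H"
      using sum[of "Poly_Mapping.keys x" "Poly_Mapping.lookup x"] h(3)
      by (simp add: poly_mapping_expand configs_def)
    moreover have "op_scale a (pauli ?Q (emb 0)) \<in> generate ?M ?H"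
      using h(2) by (intro generate.incl) (auto simp: phases_def op_one_pauli emb0)
    ultimately have "op_mult (op_scale a (pauli ?Q (emb 0))) (op_scale 1 (pauli ?Q (emb x)))
        \<in> generate ?M ?H"
      using generate.eng[of "op_scale a (pauli ?Q (emb 0))" ?M ?H] by (simp add: mult)
    then show "h \<in> generate ?M ?H" using prod[OF configs_0 h(3), of a 1] h(1) by simp
  qed
qed

lemma Z_group_eq: "Z_group \<Lambda> q =
    {op_scale a (pauli (qudits \<Lambda> q) (0, z)) | a z. cmod a = 1 \<and> z \<in> configs (qudits \<Lambda> q)}"
  unfolding Z_group_def pauli_Z_def by (rule generate_pauli) auto

lemma X_group_eq: "X_group \<Lambda> q =
    {op_scale a (pauli (qudits \<Lambda> q) (x, 0)) | a x. cmod a = 1 \<and> x \<in> configs (qudits \<Lambda> q)}"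
  unfolding X_group_def pauli_X_def by (rule generate_pauli) auto


section \<open>Clifford QCAs modulo phases\<close>

lemma algebra_aut_scale:
  "algebra_aut \<Lambda> q \<alpha> \<Longrightarrow> A \<in> local_ops \<Lambda> q \<Longrightarrow> \<alpha> (op_scale a A) = op_scale a (\<alpha> A)"
  by (simp add: algebra_aut_def)

lemma algebra_aut_mult:
  "algebra_aut \<Lambda> q \<alpha> \<Longrightarrow> A \<in> local_ops \<Lambda> q \<Longrightarrow> B \<in> local_ops \<Lambda> q \<Longrightarrow>
    \<alpha> (op_mult A B) = op_mult (\<alpha> A) (\<alpha> B)"
  by (simp add: algebra_aut_def)

lemma pauli_local1: "u \<in> pauli_space (qudits \<Lambda> q) \<Longrightarrow> pauli (qudits \<Lambda> q) u \<in> local_ops \<Lambda> q"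
  using pauli_local[of u \<Lambda> q 1] by simp

lemma symp_form_add_left: "symp_form (u + v) w = symp_form u w + symp_form v w"
  by (simp add: symp_form_def pairing_add_left)

lemma symp_form_add_right: "symp_form w (u + v) = symp_form w u + symp_form w v"
  by (simp add: symp_form_def pairing_add_right)

lemma symp_form_nondegenerate:
  assumes "u \<in> pauli_space Q" "v \<in> pauli_space Q"
    and "\<And>w. w \<in> pauli_space Q \<Longrightarrow> symp_form u w = symp_form v w"
  shows "u = v"
proof -
  have "snd u = snd v"
    using assms assms(3)[of "(_, 0)"]
    by (intro pairing_nondegenerate[of _ Q]) (auto simp: pauli_space_iff symp_form_def)
  moreover have "fst u = fst v"
    using assms assms(3)[of "(0, _)"]
    by (intro pairing_nondegenerate[of _ Q]) (auto simp: pauli_space_iff symp_form_def)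
  ultimately show ?thesis by (simp add: prod_eq_iff)
qed

text \<open>
  Here \<open>S\<close> may have any values outside the Pauli vectors of the system, so that it can be given by a
  formula.
\<close>
definition implements ::
  "'l set \<Rightarrow> ('l \<Rightarrow> nat) \<Rightarrow> (('l, 'd::nontriv) oper \<Rightarrow> ('l, 'd) oper) \<Rightarrow> (('l, 'd) pvec \<Rightarrow> ('l, 'd) pvec) \<Rightarrow> bool"
where
  "implements \<Lambda> q \<alpha> S \<longleftrightarrow> (\<forall>u\<in>pauli_space (qudits \<Lambda> q). S u \<in> pauli_space (qudits \<Lambda> q) \<and>
     (\<exists>a. cmod a = 1 \<and> \<alpha> (pauli (qudits \<Lambda> q) u) = op_scale a (pauli (qudits \<Lambda> q) (S u))))"

lemma implements_mod_phases:
  assumes "implements \<Lambda> q \<alpha> S" "u \<in> pauli_space (qudits \<Lambda> q)"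
  shows "mod_phases \<Lambda> q \<alpha> u = S u"
proof -
  let ?Q = "qudits \<Lambda> q"
  obtain a where a: "cmod a = 1" "\<alpha> (pauli ?Q u) = op_scale a (pauli ?Q (S u))"
    and Su: "S u \<in> pauli_space ?Q"
    using assms unfolding implements_def by blast
  have "(THE v. v \<in> pauli_space ?Q \<and>
       (\<exists>\<gamma>. cmod \<gamma> = 1 \<and> \<alpha> (pauli ?Q u) = op_scale \<gamma> (pauli ?Q v))) = S u"
  proof (rule the_equality)
    fix v assume "v \<in> pauli_space ?Q \<and>
       (\<exists>\<gamma>. cmod \<gamma> = 1 \<and> \<alpha> (pauli ?Q u) = op_scale \<gamma> (pauli ?Q v))"
    then obtain b where b: "cmod b = 1" "\<alpha> (pauli ?Q u) = op_scale b (pauli ?Q v)"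
      and v: "v \<in> pauli_space ?Q" by blast
    have "b \<noteq> 0" using b by auto
    then show "v = S u" using pauli_phase_inject[of b ?Q v a "S u"] a b v Su by simp
  qed (use a Su in blast)
  then show ?thesis using assms(2) by (simp add: mod_phases_def)
qed

lemma clifford_implements:
  assumes "clifford_qca \<Lambda> D q \<alpha>"
  shows "implements \<Lambda> q \<alpha> (mod_phases \<Lambda> q \<alpha>)"
proof -
  let ?Q = "qudits \<Lambda> q"
  have "\<exists>v. v \<in> pauli_space ?Q \<and> (\<exists>a. cmod a = 1 \<and> \<alpha> (pauli ?Q u) = op_scale a (pauli ?Q v))"
    if "u \<in> pauli_space ?Q" for u
  proof -
    have "op_scale 1 (pauli ?Q u) \<in> pauli_ops ?Q"
      unfolding pauli_ops_def using that norm_one by blast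
    then have "\<alpha> (pauli ?Q u) \<in> pauli_ops ?Q"
      using assms unfolding clifford_qca_def by auto
    then show ?thesis unfolding pauli_ops_def by blast
  qed
  then obtain S where S: "implements \<Lambda> q \<alpha> S" unfolding implements_def by metis
  then show ?thesis using implements_mod_phases[OF S] unfolding implements_def by simp
qed

lemma pauli_commutation:
  assumes "u \<in> pauli_space Q" "v \<in> pauli_space Q"
  shows "op_mult (op_scale a (pauli Q u)) (op_scale b (pauli Q v)) =
    op_scale (root_pow (symp_form u v)) (op_mult (op_scale b (pauli Q v)) (op_scale a (pauli Q u)))"
proof -
  have "root_pow (symp_form u v) * root_pow (pairing (snd v) (fst u)) = root_pow (pairing (snd u) (fst v))"
    unfolding symp_form_def by (simp add: pairing_commute[of "fst u"] flip: root_pow_add)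
  then show ?thesis
    unfolding pauli_mult[OF assms] pauli_mult[OF assms(2,1)] by (simp add: add.commute mult_ac)
qed

text \<open>
  An operator whose commutation phases with all the \<open>X\<close> and \<open>Z\<close> operators are those of a
  Pauli operator is a multiple of it: the phases with the \<open>Z\<close> operators fix \<open>c - c'\<close> at every
  nonzero entry \<open>A c c'\<close>, and those with the \<open>X\<close> operators express all the entries by one.
\<close>
lemma eigen_operator_is_pauli:
  fixes A :: "('l, 'd::nontriv) oper"
  assumes A: "A \<in> mats Q" and v: "v \<in> pauli_space Q"
    and comm: "\<And>u. u \<in> pauli_space Q \<Longrightarrow>
      op_mult A (pauli Q u) = op_scale (root_pow (symp_form v u)) (op_mult (pauli Q u) A)"
  shows "A = op_scale (A (fst v) 0) (pauli Q v)"
proof (intro ext)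
  fix c c' :: "('l, 'd) config"
  have R: "op_mult A (pauli Q u) c c' = root_pow (pairing (snd u) c') * A c (c' + fst u)"
    if "u \<in> pauli_space Q" for u c c'
    using op_mult_pauli_right[OF that A, of 1] by simp
  have L: "op_mult (pauli Q u) A c c' = root_pow (pairing (snd u) (c - fst u)) * A (c - fst u) c'"
    if "u \<in> pauli_space Q" for u c c'
    using op_mult_pauli_left[OF that A, of 1] by simp
  have diag: "c = c' + fst v" if "A c c' \<noteq> 0" for c c'
  proof (rule pairing_nondegenerate[of _ Q])
    show "c \<in> configs Q" "c' + fst v \<in> configs Q"
      using that A v by (auto simp: mats_def pauli_space_iff)
    fix y :: "('l, 'd) config" assume y: "y \<in> configs Q"
    then have u: "(0, y) \<in> pauli_space Q" by simp
    have "root_pow (pairing y c') = root_pow (- pairing (fst v) y) * root_pow (pairing y c)"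
      using fun_cong[OF fun_cong[OF comm[OF u]], of c c'] that
      by (simp add: R[OF u] L[OF u] op_scale_def symp_form_def)
    then have "pairing y c' = - pairing (fst v) y + pairing y c"
      by (simp add: root_pow_inject flip: root_pow_add)
    then show "pairing c y = pairing (c' + fst v) y"
      by (simp add: pairing_add_left pairing_commute[of c] pairing_commute[of c'])
  qed
  have shift: "A (fst v + y) y = root_pow (pairing (snd v) y) * A (fst v) 0" if y: "y \<in> configs Q" for y
  proof -
    have u: "(y, 0) \<in> pauli_space Q" using y by simp
    show ?thesis
      using fun_cong[OF fun_cong[OF comm[OF u]], of "fst v + y" 0]
      by (simp add: R[OF u] L[OF u] op_scale_def symp_form_def)
  qed
  show "A c c' = op_scale (A (fst v) 0) (pauli Q v) c c'"
  proof (cases "c' \<in> configs Q \<and> c = c' + fst v")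
    case True
    then show ?thesis using shift[of c'] by (simp add: op_scale_def pauli_def add.commute)
  next
    case False
    then have "A c c' = 0" using diag[of c c'] A unfolding mats_def by blast
    then show ?thesis using False by (auto simp: op_scale_def pauli_def)
  qed
qed

text \<open>
  Multiplicativity of \<open>\<alpha>\<close> gives additivity, and comparing commutation phases gives preservation of
  the form, which in turn gives injectivity.
  
  That every Pauli operator is reached needs more than the hypothesis that \<open>\<alpha>\<close> maps Pauli operators
  to Pauli operators. Let \<open>\<alpha> A\<close> be the Pauli operator of \<open>w\<close>. Then \<open>A\<close> commutes up to phases with all
  Pauli operators, and exactly with those supported off the finite support of \<open>A\<close>. Hence these
  phases are given by a finitely supported vector \<open>v\<close>, and \<open>A\<close> is a multiple of the Pauli operator of
  \<open>v\<close> by \<open>eigen_operator_is_pauli\<close>. So \<open>w\<close> is the image of \<open>v\<close>.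
\<close>
lemma clifford_mod_phases_symplectic:
  fixes \<alpha> :: "('l, 'd::nontriv) oper \<Rightarrow> ('l, 'd) oper"
  assumes cl: "clifford_qca \<Lambda> D q \<alpha>"
  shows "symplectic_aut (qudits \<Lambda> q) (mod_phases \<Lambda> q \<alpha>)"
proof -
  let ?Q = "qudits \<Lambda> q"
  let ?P = "pauli_space ?Q :: ('l, 'd) pvec set"
  let ?S = "mod_phases \<Lambda> q \<alpha>"
  have aut: "algebra_aut \<Lambda> q \<alpha>" using cl by (simp add: clifford_qca_def)
  have SP: "?S u \<in> ?P" if "u \<in> ?P" for u
    using clifford_implements[OF cl] that unfolding implements_def by blast
  obtain g where g: "\<And>u. u \<in> ?P \<Longrightarrow> cmod (g u) = 1"
    "\<And>u. u \<in> ?P \<Longrightarrow> \<alpha> (pauli ?Q u) = op_scale (g u) (pauli ?Q (?S u))"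
    using clifford_implements[OF cl] unfolding implements_def by metis
  have g0: "g u \<noteq> 0" if "u \<in> ?P" for u using g(1)[OF that] by auto
  have ap: "\<alpha> (op_scale a (pauli ?Q u)) = op_scale (a * g u) (pauli ?Q (?S u))" if "u \<in> ?P" for a u
    using algebra_aut_scale[OF aut pauli_local1[OF that]] g(2)[OF that] by simp
  have add: "?S (u + v) = ?S u + ?S v" if u: "u \<in> ?P" and v: "v \<in> ?P" for u v
  proof -
    have uv: "u + v \<in> ?P" using u v by (rule pauli_space_add)
    have "op_mult (\<alpha> (pauli ?Q u)) (\<alpha> (pauli ?Q v)) = \<alpha> (op_mult (pauli ?Q u) (pauli ?Q v))"
      using algebra_aut_mult[OF aut pauli_local1[OF u] pauli_local1[OF v]] by simp
    also have "\<dots> = op_scale (root_pow (pairing (snd u) (fst v)) * g (u + v)) (pauli ?Q (?S (u + v)))"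
      using pauli_mult[OF u v, of 1 1] ap[OF uv] by simp
    finally have "op_scale (g u * g v * root_pow (pairing (snd (?S u)) (fst (?S v)))) (pauli ?Q (?S u + ?S v))
      = op_scale (root_pow (pairing (snd u) (fst v)) * g (u + v)) (pauli ?Q (?S (u + v)))"
      using g(2)[OF u] g(2)[OF v] pauli_mult[OF SP[OF u] SP[OF v]] by simp
    then show ?thesis
      using pauli_phase_inject[of "g u * g v * root_pow (pairing (snd (?S u)) (fst (?S v)))" ?Q
          "?S u + ?S v"] g0 u v SP uv pauli_space_add[OF SP[OF u] SP[OF v]]
      by (metis mult_eq_0_iff root_pow_nonzero)
  qed
  have symp: "symp_form (?S u) (?S v) = symp_form u v" if u: "u \<in> ?P" and v: "v \<in> ?P" for u v
  proof -
    let ?B = "op_mult (\<alpha> (pauli ?Q v)) (\<alpha> (pauli ?Q u))"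
    have vu: "op_mult (pauli ?Q v) (pauli ?Q u) \<in> local_ops \<Lambda> q"
      using op_mult_pauli_local(1)[OF pauli_local1[OF u] v, of 1] by simp
    have "op_mult (\<alpha> (pauli ?Q u)) (\<alpha> (pauli ?Q v)) = \<alpha> (op_mult (pauli ?Q u) (pauli ?Q v))"
      using algebra_aut_mult[OF aut pauli_local1[OF u] pauli_local1[OF v]] by simp
    also have "\<dots> = \<alpha> (op_scale (root_pow (symp_form u v)) (op_mult (pauli ?Q v) (pauli ?Q u)))"
      using pauli_commutation[OF u v, of 1 1] by simp
    also have "\<dots> = op_scale (root_pow (symp_form u v)) ?B"
      using algebra_aut_scale[OF aut vu] algebra_aut_mult[OF aut pauli_local1[OF v] pauli_local1[OF u]]
      by simp
    finally have 1: "op_mult (\<alpha> (pauli ?Q u)) (\<alpha> (pauli ?Q v)) = op_scale (root_pow (symp_form u v)) ?B" .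
    have 2: "op_mult (\<alpha> (pauli ?Q u)) (\<alpha> (pauli ?Q v)) = op_scale (root_pow (symp_form (?S u) (?S v))) ?B"
      unfolding g(2)[OF u] g(2)[OF v] by (rule pauli_commutation[OF SP[OF u] SP[OF v]])
    obtain b where B: "?B = op_scale b (pauli ?Q (?S v + ?S u))" and b: "b \<noteq> 0"
      unfolding g(2)[OF u] g(2)[OF v] pauli_mult[OF SP[OF v] SP[OF u]] using g0[OF u] g0[OF v] by auto
    have "op_scale (root_pow (symp_form u v) * b) (pauli ?Q (?S v + ?S u))
      = op_scale (root_pow (symp_form (?S u) (?S v)) * b) (pauli ?Q (?S v + ?S u))"
      using 1 2 unfolding B by simp
    then have "root_pow (symp_form u v) * b = root_pow (symp_form (?S u) (?S v)) * b"
      using pauli_phase_inject[of "root_pow (symp_form u v) * b" ?Q "?S v + ?S u" _ "?S v + ?S u"]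
        b pauli_space_add[OF SP[OF v] SP[OF u]] by (metis mult_eq_0_iff root_pow_nonzero)
    then show ?thesis using b by (simp add: root_pow_inject)
  qed
  have inj: "inj_on ?S ?P"
  proof (rule inj_onI)
    fix u v assume u: "u \<in> ?P" and v: "v \<in> ?P" and eq: "?S u = ?S v"
    show "u = v"
      using symp[OF u] symp[OF v] eq by (intro symp_form_nondegenerate[OF u v]) metis
  qed
  have surj: "w \<in> ?S ` ?P" if w: "w \<in> ?P" for w
  proof -
    obtain A where A: "A \<in> local_ops \<Lambda> q" "\<alpha> A = pauli ?Q w"
      using aut pauli_local1[OF w] unfolding algebra_aut_def bij_betw_def by (metis imageE)
    have mA: "A \<in> mats ?Q" using A(1) by (rule local_ops_mats)
    obtain F where F: "finite F" "supported_on ?Q F A"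
      using A(1) unfolding local_ops_def by blast
    have inja: "inj_on \<alpha> (local_ops \<Lambda> q)" using aut by (simp add: algebra_aut_def bij_betw_def)
    (* Both sides have the same image under \<alpha>. *)
    have comm: "op_mult A (pauli ?Q u) = op_scale (root_pow (symp_form w (?S u))) (op_mult (pauli ?Q u) A)"
      if u: "u \<in> ?P" for u
    proof (rule inj_onD[OF inja])
      have Au: "op_mult A (pauli ?Q u) \<in> local_ops \<Lambda> q" "op_mult (pauli ?Q u) A \<in> local_ops \<Lambda> q"
        using op_mult_pauli_local[OF A(1) u, of 1] by auto
      show "op_mult A (pauli ?Q u) \<in> local_ops \<Lambda> q" by (rule Au)
      show "op_scale (root_pow (symp_form w (?S u))) (op_mult (pauli ?Q u) A) \<in> local_ops \<Lambda> q"
        using Au by (intro op_scale_local)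
      have "\<alpha> (op_mult A (pauli ?Q u)) = op_mult (op_scale 1 (pauli ?Q w)) (op_scale (g u) (pauli ?Q (?S u)))"
        using algebra_aut_mult[OF aut A(1) pauli_local1[OF u]] A(2) g(2)[OF u] by simp
      also have "\<dots> = op_scale (root_pow (symp_form w (?S u))) (op_mult (\<alpha> (pauli ?Q u)) (\<alpha> A))"
        using pauli_commutation[OF w SP[OF u], of 1 "g u"] A(2) g(2)[OF u] by simp
      also have "\<dots> = \<alpha> (op_scale (root_pow (symp_form w (?S u))) (op_mult (pauli ?Q u) A))"
        using algebra_aut_mult[OF aut pauli_local1[OF u] A(1)] algebra_aut_scale[OF aut Au(2)] by simp
      finally show "\<alpha> (op_mult A (pauli ?Q u)) = \<dots>" .
    qed
    have A0: "A \<noteq> (\<lambda>_ _. 0)"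
    proof
      assume "A = (\<lambda>_ _. 0)"
      then have "A = op_scale 0 A" by (simp add: op_scale_def)
      then have "\<alpha> A = op_scale 0 (\<alpha> A)" using algebra_aut_scale[OF aut A(1), of 0] by simp
      then have "pauli ?Q w (fst w) 0 = 0" using A(2) by (metis mult_zero_left op_scale_def)
      then show False by (simp add: pauli_def)
    qed
    define K where "K = {k \<in> ?Q. fst k \<in> F}"
    have "K \<subseteq> (SIGMA i:F. {..<q i})" by (auto simp: K_def qudits_def)
    then have K: "finite K" "K \<subseteq> ?Q"
      using F(1) finite_subset[of K "SIGMA i:F. {..<q i}"] by (auto simp: K_def)
    (* Off the support of A the operator commutes with A exactly; since A has a nonzero
       entry, the phase must be 1. *)
    have far: "symp_form w (?S u) = 0"
      if u: "u \<in> ?P" and off: "\<And>k. k \<in> Poly_Mapping.keys (fst u) \<union> Poly_Mapping.keys (snd u) \<Longrightarrow> fst k \<notin> F" for u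
    proof -
      obtain c c' where cc: "A c c' \<noteq> 0" using A0 by blast
      then have ccQ: "c \<in> configs ?Q" "c' \<in> configs ?Q" using mA by (auto simp: mats_def)
      have ag: "agree_on (- F) c c'" using F(2) cc ccQ unfolding supported_on_def by blast
      have uQ: "fst u \<in> configs ?Q" using u by (simp add: pauli_space_iff)
      have "A (c + fst u) (c' + fst u) = A c c'"
      proof -
        have "agree_on F (c + fst u) c" "agree_on F (c' + fst u) c'"
          using off by (auto simp: agree_on_keys)
        moreover have "agree_on (- F) (c + fst u) (c' + fst u)"
          using ag by (simp add: agree_on_def lookup_add)
        ultimately show ?thesis
          using ag ccQ uQ by (intro F(2)[unfolded supported_on_def, THEN conjunct2, rule_format]) auto
      qed
      moreover have "pairing (snd u) c' = pairing (snd u) c"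
        unfolding pairing_def
      proof (intro sum.cong refl)
        fix k assume "k \<in> Poly_Mapping.keys (snd u)"
        then have "fst k \<in> - F" using off by auto
        then have "Poly_Mapping.lookup c' k = Poly_Mapping.lookup c k"
          using ag unfolding agree_on_def by (metis prod.collapse)
        then show "Poly_Mapping.lookup (snd u) k * Poly_Mapping.lookup c' k
          = Poly_Mapping.lookup (snd u) k * Poly_Mapping.lookup c k" by simp
      qed
      moreover have "op_mult A (pauli ?Q u) (c + fst u) c' = root_pow (pairing (snd u) c') * A (c + fst u) (c' + fst u)"
        using op_mult_pauli_right[OF u mA, of 1] by simp
      moreover have "op_mult (pauli ?Q u) A (c + fst u) c' = root_pow (pairing (snd u) c) * A c c'"
        using op_mult_pauli_left[OF u mA, of 1] by simp
      ultimately have "root_pow (symp_form w (?S u)) = 1"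
        using fun_cong[OF fun_cong[OF comm[OF u]], of "c + fst u" c'] cc
        by (simp add: op_scale_def)
      then show ?thesis by (simp add: root_pow_eq_1_iff)
    qed
    have "\<exists>z\<in>configs ?Q. \<forall>x\<in>configs ?Q. symp_form w (?S (x, 0)) = pairing z x"
    proof (rule additive_functional_is_pairing[OF _ K])
      fix x y :: "('l, 'd) config" assume "x \<in> configs ?Q" "y \<in> configs ?Q"
      then show "symp_form w (?S (x + y, 0)) = symp_form w (?S (x, 0)) + symp_form w (?S (y, 0))"
        using add[of "(x, 0)" "(y, 0)"] by (simp add: symp_form_add_right)
    next
      fix k assume "k \<in> ?Q - K"
      then show "symp_form w (?S (Poly_Mapping.single k 1, 0)) = 0" by (intro far) (auto simp: K_def)
    qed
    then obtain z where z: "z \<in> configs ?Q" "\<And>x. x \<in> configs ?Q \<Longrightarrow> symp_form w (?S (x, 0)) = pairing z x"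
      by blast
    have "\<exists>x\<in>configs ?Q. \<forall>y\<in>configs ?Q. symp_form w (?S (0, y)) = pairing x y"
    proof (rule additive_functional_is_pairing[OF _ K])
      fix x y :: "('l, 'd) config" assume "x \<in> configs ?Q" "y \<in> configs ?Q"
      then show "symp_form w (?S (0, x + y)) = symp_form w (?S (0, x)) + symp_form w (?S (0, y))"
        using add[of "(0, x)" "(0, y)"] by (simp add: symp_form_add_right)
    next
      fix k assume "k \<in> ?Q - K"
      then show "symp_form w (?S (0, Poly_Mapping.single k 1)) = 0" by (intro far) (auto simp: K_def)
    qed
    then obtain x where x: "x \<in> configs ?Q" "\<And>y. y \<in> configs ?Q \<Longrightarrow> symp_form w (?S (0, y)) = pairing x y"
      by blast
    (* The sign comes from the sign of the second term of symp_form. *)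
    define v where "v = (- x, z)"
    have v: "v \<in> ?P" using x z by (auto simp: v_def)
    have "symp_form w (?S u) = symp_form v u" if u: "u \<in> ?P" for u
    proof -
      have "u = (fst u, 0) + (0, snd u)" by (simp add: prod_eq_iff)
      then have "?S u = ?S (fst u, 0) + ?S (0, snd u)"
        using add[of "(fst u, 0)" "(0, snd u)"] u by (simp add: pauli_space_iff)
      then show ?thesis using u x(2) z(2)
        by (simp add: symp_form_add_right pauli_space_iff v_def symp_form_def[of "(- x, z)"] pairing_uminus)
    qed
    then have Av: "A = op_scale (A (fst v) 0) (pauli ?Q v)"
      using comm by (intro eigen_operator_is_pauli[OF mA v]) simp
    have "op_scale 1 (pauli ?Q w) = op_scale (A (fst v) 0 * g v) (pauli ?Q (?S v))"
      using A(2) ap[OF v, of "A (fst v) 0"] Av by simp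
    then have "w = ?S v"
      using pauli_phase_inject[of 1 ?Q w] w SP[OF v] by simp
    then show ?thesis using v by blast
  qed
  have "?S \<in> extensional ?P" by (simp add: mod_phases_def)
  moreover have "bij_betw ?S ?P ?P"
    using inj surj SP unfolding bij_betw_def by blast
  ultimately show ?thesis
    using add symp by (simp add: symplectic_aut_def Bij_def)
qed


section \<open>Local symplectic automorphisms\<close>

definition local_symplectic ::
  "'l set \<Rightarrow> ('l \<Rightarrow> 'l \<Rightarrow> real) \<Rightarrow> ('l \<Rightarrow> nat) \<Rightarrow> (('l, 'd::nontriv) pvec \<Rightarrow> ('l, 'd) pvec) \<Rightarrow> bool"
where
  "local_symplectic \<Lambda> D q S \<longleftrightarrow> symplectic_aut (qudits \<Lambda> q) S \<and>
     (\<exists>r. \<forall>u\<in>pauli_space (qudits \<Lambda> q). \<forall>l\<in>Poly_Mapping.keys (fst (S u)) \<union> Poly_Mapping.keys (snd (S u)).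
        \<exists>k\<in>Poly_Mapping.keys (fst u) \<union> Poly_Mapping.keys (snd u). D (fst k) (fst l) \<le> r)"

lemma symplectic_aut_closed: "symplectic_aut Q S \<Longrightarrow> u \<in> pauli_space Q \<Longrightarrow> S u \<in> pauli_space Q"
  by (auto simp: symplectic_aut_def Bij_def dest: bij_betwE)

lemma symplectic_aut_add:
  "symplectic_aut Q S \<Longrightarrow> u \<in> pauli_space Q \<Longrightarrow> v \<in> pauli_space Q \<Longrightarrow> S (u + v) = S u + S v"
  by (simp add: symplectic_aut_def)

lemma symplectic_aut_form:
  "symplectic_aut Q S \<Longrightarrow> u \<in> pauli_space Q \<Longrightarrow> v \<in> pauli_space Q \<Longrightarrow>
    symp_form (S u) (S v) = symp_form u v"
  by (simp add: symplectic_aut_def)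

text \<open>A map that preserves the form is injective since the form is nondegenerate.\<close>
lemma symplectic_autI:
  fixes S :: "('l, 'd::nontriv) pvec \<Rightarrow> ('l, 'd) pvec"
  assumes "S \<in> extensional (pauli_space Q)" and cl: "\<And>u. u \<in> pauli_space Q \<Longrightarrow> S u \<in> pauli_space Q"
    and add: "\<And>u v. u \<in> pauli_space Q \<Longrightarrow> v \<in> pauli_space Q \<Longrightarrow> S (u + v) = S u + S v"
    and form: "\<And>u v. u \<in> pauli_space Q \<Longrightarrow> v \<in> pauli_space Q \<Longrightarrow> symp_form (S u) (S v) = symp_form u v"
    and surj: "\<And>u. u \<in> pauli_space Q \<Longrightarrow> \<exists>v\<in>pauli_space Q. S v = u"
  shows "symplectic_aut Q S"
proof -
  have "inj_on S (pauli_space Q)"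
  proof (rule inj_onI)
    fix u v assume u: "u \<in> pauli_space Q" and v: "v \<in> pauli_space Q" and eq: "S u = S v"
    show "u = v"
      using form[OF u] form[OF v] eq by (intro symp_form_nondegenerate[OF u v]) metis
  qed
  moreover have "S ` pauli_space Q = pauli_space Q" using cl surj by blast
  ultimately show ?thesis
    using assms by (simp add: symplectic_aut_def Bij_def bij_betw_def)
qed

lemma symplectic_aut_compose:
  assumes "symplectic_aut Q S" "symplectic_aut Q T"
  shows "symplectic_aut Q (compose (pauli_space Q) S T)"
  using assms compose_Bij[of S "pauli_space Q" T] symplectic_aut_closed[OF assms(2)]
  by (auto simp: symplectic_aut_def compose_def pauli_space_add)

lemma symplectic_aut_inv_into:
  assumes S: "symplectic_aut Q S" and u: "u \<in> pauli_space Q"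
  shows "inv_into (pauli_space Q) S u \<in> pauli_space Q" "S (inv_into (pauli_space Q) S u) = u"
    "inv_into (pauli_space Q) S (S u) = u"
proof -
  have im: "S ` pauli_space Q = pauli_space Q" "inj_on S (pauli_space Q)"
    using S by (auto simp: symplectic_aut_def Bij_def bij_betw_def)
  show "inv_into (pauli_space Q) S u \<in> pauli_space Q" using im u by (metis inv_into_into)
  show "S (inv_into (pauli_space Q) S u) = u" using im u by (metis f_inv_into_f)
  show "inv_into (pauli_space Q) S (S u) = u" using im u by (metis inv_into_f_f)
qed

lemma symplectic_aut_inverse:
  fixes S :: "('l, 'd::nontriv) pvec \<Rightarrow> ('l, 'd) pvec"
  assumes S: "symplectic_aut Q S"
  shows "symplectic_aut Q (restrict (inv_into (pauli_space Q) S) (pauli_space Q))"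
proof (rule symplectic_autI)
  note i = symplectic_aut_inv_into[OF S]
  let ?I = "inv_into (pauli_space Q) S"
  fix u v :: "('l, 'd) pvec" assume u: "u \<in> pauli_space Q" and v: "v \<in> pauli_space Q"
  have "S (?I u + ?I v) = u + v" using symplectic_aut_add[OF S i(1)[OF u] i(1)[OF v]] i u v by simp
  then have "?I (u + v) = ?I u + ?I v" using i(3)[of "?I u + ?I v"] i(1) u v by (metis pauli_space_add)
  then show "restrict ?I (pauli_space Q) (u + v) = restrict ?I (pauli_space Q) u + restrict ?I (pauli_space Q) v"
    using u v by auto
  show "symp_form (restrict ?I (pauli_space Q) u) (restrict ?I (pauli_space Q) v) = symp_form u v"
    using symplectic_aut_form[OF S i(1)[OF u] i(1)[OF v]] i u v by simp
next
  fix u :: "('l, 'd) pvec" assume u: "u \<in> pauli_space Q"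
  show "restrict (inv_into (pauli_space Q) S) (pauli_space Q) u \<in> pauli_space Q"
    using u symplectic_aut_inv_into(1)[OF S] by simp
  show "\<exists>v\<in>pauli_space Q. restrict (inv_into (pauli_space Q) S) (pauli_space Q) v = u"
    using u symplectic_aut_inv_into(3)[OF S] symplectic_aut_closed[OF S]
    by (intro bexI[of _ "S u"]) auto
qed simp

context Metric_space
begin

lemma local_symplectic_compose:
  fixes S T :: "('a, 'd::nontriv) pvec \<Rightarrow> ('a, 'd) pvec"
  assumes S: "local_symplectic M d q S" and T: "local_symplectic M d q T"
  shows "local_symplectic M d q (compose (pauli_space (qudits M q)) S T)"
proof -
  let ?P = "pauli_space (qudits M q) :: ('a, 'd) pvec set"
  let ?keys = "\<lambda>u :: ('a, 'd) pvec. Poly_Mapping.keys (fst u) \<union> Poly_Mapping.keys (snd u)"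
  obtain r s where r': "\<forall>u\<in>?P. \<forall>l\<in>?keys (S u). \<exists>k\<in>?keys u. d (fst k) (fst l) \<le> r"
    and s': "\<forall>u\<in>?P. \<forall>l\<in>?keys (T u). \<exists>k\<in>?keys u. d (fst k) (fst l) \<le> s"
    using S T unfolding local_symplectic_def by (elim conjE exE)
  note r = r'[rule_format] and s = s'[rule_format]
  have cl: "S u \<in> ?P" "T u \<in> ?P" if "u \<in> ?P" for u
    using S T that symplectic_aut_closed unfolding local_symplectic_def by blast+
  have site: "fst k \<in> M" if "u \<in> ?P" "k \<in> ?keys u" for u k
    using that configs_keys qudits_site unfolding pauli_space_iff by blast
  have "\<exists>k\<in>?keys u. d (fst k) (fst l) \<le> s + r" if u: "u \<in> ?P" and l: "l \<in> ?keys (S (T u))" for u l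
  proof -
    obtain m where m: "m \<in> ?keys (T u)" "d (fst m) (fst l) \<le> r" using r[OF cl(2)[OF u] l] by blast
    obtain k where k: "k \<in> ?keys u" "d (fst k) (fst m) \<le> s" using s[OF u m(1)] by blast
    have "d (fst k) (fst l) \<le> s + r"
      using triangle[OF site[OF u k(1)] site[OF cl(2)[OF u] m(1)] site[OF cl(1)[OF cl(2)[OF u]] l]] m k
      by simp
    then show ?thesis using k by blast
  qed
  then show ?thesis
    using S T symplectic_aut_compose unfolding local_symplectic_def
    by (intro conjI exI[of _ "s + r"]) (auto simp: compose_def)
qed

text \<open>
  The components of \<open>S\<^sup>-\<^sup>1 u\<close> at a qudit are, up to sign, its symplectic products with the two unit
  vectors \<open>e\<close> at that qudit, hence the products of \<open>u\<close> with \<open>S e\<close>. So \<open>S\<^sup>-\<^sup>1\<close> has the same radius as \<open>S\<close>.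
\<close>
lemma local_symplectic_inverse:
  fixes S :: "('a, 'd::nontriv) pvec \<Rightarrow> ('a, 'd) pvec"
  assumes S: "local_symplectic M d q S"
  shows "local_symplectic M d q (restrict (inv_into (pauli_space (qudits M q)) S) (pauli_space (qudits M q)))"
proof -
  let ?P = "pauli_space (qudits M q) :: ('a, 'd) pvec set"
  let ?I = "inv_into ?P S"
  let ?keys = "\<lambda>u :: ('a, 'd) pvec. Poly_Mapping.keys (fst u) \<union> Poly_Mapping.keys (snd u)"
  have sym: "symplectic_aut (qudits M q) S" using S by (simp add: local_symplectic_def)
  obtain r where r': "\<forall>u\<in>?P. \<forall>l\<in>?keys (S u). \<exists>k\<in>?keys u. d (fst k) (fst l) \<le> r"
    using S unfolding local_symplectic_def by (elim conjE exE)
  note r = r'[rule_format]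
  have near: "\<exists>k\<in>?keys u. d (fst k) (fst l) \<le> r"
    if u: "u \<in> ?P" and e: "e \<in> ?P" and ek: "?keys e \<subseteq> {l}" and ne: "symp_form (?I u) e \<noteq> 0" for u e l
  proof -
    have "symp_form (?I u) e = symp_form u (S e)"
      using symplectic_aut_form[OF sym symplectic_aut_inv_into(1)[OF sym u] e]
        symplectic_aut_inv_into(2)[OF sym u] by simp
    then have "symp_form u (S e) \<noteq> 0" using ne by simp
    then have "pairing (snd u) (fst (S e)) \<noteq> 0 \<or> pairing (fst u) (snd (S e)) \<noteq> 0"
      by (auto simp: symp_form_def)
    then obtain k where k: "k \<in> ?keys u" "k \<in> ?keys (S e)" using pairing_nonzero_keys by blast
    then have "d (fst l) (fst k) \<le> r" using r[OF e k(2)] ek by blast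
    then show ?thesis using k commute by metis
  qed
  have "\<exists>k\<in>?keys u. d (fst k) (fst l) \<le> r" if u: "u \<in> ?P" and l: "l \<in> ?keys (?I u)" for u l
  proof -
    have "l \<in> qudits M q"
      using symplectic_aut_inv_into(1)[OF sym u] l configs_keys unfolding pauli_space_iff by blast
    then have e: "Poly_Mapping.single l 1 \<in> configs (qudits M q)" by simp
    have "symp_form (?I u) (Poly_Mapping.single l 1, 0) \<noteq> 0 \<or> symp_form (?I u) (0, Poly_Mapping.single l 1) \<noteq> 0"
      using l by (auto simp: symp_form_def in_keys_iff)
    then show ?thesis using near[OF u, of "(Poly_Mapping.single l 1, 0)" l]
        near[OF u, of "(0, Poly_Mapping.single l 1)" l] e by auto
  qed
  then show ?thesis
    using symplectic_aut_inverse[OF sym] unfolding local_symplectic_def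
    by (intro conjI exI[of _ r]) auto
qed

end

text \<open>
  The support of a Pauli operator is that of its exponent vectors, both before and after the
  application of the automaton.
\<close>
lemma clifford_local_symplectic:
  fixes \<alpha> :: "('l, 'd::nontriv) oper \<Rightarrow> ('l, 'd) oper"
  assumes cl: "clifford_qca \<Lambda> D q \<alpha>"
  shows "local_symplectic \<Lambda> D q (mod_phases \<Lambda> q \<alpha>)"
proof -
  let ?Q = "qudits \<Lambda> q" and ?S = "mod_phases \<Lambda> q \<alpha>"
  let ?keys = "\<lambda>u :: ('l, 'd) pvec. Poly_Mapping.keys (fst u) \<union> Poly_Mapping.keys (snd u)"
  obtain r where r: "\<forall>A\<in>local_ops \<Lambda> q. \<forall>F\<subseteq>\<Lambda>. supported_on ?Q F A \<longrightarrow>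
      supported_on ?Q (neighbourhood \<Lambda> D r F) (\<alpha> A)"
    using cl unfolding clifford_qca_def locality_preserving_def by (elim conjE exE)
  have "\<exists>k\<in>?keys u. D (fst k) (fst l) \<le> r" if u: "u \<in> pauli_space ?Q" and l: "l \<in> ?keys (?S u)" for u l
  proof -
    obtain a where a: "cmod a = 1" "\<alpha> (pauli ?Q u) = op_scale a (pauli ?Q (?S u))"
      and Su: "?S u \<in> pauli_space ?Q"
      using clifford_implements[OF cl] u unfolding implements_def by blast
    let ?F = "fst ` ?keys u"
    have "?F \<subseteq> \<Lambda>" using u unfolding pauli_space_iff by (auto dest: configs_keys qudits_site)
    moreover have "supported_on ?Q ?F (pauli ?Q u)"
      using pauli_supported[OF u, of ?F 1] by auto
    ultimately have "supported_on ?Q (neighbourhood \<Lambda> D r ?F) (op_scale a (pauli ?Q (?S u)))"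
      using r[rule_format, OF pauli_local1[OF u]] a(2) by simp
    moreover have "a \<noteq> 0" using a(1) by auto
    ultimately have "fst ` ?keys (?S u) \<subseteq> neighbourhood \<Lambda> D r ?F"
      using supported_pauliD[OF _ _ Su] by blast
    then show ?thesis using l unfolding neighbourhood_def by blast
  qed
  then show ?thesis
    using clifford_mod_phases_symplectic[OF cl] unfolding local_symplectic_def by blast
qed

lemma mod_phases_inverse_comp:
  assumes \<alpha>: "clifford_qca \<Lambda> D q \<alpha>" and \<beta>: "clifford_qca \<Lambda> D q \<beta>"
    and u: "u \<in> pauli_space (qudits \<Lambda> q)"
  shows "mod_phases \<Lambda> q (inv_into (local_ops \<Lambda> q) \<beta> \<circ> \<alpha>) u =
    inv_into (pauli_space (qudits \<Lambda> q)) (mod_phases \<Lambda> q \<beta>) (mod_phases \<Lambda> q \<alpha> u)"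
proof (rule implements_mod_phases[OF _ u])
  let ?Q = "qudits \<Lambda> q"
  let ?I = "inv_into (pauli_space ?Q) (mod_phases \<Lambda> q \<beta>)"
  note symp = clifford_mod_phases_symplectic[OF \<beta>]
  have aut: "algebra_aut \<Lambda> q \<beta>" using \<beta> by (simp add: clifford_qca_def)
  then have inj: "inj_on \<beta> (local_ops \<Lambda> q)" by (simp add: algebra_aut_def bij_betw_def)
  show "implements \<Lambda> q (inv_into (local_ops \<Lambda> q) \<beta> \<circ> \<alpha>) (\<lambda>u. ?I (mod_phases \<Lambda> q \<alpha> u))"
    unfolding implements_def
  proof (intro ballI conjI)
    fix u :: "('a, 'b) pvec" assume u: "u \<in> pauli_space ?Q"
    obtain a where a: "cmod a = 1" "\<alpha> (pauli ?Q u) = op_scale a (pauli ?Q (mod_phases \<Lambda> q \<alpha> u))"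
      and au: "mod_phases \<Lambda> q \<alpha> u \<in> pauli_space ?Q"
      using clifford_implements[OF \<alpha>] u unfolding implements_def by blast
    let ?v = "?I (mod_phases \<Lambda> q \<alpha> u)"
    show v: "?v \<in> pauli_space ?Q" by (rule symplectic_aut_inv_into(1)[OF symp au])
    obtain b where b: "cmod b = 1" "\<beta> (pauli ?Q ?v) = op_scale b (pauli ?Q (mod_phases \<Lambda> q \<alpha> u))"
      using clifford_implements[OF \<beta>] v symplectic_aut_inv_into(2)[OF symp au]
      unfolding implements_def by metis
    have b0: "b \<noteq> 0" using b(1) by auto
    have "\<beta> (op_scale (a / b) (pauli ?Q ?v)) = \<alpha> (pauli ?Q u)"
      using algebra_aut_scale[OF aut pauli_local1[OF v]] a b b0 by simp
    then have "inv_into (local_ops \<Lambda> q) \<beta> (\<alpha> (pauli ?Q u)) = op_scale (a / b) (pauli ?Q ?v)"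
      using inv_into_f_f[OF inj pauli_local[OF v]] by metis
    moreover have "cmod (a / b) = 1" using a b by (simp add: norm_divide)
    ultimately show "\<exists>c. cmod c = 1 \<and> (inv_into (local_ops \<Lambda> q) \<beta> \<circ> \<alpha>) (pauli ?Q u) = op_scale c (pauli ?Q ?v)"
      by auto
  qed
qed


section \<open>Relabelling the basis vectors\<close>

text \<open>
  Conjugation by the permutation \<open>|\<phi> c\<rangle> \<mapsto> |c\<rangle>\<close> of the basis vectors.
\<close>
definition relabel :: "(('l, 'd::nontriv) config \<Rightarrow> ('l, 'd) config) \<Rightarrow> ('l, 'd) oper \<Rightarrow> ('l, 'd) oper" where
  "relabel \<phi> A = (\<lambda>c c'. A (\<phi> c) (\<phi> c'))"

text \<open>
  Two conditions on supports are needed, one for each half of the definition of the support: \<open>f\<close>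
  spreads differences inside \<open>F\<close> at most over \<open>G\<close>, and differences outside \<open>G\<close> do not reach \<open>F\<close> under the
  inverse \<open>f'\<close> of \<open>f\<close>.
\<close>
lemma supported_on_relabel:
  fixes A :: "('l, 'd::nontriv) oper"
  assumes f: "adj_on Q f g" and f': "adj_on Q f' g'"
    and inv: "\<And>x. x \<in> configs Q \<Longrightarrow> f (f' x) = x"
    and \<phi>: "\<And>x. x \<in> configs Q \<Longrightarrow> \<phi> x = f' x"
    and sup: "supported_on Q F A"
    and out: "\<And>x. x \<in> configs Q \<Longrightarrow> fst ` Poly_Mapping.keys x \<subseteq> F \<Longrightarrow> fst ` Poly_Mapping.keys (f x) \<subseteq> G"
    and inw: "\<And>x. x \<in> configs Q \<Longrightarrow> fst ` Poly_Mapping.keys x \<subseteq> - G \<Longrightarrow> fst ` Poly_Mapping.keys (f' x) \<subseteq> - F"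
  shows "supported_on Q G (relabel \<phi> A)"
  unfolding supported_on_def
proof (intro conjI ballI impI)
  have cl: "f' c \<in> configs Q" if "c \<in> configs Q" for c by (rule adj_on_closed[OF f' that])
  have diff: "f' (c - c') = f' c - f' c'" if "c \<in> configs Q" "c' \<in> configs Q" for c c'
    by (rule adj_on_diff[OF f' that])
  have diag: "agree_on (- F) b b'" if "b \<in> configs Q" "b' \<in> configs Q" "A b b' \<noteq> 0" for b b'
    using sup that unfolding supported_on_def by blast
  {
    fix c c' assume c: "c \<in> configs Q" "c' \<in> configs Q" and "relabel \<phi> A c c' \<noteq> 0"
    then have "agree_on (- F) (f' c) (f' c')"
      using \<phi> cl by (intro diag) (auto simp: relabel_def)
    then have "fst ` Poly_Mapping.keys (f' (c - c')) \<subseteq> F"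
      using c by (auto simp: agree_on_Compl_keys diff)
    then have "fst ` Poly_Mapping.keys (f (f' (c - c'))) \<subseteq> G"
      using c by (intro out cl configs_diff)
    then show "agree_on (- G) c c'"
      using c inv[OF configs_diff, of c c'] by (auto simp: agree_on_Compl_keys)
  }
  fix b b' c c' :: "('l, 'd) config"
  assume *: "b \<in> configs Q" "b' \<in> configs Q" "c \<in> configs Q" "c' \<in> configs Q"
    and **: "agree_on G b c \<and> agree_on G b' c' \<and> agree_on (- G) b b' \<and> agree_on (- G) c c'"
  (* b - b' may spread beyond F under f', but it equals c - c'; so either both
     transformed pairs agree off F or both entries vanish. *)
  have "agree_on G (b - b') (c - c')" "agree_on (- G) (b - b') (c - c')"
    using ** by (auto simp: agree_on_def lookup_minus)
  then have "b - b' = c - c'" by (rule agree_on_eq)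
  then have eq: "f' b - f' b' = f' c - f' c'" using * diff by metis
  have in_F: "agree_on F (f' x) (f' y)" if "x \<in> configs Q" "y \<in> configs Q" "agree_on G x y" for x y :: "('l, 'd) config"
  proof -
    have "fst ` Poly_Mapping.keys (f' (x - y)) \<subseteq> - F"
      using that by (intro inw) (auto simp: agree_on_keys)
    then show ?thesis using that by (auto simp: agree_on_keys diff)
  qed
  have "A (f' b) (f' b') = A (f' c) (f' c')"
  proof (cases "agree_on (- F) (f' b) (f' b')")
    case True
    then have "agree_on (- F) (f' c) (f' c')" unfolding agree_on_keys eq .
    then show ?thesis
      using sup True in_F[OF *(1,3)] in_F[OF *(2,4)] ** * cl unfolding supported_on_def by blast
  next
    case False
    then have "\<not> agree_on (- F) (f' c) (f' c')" unfolding agree_on_keys eq .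
    with False show ?thesis using diag cl * by metis
  qed
  then show "relabel \<phi> A b b' = relabel \<phi> A c c'" using * \<phi> by (simp add: relabel_def)
qed

lemma relabel_mats:
  assumes "\<And>c. \<phi> c \<in> configs Q \<longleftrightarrow> c \<in> configs Q" "A \<in> mats Q"
  shows "relabel \<phi> A \<in> mats Q"
  using assms by (auto simp: relabel_def mats_def)

text \<open>
  The neighbourhood of a finite set of sites can be infinite, so locality in the sense of the
  metric does not suffice here. A finite support exists because the columns of \<open>f\<close> and
  the rows of \<open>f'\<close>, which are the columns of its adjoint \<open>g'\<close>, are finitely supported.
\<close>
lemma relabel_local:
  fixes A :: "('l, 'd::nontriv) oper"
  assumes f: "adj_on (qudits \<Lambda> q) f g" and f': "adj_on (qudits \<Lambda> q) f' g'"
    and inv: "\<And>x. x \<in> configs (qudits \<Lambda> q) \<Longrightarrow> f (f' x) = x"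
    and \<phi>: "\<And>x. x \<in> configs (qudits \<Lambda> q) \<Longrightarrow> \<phi> x = f' x"
    and \<phi>_iff: "\<And>c. \<phi> c \<in> configs (qudits \<Lambda> q) \<longleftrightarrow> c \<in> configs (qudits \<Lambda> q)"
    and A: "A \<in> local_ops \<Lambda> q"
  shows "relabel \<phi> A \<in> local_ops \<Lambda> q"
proof -
  let ?Q = "qudits \<Lambda> q"
  obtain F where F: "finite F" "F \<subseteq> \<Lambda>" "supported_on ?Q F A"
    using A by (auto simp: local_ops_def)
  let ?K = "SIGMA i:F. {..<q i}"
  have K: "finite ?K" "?K \<subseteq> ?Q" using F by (auto simp: qudits_def)
  define G where "G = (\<Union>k\<in>?K. \<Union>v\<in>UNIV. fst ` Poly_Mapping.keys (f (Poly_Mapping.single k v)))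
    \<union> (\<Union>k\<in>?K. fst ` Poly_Mapping.keys (g' (Poly_Mapping.single k 1)))"
  have finG: "finite G" using K(1) unfolding G_def by auto
  have "G \<subseteq> \<Lambda>"
  proof -
    have "f (Poly_Mapping.single k v) \<in> configs ?Q" "g' (Poly_Mapping.single k v) \<in> configs ?Q"
      if "k \<in> ?K" for k v
      using that K(2) adj_on_closed[OF f] adj_on_closed[OF adj_on_sym[OF f']] by (auto simp: subset_iff)
    then show ?thesis unfolding G_def using configs_keys qudits_site by blast
  qed
  have mem: "k \<in> ?K" if "k \<in> ?Q" "fst k \<in> F" for k using that by (auto simp: qudits_def)
  have "supported_on ?Q G (relabel \<phi> A)"
  proof (rule supported_on_relabel[OF f f' inv \<phi> F(3)])
    fix x :: "('l, 'd) config" assume x: "x \<in> configs ?Q" and xF: "fst ` Poly_Mapping.keys x \<subseteq> F"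
    have "f x = (\<Sum>k\<in>Poly_Mapping.keys x. f (Poly_Mapping.single k (Poly_Mapping.lookup x k)))"
      by (rule additive_expand[OF adj_on_add[OF f] x])
    then have "Poly_Mapping.keys (f x) \<subseteq>
        (\<Union>k\<in>Poly_Mapping.keys x. Poly_Mapping.keys (f (Poly_Mapping.single k (Poly_Mapping.lookup x k))))"
      using keys_sum by metis
    then have fx: "\<exists>k\<in>Poly_Mapping.keys x.
        l \<in> Poly_Mapping.keys (f (Poly_Mapping.single k (Poly_Mapping.lookup x k)))"
      if "l \<in> Poly_Mapping.keys (f x)" for l
      using that by (auto simp: subset_iff)
    show "fst ` Poly_Mapping.keys (f x) \<subseteq> G"
    proof (rule image_subsetI)
      fix l assume "l \<in> Poly_Mapping.keys (f x)"
      then obtain k where kx: "k \<in> Poly_Mapping.keys x"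
        and l: "l \<in> Poly_Mapping.keys (f (Poly_Mapping.single k (Poly_Mapping.lookup x k)))"
        using fx by blast
      have k: "k \<in> ?K" using mem[OF configs_keys[OF x kx]] xF kx by blast
      show "fst l \<in> G"
        unfolding G_def
        by (rule UnI1, rule UN_I[OF k], rule UN_I[OF UNIV_I], rule imageI, rule l)
    qed
  next
    fix x :: "('l, 'd) config" assume x: "x \<in> configs ?Q" and xG: "fst ` Poly_Mapping.keys x \<subseteq> - G"
    have "fst k \<notin> F" if k: "k \<in> Poly_Mapping.keys (f' x)" for k
    proof
      assume "fst k \<in> F"
      then have kK: "k \<in> ?K" using mem k adj_on_closed[OF f' x] configs_keys by blast
      then have e: "Poly_Mapping.single k 1 \<in> configs ?Q" using K(2) by auto
      have "pairing x (g' (Poly_Mapping.single k 1)) \<noteq> 0"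
        using adj_on_pairing[OF f' x e] k by (simp add: in_keys_iff)
      then obtain l where "l \<in> Poly_Mapping.keys x" "l \<in> Poly_Mapping.keys (g' (Poly_Mapping.single k 1))"
        using pairing_nonzero_keys by blast
      then show False using xG kK unfolding G_def by blast
    qed
    then show "fst ` Poly_Mapping.keys (f' x) \<subseteq> - F" by blast
  qed
  then show ?thesis
    using finG \<open>G \<subseteq> \<Lambda>\<close> relabel_mats[OF \<phi>_iff local_ops_mats[OF A]]
    unfolding local_ops_def mats_def mem_Collect_eq by meson
qed

lemma relabel_op_mult:
  assumes "bij \<phi>"
  shows "relabel \<phi> (op_mult A B) = op_mult (relabel \<phi> A) (relabel \<phi> B)"
proof (intro ext)
  fix c c'
  have "Sum_any (\<lambda>b. A (\<phi> c) b * B b (\<phi> c')) = Sum_any (\<lambda>b. A (\<phi> c) (\<phi> b) * B (\<phi> b) (\<phi> c'))"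
    by (rule Sum_any.reindex_cong[OF assms]) (simp add: fun_eq_iff)
  then show "relabel \<phi> (op_mult A B) c c' = op_mult (relabel \<phi> A) (relabel \<phi> B) c c'"
    by (simp add: relabel_def op_mult_def)
qed

context Metric_space
begin

text \<open>
  The automaton is the basis permutation \<open>|c\<rangle> \<mapsto> |f c\<rangle>\<close>. It maps the Pauli operator of \<open>(x, z)\<close> to that
  of \<open>(f x, g' z)\<close> without any phase, where \<open>g'\<close> is the adjoint of \<open>f' = f\<^sup>-\<^sup>1\<close>.
\<close>
lemma separated_qca_exists:
  fixes f g f' g' :: "('a, 'd::nontriv) config \<Rightarrow> ('a, 'd) config"
  assumes f: "adj_on (qudits M q) f g" and f': "adj_on (qudits M q) f' g'"
    and inv: "\<And>x. x \<in> configs (qudits M q) \<Longrightarrow> f (f' x) = x"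
      "\<And>x. x \<in> configs (qudits M q) \<Longrightarrow> f' (f x) = x"
    and loc: "local_map d (qudits M q) f" "local_map d (qudits M q) f'"
  obtains \<alpha> where "clifford_qca M d q \<alpha>" "separated M q \<alpha>"
    "implements M q \<alpha> (\<lambda>u. (f (fst u), g' (snd u)))"
proof -
  let ?Q = "qudits M q"
  (* Extended by the identity, f' and f are bijections of the whole type of configurations, so that
     sums over all configurations can be reindexed. *)
  define \<phi> where "\<phi> c = (if c \<in> configs ?Q then f' c else c)" for c
  define \<psi> where "\<psi> c = (if c \<in> configs ?Q then f c else c)" for c
  have \<phi>_eq: "\<phi> c = f' c" and \<psi>_eq: "\<psi> c = f c" if "c \<in> configs ?Q" for c
    using that by (simp_all add: \<phi>_def \<psi>_def)
  have \<phi>_iff: "\<phi> c \<in> configs ?Q \<longleftrightarrow> c \<in> configs ?Q" for c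
    using adj_on_closed[OF f'] by (simp add: \<phi>_def)
  have \<psi>_iff: "\<psi> c \<in> configs ?Q \<longleftrightarrow> c \<in> configs ?Q" for c
    using adj_on_closed[OF f] by (simp add: \<psi>_def)
  have \<phi>\<psi>: "\<phi> (\<psi> c) = c" "\<psi> (\<phi> c) = c" for c
    using inv adj_on_closed[OF f] adj_on_closed[OF f'] by (auto simp: \<phi>_def \<psi>_def)
  have bij: "bij \<phi>" using \<phi>\<psi> by (metis bijI' )
  let ?\<alpha> = "relabel \<phi> :: ('a, 'd) oper \<Rightarrow> ('a, 'd) oper"
  have pauli: "?\<alpha> (op_scale a (pauli ?Q u)) = op_scale a (pauli ?Q (f (fst u), g' (snd u)))"
    if u: "u \<in> pauli_space ?Q" for a u
  proof (intro ext)
    fix c c' :: "('a, 'd) config"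
    have uQ: "fst u \<in> configs ?Q" "snd u \<in> configs ?Q" using u by (auto simp: pauli_space_iff)
    have "\<phi> c = \<phi> c' + fst u \<longleftrightarrow> c = c' + f (fst u)" if c': "c' \<in> configs ?Q"
    proof -
      have "\<phi> c = \<phi> c' + fst u \<longleftrightarrow> \<phi> c = \<phi> (c' + f (fst u))"
        using c' uQ(1) inv(2) adj_on_add[OF f' c' adj_on_closed[OF f uQ(1)]] adj_on_closed[OF f uQ(1)]
        by (auto simp: \<phi>_def)
      also have "\<dots> \<longleftrightarrow> c = c' + f (fst u)" using bij by (auto dest: bij_is_inj injD)
      finally show ?thesis .
    qed
    moreover have "pairing (snd u) (\<phi> c') = pairing (g' (snd u)) c'" if "c' \<in> configs ?Q"
      using adj_on_pairing[OF adj_on_sym[OF f'] uQ(2) that] that by (simp add: \<phi>_def)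
    ultimately show "?\<alpha> (op_scale a (pauli ?Q u)) c c' = op_scale a (pauli ?Q (f (fst u), g' (snd u))) c c'"
      by (auto simp: relabel_def op_scale_def pauli_def \<phi>_iff)
  qed
  have image: "(f (fst u), g' (snd u)) \<in> pauli_space ?Q" if "u \<in> pauli_space ?Q" for u
    using that adj_on_closed[OF f] adj_on_closed[OF adj_on_sym[OF f']] by (simp add: pauli_space_iff)
  have "bij_betw ?\<alpha> (local_ops M q) (local_ops M q)"
  proof (rule bij_betw_byWitness[where f' = "relabel \<psi>"])
    show "?\<alpha> ` local_ops M q \<subseteq> local_ops M q"
      using relabel_local[OF f f' inv(1) \<phi>_eq \<phi>_iff] by blast
    show "relabel \<psi> ` local_ops M q \<subseteq> local_ops M q"
      using relabel_local[OF f' f inv(2) \<psi>_eq \<psi>_iff] by blast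
  qed (auto simp: relabel_def \<phi>\<psi>)
  then have aut: "algebra_aut M q ?\<alpha>"
    unfolding algebra_aut_def using relabel_op_mult[OF bij]
    by (auto simp: relabel_def op_add_def op_scale_def op_adj_def)
  obtain r where r: "\<And>x l. x \<in> configs ?Q \<Longrightarrow> l \<in> Poly_Mapping.keys (f x) \<Longrightarrow>
      \<exists>k\<in>Poly_Mapping.keys x. d (fst k) (fst l) \<le> r"
    "\<And>x l. x \<in> configs ?Q \<Longrightarrow> l \<in> Poly_Mapping.keys (f' x) \<Longrightarrow>
      \<exists>k\<in>Poly_Mapping.keys x. d (fst k) (fst l) \<le> r"
    using local_map_common_radius[OF loc] by metis
  have "locality_preserving M d q ?\<alpha>"
    unfolding locality_preserving_def
  proof (intro exI[of _ r] ballI allI impI)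
    fix A :: "('a, 'd) oper" and F assume F: "F \<subseteq> M" and sup: "supported_on ?Q F A"
    show "supported_on ?Q (neighbourhood M d r F) (?\<alpha> A)"
    proof (rule supported_on_relabel[OF f f' inv(1) _ sup])
      fix x :: "('a, 'd) config" assume x: "x \<in> configs ?Q" and xF: "fst ` Poly_Mapping.keys x \<subseteq> F"
      have "fst l \<in> neighbourhood M d r F" if l: "l \<in> Poly_Mapping.keys (f x)" for l
        using r(1)[OF x l] xF qudits_site[OF configs_keys[OF adj_on_closed[OF f x] l]]
        unfolding neighbourhood_def by blast
      then show "fst ` Poly_Mapping.keys (f x) \<subseteq> neighbourhood M d r F" by blast
    next
      fix x :: "('a, 'd) config" assume x: "x \<in> configs ?Q" and xG: "fst ` Poly_Mapping.keys x \<subseteq> - neighbourhood M d r F"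
      have "fst l \<notin> F" if l: "l \<in> Poly_Mapping.keys (f' x)" for l
      proof
        assume "fst l \<in> F"
        obtain k where k: "k \<in> Poly_Mapping.keys x" "d (fst k) (fst l) \<le> r" using r(2)[OF x l] by blast
        then have "fst k \<in> neighbourhood M d r F"
          using \<open>fst l \<in> F\<close> qudits_site[OF configs_keys[OF x k(1)]] commute[of "fst k" "fst l"]
          unfolding neighbourhood_def by auto
        then show False using xG k by blast
      qed
      then show "fst ` Poly_Mapping.keys (f' x) \<subseteq> - F" by blast
    qed (auto simp: \<phi>_eq)
  qed
  moreover have "?\<alpha> ` pauli_ops ?Q \<subseteq> pauli_ops ?Q"
    unfolding pauli_ops_def using pauli image by blast
  ultimately have cl: "clifford_qca M d q ?\<alpha>" using aut by (simp add: clifford_qca_def)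
  have imp: "implements M q ?\<alpha> (\<lambda>u. (f (fst u), g' (snd u)))"
    unfolding implements_def
  proof (intro ballI conjI exI[of _ 1])
    fix u :: "('a, 'd) pvec" assume u: "u \<in> pauli_space ?Q"
    show "(f (fst u), g' (snd u)) \<in> pauli_space ?Q" by (rule image[OF u])
    show "?\<alpha> (pauli ?Q u) = op_scale 1 (pauli ?Q (f (fst u), g' (snd u)))"
      using pauli[OF u, of 1] by simp
  qed simp
  have f0: "f 0 = 0" "g' 0 = 0" using adj_on_0[OF f] adj_on_0[OF adj_on_sym[OF f']] by auto
  have pX: "?\<alpha> (op_scale a (pauli ?Q (x, 0))) = op_scale a (pauli ?Q (f x, 0))" if "x \<in> configs ?Q" for a x
    using pauli[of "(x, 0)" a] that f0 by simp
  have pZ: "?\<alpha> (op_scale a (pauli ?Q (0, z))) = op_scale a (pauli ?Q (0, g' z))" if "z \<in> configs ?Q" for a z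
    using pauli[of "(0, z)" a] that f0 by simp
  have g: "adj_on ?Q g f" "adj_on ?Q g' f'" using f f' by (auto intro: adj_on_sym)
  have g'g: "g' (g z) = z" if z: "z \<in> configs ?Q" for z
    using z adj_on_closed[OF g(1)] adj_on_closed[OF g(2)] adj_on_closed[OF f'] inv
    by (intro pairing_nondegenerate[of _ Q] pairing_nondegenerate[of _ ?Q])
      (simp_all add: adj_on_pairing[OF g(1)] adj_on_pairing[OF g(2)])
  have "separated M q ?\<alpha>"
    unfolding separated_def X_group_eq Z_group_eq
  proof (intro conjI equalityI subsetI)
    fix A :: "('a, 'd) oper" assume "A \<in> ?\<alpha> ` {op_scale a (pauli ?Q (x, 0)) |a x. cmod a = 1 \<and> x \<in> configs ?Q}"
    then show "A \<in> {op_scale a (pauli ?Q (x, 0)) |a x. cmod a = 1 \<and> x \<in> configs ?Q}"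
      using pX adj_on_closed[OF f] by blast
  next
    fix A :: "('a, 'd) oper" assume "A \<in> {op_scale a (pauli ?Q (x, 0)) |a x. cmod a = 1 \<and> x \<in> configs ?Q}"
    then obtain a x where A: "A = op_scale a (pauli ?Q (x, 0))" "cmod a = 1" "x \<in> configs ?Q" by blast
    then have "A = ?\<alpha> (op_scale a (pauli ?Q (f' x, 0)))"
      using pX[OF adj_on_closed[OF f' A(3)]] inv(1) by simp
    then show "A \<in> ?\<alpha> ` {op_scale a (pauli ?Q (x, 0)) |a x. cmod a = 1 \<and> x \<in> configs ?Q}"
      using A adj_on_closed[OF f' A(3)] by blast
  next
    fix A :: "('a, 'd) oper" assume "A \<in> ?\<alpha> ` {op_scale a (pauli ?Q (0, x)) |a x. cmod a = 1 \<and> x \<in> configs ?Q}"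
    then show "A \<in> {op_scale a (pauli ?Q (0, x)) |a x. cmod a = 1 \<and> x \<in> configs ?Q}"
      using pZ adj_on_closed[OF g(2)] by blast
  next
    fix A :: "('a, 'd) oper" assume "A \<in> {op_scale a (pauli ?Q (0, x)) |a x. cmod a = 1 \<and> x \<in> configs ?Q}"
    then obtain a x where A: "A = op_scale a (pauli ?Q (0, x))" "cmod a = 1" "x \<in> configs ?Q" by blast
    then have "A = ?\<alpha> (op_scale a (pauli ?Q (0, g x)))"
      using pZ[OF adj_on_closed[OF g(1) A(3)]] g'g by simp
    then show "A \<in> ?\<alpha> ` {op_scale a (pauli ?Q (0, x)) |a x. cmod a = 1 \<and> x \<in> configs ?Q}"
      using A adj_on_closed[OF g(1) A(3)] by blast
  qed
  then show ?thesis using that cl imp by blast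
qed

end


section \<open>Trivial maps and stabilization\<close>

definition gate_group ::
  "'l set \<Rightarrow> ('l \<Rightarrow> 'l \<Rightarrow> real) \<Rightarrow> ('l \<Rightarrow> nat) \<Rightarrow> (('l, 'd::nontriv) pvec \<Rightarrow> ('l, 'd) pvec) set" where
  "gate_group \<Lambda> D q = generate (BijGroup (pauli_space (qudits \<Lambda> q)))
     (single_layer_circuits \<Lambda> D q \<union> qudit_permutations \<Lambda> D q)"

definition trivial_map ::
  "'l set \<Rightarrow> ('l \<Rightarrow> 'l \<Rightarrow> real) \<Rightarrow> ('l \<Rightarrow> nat) \<Rightarrow> (('l, 'd::nontriv) pvec \<Rightarrow> ('l, 'd) pvec) \<Rightarrow> bool" where
  "trivial_map \<Lambda> D q S \<longleftrightarrow> (\<exists>e. \<exists>T\<in>gate_group \<Lambda> D (\<lambda>i. q i + e i). stabilization \<Lambda> q e S T)"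

lemma trivial_qca_iff: "trivial_qca \<Lambda> D q \<alpha> \<longleftrightarrow> trivial_map \<Lambda> D q (mod_phases \<Lambda> q \<alpha>)"
  by (simp add: trivial_qca_def trivial_map_def gate_group_def Let_def)

lemma qudits_mono: "qudits \<Lambda> q \<subseteq> qudits \<Lambda> (\<lambda>i. q i + e i)"
  by (auto simp: qudits_def)

lemma pauli_space_mono: "u \<in> pauli_space Q \<Longrightarrow> Q \<subseteq> Q' \<Longrightarrow> u \<in> pauli_space Q'"
  by (auto simp: pauli_space_iff intro: configs_mono)

definition restr_pair :: "'l qudit set \<Rightarrow> ('l, 'd::nontriv) pvec \<Rightarrow> ('l, 'd) pvec" where
  "restr_pair Q u = (restr Q (fst u), restr Q (snd u))"

lemma restr_pair_space [simp]: "restr_pair Q u \<in> pauli_space Q"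
  by (simp add: restr_pair_def)

lemma restr_pair_add: "restr_pair Q (u + v) = restr_pair Q u + restr_pair Q v"
  by (simp add: restr_pair_def restr_add)

lemma restr_pair_id: "u \<in> pauli_space Q \<Longrightarrow> restr_pair Q u = u"
  by (simp add: restr_pair_def pauli_space_iff restr_id prod_eq_iff)

lemma restr_pair_disjoint: "u \<in> pauli_space Q' \<Longrightarrow> Q \<inter> Q' = {} \<Longrightarrow> restr_pair Q u = 0"
  by (auto simp: restr_pair_def pauli_space_iff prod_eq_iff intro: restr_disjoint)

lemma restr_pair_split:
  assumes "u \<in> pauli_space Q'" "Q \<subseteq> Q'"
  shows "restr_pair Q u + restr_pair (Q' - Q) u = u"
  using assms
  by (auto simp: restr_pair_def pauli_space_iff prod_eq_iff configs_lookup
      intro!: poly_mapping_eqI simp: lookup_add lookup_restr)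

lemma restr_pair_keys: "u \<in> pauli_space K \<Longrightarrow> restr_pair Q u \<in> pauli_space (K \<inter> Q)"
  by (simp add: restr_pair_def pauli_space_iff configs_lookup lookup_restr)

lemma symp_form_disjoint:
  assumes "u \<in> pauli_space Q" "v \<in> pauli_space Q'" "Q \<inter> Q' = {}"
  shows "symp_form u v = 0" "symp_form v u = 0"
proof -
  have "pairing a b = 0" if "a \<in> configs Q" "b \<in> configs Q'" for a b :: "('a, 'b) config"
    using that assms(3) pairing_nonzero_keys[of a b] configs_keys by blast
  then show "symp_form u v = 0" "symp_form v u = 0"
    using assms(1,2) by (auto simp: symp_form_def pauli_space_iff pairing_commute[of "_ v"])
qed

lemma permute_qudits_Bij:
  assumes \<pi>: "\<pi> permutes Q"
  shows "permute_qudits Q \<pi> \<in> Bij (pauli_space Q :: ('l, 'd::nontriv) pvec set)"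
proof -
  let ?P = "pauli_space Q :: ('l, 'd) pvec set"
  have lk: "Poly_Mapping.lookup (Poly_Mapping.map_key f p) k = Poly_Mapping.lookup p (f k)"
    if "f permutes Q" for f and p :: "('l, 'd) config" and k
    using map_key.rep_eq[OF permutes_inj[OF that], of p] by simp
  have cl: "Poly_Mapping.map_key f p \<in> configs Q" if "f permutes Q" "p \<in> configs Q" for f and p :: "('l, 'd) config"
    using that permutes_not_in[OF that(1)] by (simp add: configs_lookup lk)
  have inv: "inv_into UNIV \<pi> permutes Q" by (rule permutes_inv[OF \<pi>])
  have inv2: "inv_into UNIV (inv_into UNIV \<pi>) = \<pi>" by (rule permutes_inv_inv[OF \<pi>])
  have "bij_betw (permute_qudits Q \<pi>) ?P ?P"
  proof (rule bij_betw_byWitness[where f' = "permute_qudits Q (inv_into UNIV \<pi>)"])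
    have id: "Poly_Mapping.map_key \<pi> (Poly_Mapping.map_key (inv_into UNIV \<pi>) p) = p"
      "Poly_Mapping.map_key (inv_into UNIV \<pi>) (Poly_Mapping.map_key \<pi> p) = p" for p :: "('l, 'd) config"
      by (rule poly_mapping_eqI; simp add: lk \<pi> inv permutes_inverses[OF \<pi>])+
    show "\<forall>u\<in>?P. permute_qudits Q (inv_into UNIV \<pi>) (permute_qudits Q \<pi> u) = u"
      "\<forall>u\<in>?P. permute_qudits Q \<pi> (permute_qudits Q (inv_into UNIV \<pi>) u) = u"
      using cl[OF \<pi>] cl[OF inv] by (auto simp: permute_qudits_def inv2 id pauli_space_iff)
    show "permute_qudits Q \<pi> ` ?P \<subseteq> ?P" "permute_qudits Q (inv_into UNIV \<pi>) ` ?P \<subseteq> ?P"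
      using cl[OF \<pi>] cl[OF inv] by (auto simp: permute_qudits_def inv2 pauli_space_iff)
  qed
  then show ?thesis by (simp add: Bij_def permute_qudits_def)
qed

lemma gates_Bij:
  "single_layer_circuits \<Lambda> D q \<union> qudit_permutations \<Lambda> D q \<subseteq> carrier (BijGroup (pauli_space (qudits \<Lambda> q)))"
  using permute_qudits_Bij
  by (auto simp: BijGroup_def single_layer_circuits_def symplectic_aut_def qudit_permutations_def)

lemma gate_group_Bij: "T \<in> gate_group \<Lambda> D q \<Longrightarrow> T \<in> Bij (pauli_space (qudits \<Lambda> q))"
  using group.generate_in_carrier[OF group_BijGroup gates_Bij] unfolding gate_group_def
  by (simp add: BijGroup_def)

lemma gate_group_compose:
  assumes "S \<in> gate_group \<Lambda> D q" "T \<in> gate_group \<Lambda> D q"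
  shows "compose (pauli_space (qudits \<Lambda> q)) S T \<in> gate_group \<Lambda> D q"
  using generate.eng[OF assms[unfolded gate_group_def]] gate_group_Bij[OF assms(1)] gate_group_Bij[OF assms(2)]
  by (simp add: gate_group_def BijGroup_def)

lemma gate_group_inverse:
  assumes "T \<in> gate_group \<Lambda> D q"
  shows "restrict (inv_into (pauli_space (qudits \<Lambda> q)) T) (pauli_space (qudits \<Lambda> q)) \<in> gate_group \<Lambda> D q"
  using group.generate_m_inv_closed[OF group_BijGroup gates_Bij assms[unfolded gate_group_def]]
    inv_BijGroup[OF gate_group_Bij[OF assms]]
  by (simp add: gate_group_def)

text \<open>
  The extension acts as the identity on the added qudits of each block.
\<close>
lemma extend_single_layer:
  fixes S :: "('l, 'd::nontriv) pvec \<Rightarrow> ('l, 'd) pvec"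
  assumes S: "S \<in> single_layer_circuits \<Lambda> D q"
  shows "\<exists>T\<in>single_layer_circuits \<Lambda> D (\<lambda>i. q i + e i). stabilization \<Lambda> q e S T"
proof -
  let ?q' = "\<lambda>i. q i + e i"
  let ?Q = "qudits \<Lambda> q" and ?Q' = "qudits \<Lambda> ?q'"
  let ?R = "?Q' - ?Q"
  have QQ: "?Q \<subseteq> ?Q'" by (rule qudits_mono)
  have sym: "symplectic_aut ?Q S" using S by (simp add: single_layer_circuits_def)
  obtain \<B> r where B: "partition_on \<Lambda> \<B>" "\<forall>B\<in>\<B>. \<forall>i\<in>B. \<forall>j\<in>B. D i j \<le> r"
    "\<forall>B\<in>\<B>. S ` pauli_space (qudits B q) \<subseteq> pauli_space (qudits B q)"
    using S unfolding single_layer_circuits_def mem_Collect_eq by (elim conjE exE)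
  define T where "T = (\<lambda>u\<in>pauli_space ?Q'. S (restr_pair ?Q u) + restr_pair ?R u)"
  have Q': "u + w \<in> pauli_space ?Q'" if "u \<in> pauli_space ?Q" "w \<in> pauli_space ?R" for u w :: "('l, 'd) pvec"
    using pauli_space_mono[OF that(1) QQ] pauli_space_mono[OF that(2) Diff_subset]
    by (rule pauli_space_add)
  have T: "T (u + w) = S u + w" if "u \<in> pauli_space ?Q" "w \<in> pauli_space ?R" for u w
    using that Q'[OF that] restr_pair_disjoint[OF that(1), of ?R, OF Diff_disjoint[THEN trans[OF Int_commute]]]
      restr_pair_disjoint[OF that(2), of ?Q]
    by (simp add: T_def restr_pair_add restr_pair_id)
  have Scl: "S (restr_pair ?Q u) \<in> pauli_space ?Q" for u
    by (rule symplectic_aut_closed[OF sym]) simp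
  have "symplectic_aut ?Q' T"
  proof (rule symplectic_autI)
    fix u v :: "('l, 'd) pvec" assume u: "u \<in> pauli_space ?Q'" and v: "v \<in> pauli_space ?Q'"
    show "T u \<in> pauli_space ?Q'" using u Q'[OF Scl] by (simp add: T_def)
    show "T (u + v) = T u + T v"
      using u v symplectic_aut_add[OF sym] by (simp add: T_def restr_pair_add pauli_space_add)
    have form: "symp_form (a + w) (b + x) = symp_form a b + symp_form w x"
      if "a \<in> pauli_space ?Q" "b \<in> pauli_space ?Q" "w \<in> pauli_space ?R" "x \<in> pauli_space ?R"
      for a b w x :: "('l, 'd) pvec"
      using symp_form_disjoint[OF that(1,4)] symp_form_disjoint[OF that(2,3)]
      by (auto simp: symp_form_add_left symp_form_add_right)
    have "symp_form (T u) (T v) = symp_form (restr_pair ?Q u) (restr_pair ?Q v) + symp_form (restr_pair ?R u) (restr_pair ?R v)"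
      using u v symplectic_aut_form[OF sym] by (simp add: T_def form Scl)
    also have "\<dots> = symp_form (restr_pair ?Q u + restr_pair ?R u) (restr_pair ?Q v + restr_pair ?R v)"
      by (simp add: form)
    also have "\<dots> = symp_form u v"
      by (simp add: restr_pair_split[OF u QQ] restr_pair_split[OF v QQ])
    finally show "symp_form (T u) (T v) = symp_form u v" .
    let ?w = "inv_into (pauli_space ?Q) S (restr_pair ?Q u)"
    have "T (?w + restr_pair ?R u) = u"
      using T[OF symplectic_aut_inv_into(1)[OF sym]] symplectic_aut_inv_into(2)[OF sym]
      by (simp add: restr_pair_split[OF u QQ])
    then show "\<exists>v\<in>pauli_space ?Q'. T v = u"
      by (rule bexI) (rule Q'[OF symplectic_aut_inv_into(1)[OF sym]]; simp)
  qed (simp add: T_def)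
  moreover have "T ` pauli_space (qudits B ?q') \<subseteq> pauli_space (qudits B ?q')" if B': "B \<in> \<B>" for B
  proof (rule image_subsetI)
    fix u :: "('l, 'd) pvec" assume u: "u \<in> pauli_space (qudits B ?q')"
    have "B \<subseteq> \<Lambda>" using B(1) B' by (auto simp: partition_on_def)
    then have sub: "qudits B ?q' \<subseteq> ?Q'" "qudits B ?q' \<inter> ?Q = qudits B q"
      by (auto simp: qudits_def)
    have "restr_pair ?Q u \<in> pauli_space (qudits B q)"
      using restr_pair_keys[OF u, of ?Q] sub(2) by simp
    then have "S (restr_pair ?Q u) \<in> pauli_space (qudits B q)" using B(3) B' by blast
    then have "S (restr_pair ?Q u) \<in> pauli_space (qudits B ?q')"
      by (rule pauli_space_mono[OF _ qudits_mono])
    moreover have "restr_pair ?R u \<in> pauli_space (qudits B ?q')"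
      using restr_pair_keys[OF u, of ?R] by (rule pauli_space_mono) blast
    ultimately show "T u \<in> pauli_space (qudits B ?q')"
      using pauli_space_mono[OF u sub(1)] by (simp add: T_def pauli_space_add)
  qed
  ultimately have "T \<in> single_layer_circuits \<Lambda> D ?q'"
    unfolding single_layer_circuits_def using B(1,2) by blast
  then show ?thesis using T unfolding stabilization_def by blast
qed

lemma stabilization_trans:
  fixes S T U :: "('a, 'd::nontriv) pvec \<Rightarrow> ('a, 'd) pvec"
  assumes ST: "stabilization \<Lambda> q e S T" and TU: "stabilization \<Lambda> (\<lambda>i. q i + e i) e' T U"
  shows "stabilization \<Lambda> q (\<lambda>i. e i + e' i) S U"
  unfolding stabilization_def
proof (intro ballI)
  let ?Q = "qudits \<Lambda> q" and ?Q1 = "qudits \<Lambda> (\<lambda>i. q i + e i)" and ?Q2 = "qudits \<Lambda> (\<lambda>i. q i + (e i + e' i))"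
  fix u w :: "('a, 'd) pvec" assume u: "u \<in> pauli_space ?Q" and w: "w \<in> pauli_space (?Q2 - ?Q)"
  have sub: "?Q \<subseteq> ?Q1" "?Q1 \<subseteq> ?Q2" by (auto simp: qudits_def)
  let ?w1 = "restr_pair (?Q1 - ?Q) w" and ?w2 = "restr_pair (?Q2 - ?Q1) w"
  have "(?Q2 - ?Q) - (?Q1 - ?Q) = ?Q2 - ?Q1" using sub by blast
  then have split: "?w1 + ?w2 = w"
    using restr_pair_split[OF w, of "?Q1 - ?Q"] sub by auto
  have u1: "u + ?w1 \<in> pauli_space ?Q1"
    using pauli_space_mono[OF u sub(1)] pauli_space_mono[of ?w1 "?Q1 - ?Q" ?Q1] by auto
  have "U ((u + ?w1) + ?w2) = T (u + ?w1) + ?w2"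
    using TU[unfolded stabilization_def, rule_format, OF u1, of ?w2] by (simp add: add.assoc)
  also have "T (u + ?w1) = S u + ?w1"
    using ST[unfolded stabilization_def, rule_format, OF u, of ?w1] by simp
  finally show "U (u + w) = S u + w" using split by (simp add: add.assoc)
qed

lemma trivial_map_cong:
  assumes "trivial_map \<Lambda> D q S" "\<And>u. u \<in> pauli_space (qudits \<Lambda> q) \<Longrightarrow> S' u = S u"
  shows "trivial_map \<Lambda> D q S'"
proof -
  obtain e T where e: "T \<in> gate_group \<Lambda> D (\<lambda>i. q i + e i)" "stabilization \<Lambda> q e S T"
    using assms(1) unfolding trivial_map_def by blast
  then have "stabilization \<Lambda> q e S' T" using assms(2) unfolding stabilization_def by simp
  then show ?thesis using e(1) unfolding trivial_map_def by blast
qed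

lemma trivial_map_gate:
  assumes "S \<in> single_layer_circuits \<Lambda> D q"
  shows "trivial_map \<Lambda> D q S"
proof -
  have "S \<in> gate_group \<Lambda> D (\<lambda>i. q i + 0)"
    unfolding gate_group_def using assms by (auto intro: generate.incl)
  moreover have "stabilization \<Lambda> q (\<lambda>i. 0) S S"
    by (auto simp: stabilization_def pauli_space_def configs_def zero_prod_def[symmetric])
  ultimately show ?thesis unfolding trivial_map_def by (intro exI[of _ "\<lambda>i. 0"]) auto
qed

lemma trivial_map_destabilize:
  assumes "trivial_map \<Lambda> D (\<lambda>i. q i + e i) T" "stabilization \<Lambda> q e S T"
  shows "trivial_map \<Lambda> D q S"
proof -
  obtain e' U where U: "U \<in> gate_group \<Lambda> D (\<lambda>i. q i + e i + e' i)"
    "stabilization \<Lambda> (\<lambda>i. q i + e i) e' T U" using assms(1) unfolding trivial_map_def by blast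
  then have "U \<in> gate_group \<Lambda> D (\<lambda>i. q i + (e i + e' i))" by (simp add: add.assoc)
  then show ?thesis unfolding trivial_map_def
    using stabilization_trans[OF assms(2) U(2)] by (intro exI[of _ "\<lambda>i. e i + e' i"]) blast
qed

context Metric_space
begin

lemma extend_permutation:
  fixes S :: "('a, 'd::nontriv) pvec \<Rightarrow> ('a, 'd) pvec"
  assumes S: "S \<in> qudit_permutations M d q"
  shows "\<exists>T\<in>qudit_permutations M d (\<lambda>i. q i + e i). stabilization M q e S T"
proof -
  let ?q' = "\<lambda>i. q i + e i"
  let ?Q = "qudits M q" and ?Q' = "qudits M ?q'"
  obtain \<pi> r where \<pi>: "\<pi> permutes ?Q" "S = permute_qudits ?Q \<pi>"
    "\<forall>k\<in>?Q. d (fst k) (fst (\<pi> k)) \<le> r"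
    using S unfolding qudit_permutations_def by blast
  have \<pi>': "\<pi> permutes ?Q'" using permutes_subset[OF \<pi>(1) qudits_mono] .
  have "d (fst k) (fst (\<pi> k)) \<le> max r 0" if k: "k \<in> ?Q'" for k
  proof (cases "k \<in> ?Q")
    case True
    then show ?thesis using \<pi>(3) by fastforce
  next
    case False
    then show ?thesis using permutes_not_in[OF \<pi>(1)] qudits_site[OF k] by simp
  qed
  then have "permute_qudits ?Q' \<pi> \<in> qudit_permutations M d ?q'"
    unfolding qudit_permutations_def using \<pi>' by blast
  moreover have "stabilization M q e S (permute_qudits ?Q' \<pi>)"
    unfolding stabilization_def
  proof (intro ballI)
    fix u w :: "('a, 'd) pvec" assume u: "u \<in> pauli_space ?Q" and w: "w \<in> pauli_space (?Q' - ?Q)"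
    have lk: "Poly_Mapping.lookup (Poly_Mapping.map_key (inv_into UNIV \<pi>) p) k = Poly_Mapping.lookup p (inv_into UNIV \<pi> k)"
      for p :: "('a, 'd) config" and k
      using map_key.rep_eq[OF permutes_inj[OF permutes_inv[OF \<pi>(1)]], of p] by simp
    have "Poly_Mapping.map_key (inv_into UNIV \<pi>) p = p" if p: "p \<in> configs (?Q' - ?Q)" for p :: "('a, 'd) config"
    proof (rule poly_mapping_eqI)
      fix k
      have "inv_into UNIV \<pi> k = k \<or> k \<in> ?Q \<and> inv_into UNIV \<pi> k \<in> ?Q"
        using permutes_not_in[OF permutes_inv[OF \<pi>(1)]] permutes_in_image[OF permutes_inv[OF \<pi>(1)]]
        by blast
      then show "Poly_Mapping.lookup (Poly_Mapping.map_key (inv_into UNIV \<pi>) p) k = Poly_Mapping.lookup p k"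
        using p by (auto simp: lk configs_lookup)
    qed
    moreover have "Poly_Mapping.map_key (inv_into UNIV \<pi>) (p + p') =
        Poly_Mapping.map_key (inv_into UNIV \<pi>) p + Poly_Mapping.map_key (inv_into UNIV \<pi>) p'" for p p' :: "('a, 'd) config"
      by (rule poly_mapping_eqI) (simp add: lk lookup_add)
    moreover have "u + w \<in> pauli_space ?Q'"
      using pauli_space_mono[OF u qudits_mono] pauli_space_mono[OF w Diff_subset]
      by (rule pauli_space_add)
    ultimately show "permute_qudits ?Q' \<pi> (u + w) = S u + w"
      using u w by (simp add: permute_qudits_def \<pi>(2) pauli_space_iff prod_eq_iff)
  qed
  ultimately show ?thesis by blast
qed

text \<open>
  The added qudits are numbered after the existing ones, so the stabilizations of a system are
  nested. Hence maps whose circuits use different numbers of added qudits can be composed after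
  extending all circuits to a common system.
\<close>
lemma extend_gate_group:
  fixes S :: "('a, 'd::nontriv) pvec \<Rightarrow> ('a, 'd) pvec"
  assumes "S \<in> gate_group M d q"
  shows "\<exists>T\<in>gate_group M d (\<lambda>i. q i + e i). stabilization M q e S T"
proof -
  let ?q' = "\<lambda>i. q i + e i"
  let ?Q = "qudits M q" and ?Q' = "qudits M ?q'"
  let ?P = "pauli_space ?Q :: ('a, 'd) pvec set" and ?P' = "pauli_space ?Q' :: ('a, 'd) pvec set"
  have sum: "u + w \<in> ?P'" if "u \<in> ?P" "w \<in> pauli_space (?Q' - ?Q)" for u w
    using pauli_space_mono[OF that(1) qudits_mono] pauli_space_mono[OF that(2) Diff_subset]
    by (rule pauli_space_add)
  have gate: "\<exists>T\<in>gate_group M d ?q'. stabilization M q e h T"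
    if "h \<in> single_layer_circuits M d q \<union> qudit_permutations M d q" for h :: "('a, 'd) pvec \<Rightarrow> ('a, 'd) pvec"
    using that
  proof
    assume "h \<in> single_layer_circuits M d q"
    then obtain T where "T \<in> single_layer_circuits M d ?q'" "stabilization M q e h T"
      using extend_single_layer by blast
    then show ?thesis unfolding gate_group_def by (intro bexI[of _ T] generate.incl) auto
  next
    assume "h \<in> qudit_permutations M d q"
    then obtain T where "T \<in> qudit_permutations M d ?q'" "stabilization M q e h T"
      using extend_permutation by blast
    then show ?thesis unfolding gate_group_def by (intro bexI[of _ T] generate.incl) auto
  qed
  show ?thesis
    using assms unfolding gate_group_def[of M d q]
  proof induction
    case one
    have "restrict (\<lambda>u. u) ?P' \<in> gate_group M d ?q'"
      using generate.one[of "BijGroup ?P'"] unfolding gate_group_def by (simp add: BijGroup_def)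
    moreover have "stabilization M q e \<one>\<^bsub>BijGroup ?P\<^esub> (restrict (\<lambda>u. u) ?P')"
      using sum by (simp add: stabilization_def BijGroup_def)
    ultimately show ?case by blast
  next
    case (incl h)
    then show ?case by (rule gate)
  next
    case (inv h)
    obtain T where T: "T \<in> gate_group M d ?q'" "stabilization M q e h T" using gate[OF inv] by blast
    have h: "h \<in> Bij ?P" using inv gates_Bij[of M d q] by (auto simp: BijGroup_def)
    have bh: "bij_betw h ?P ?P" using h by (simp add: Bij_def)
    have bT: "bij_betw T ?P' ?P'" using gate_group_Bij[OF T(1)] by (simp add: Bij_def)
    have "stabilization M q e (inv\<^bsub>BijGroup ?P\<^esub> h) (restrict (inv_into ?P' T) ?P')"
      unfolding stabilization_def inv_BijGroup[OF h]
    proof (intro ballI)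
      fix u w :: "('a, 'd) pvec" assume u: "u \<in> ?P" and w: "w \<in> pauli_space (?Q' - ?Q)"
      let ?v = "inv_into ?P h u"
      have v: "?v \<in> ?P" "h ?v = u"
        using bh u by (auto simp: bij_betw_def inv_into_into f_inv_into_f)
      have "T (?v + w) = u + w" using T(2) v w by (simp add: stabilization_def)
      then have "inv_into ?P' T (u + w) = ?v + w"
        using inv_into_f_f[OF bij_betw_imp_inj_on[OF bT] sum[OF v(1) w]] by simp
      then show "restrict (inv_into ?P' T) ?P' (u + w) = restrict (inv_into ?P h) ?P u + w"
        using sum[OF u w] u by simp
    qed
    then show ?case using gate_group_inverse[OF T(1)] by blast
  next
    case (eng h1 h2)
    then obtain T1 T2 where T: "T1 \<in> gate_group M d ?q'" "stabilization M q e h1 T1"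
      "T2 \<in> gate_group M d ?q'" "stabilization M q e h2 T2" by blast
    have h: "h1 \<in> Bij ?P" "h2 \<in> Bij ?P"
      using eng gate_group_Bij unfolding gate_group_def by blast+
    then have h2: "h2 u \<in> ?P" if "u \<in> ?P" for u using that by (auto simp: Bij_def dest: bij_betwE)
    have "stabilization M q e (h1 \<otimes>\<^bsub>BijGroup ?P\<^esub> h2) (compose ?P' T1 T2)"
      using T(2,4) h h2 sum unfolding stabilization_def by (simp add: BijGroup_def compose_def)
    then show ?case using gate_group_compose[OF T(1,3)] by blast
  qed
qed

lemma trivial_map_compose:
  fixes S T U :: "('a, 'd::nontriv) pvec \<Rightarrow> ('a, 'd) pvec"
  assumes S: "trivial_map M d q S" and T: "trivial_map M d q T"
    and cl: "\<And>u. u \<in> pauli_space (qudits M q) \<Longrightarrow> T u \<in> pauli_space (qudits M q)"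
    and U: "\<And>u. u \<in> pauli_space (qudits M q) \<Longrightarrow> U u = S (T u)"
  shows "trivial_map M d q U"
proof -
  obtain e S' where e: "S' \<in> gate_group M d (\<lambda>i. q i + e i)" "stabilization M q e S S'"
    using S unfolding trivial_map_def by blast
  obtain e' T' where e': "T' \<in> gate_group M d (\<lambda>i. q i + e' i)" "stabilization M q e' T T'"
    using T unfolding trivial_map_def by blast
  obtain S'' where S'': "S'' \<in> gate_group M d (\<lambda>i. q i + e i + e' i)"
    "stabilization M (\<lambda>i. q i + e i) e' S' S''" using extend_gate_group[OF e(1)] by blast
  obtain T'' where T'': "T'' \<in> gate_group M d (\<lambda>i. q i + e' i + e i)"
    "stabilization M (\<lambda>i. q i + e' i) e T' T''" using extend_gate_group[OF e'(1)] by blast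
  let ?e = "\<lambda>i. e i + e' i"
  let ?Q = "qudits M q" and ?Q' = "qudits M (\<lambda>i. q i + ?e i)"
  have s: "S'' \<in> gate_group M d (\<lambda>i. q i + ?e i)" "stabilization M q ?e S S''"
    using S'' stabilization_trans[OF e(2) S''(2)] by (simp_all add: add.assoc)
  have t: "T'' \<in> gate_group M d (\<lambda>i. q i + ?e i)" "stabilization M q ?e T T''"
    using T'' stabilization_trans[OF e'(2) T''(2)] by (simp_all add: ac_simps)
  have "u + w \<in> pauli_space ?Q'" if "u \<in> pauli_space ?Q" "w \<in> pauli_space (?Q' - ?Q)" for u w :: "('a, 'd) pvec"
    using pauli_space_mono[OF that(1) qudits_mono] pauli_space_mono[OF that(2) Diff_subset]
    by (rule pauli_space_add)
  then have "stabilization M q ?e U (compose (pauli_space ?Q') S'' T'')"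
    using s(2) t(2) cl U unfolding stabilization_def by (simp add: compose_def)
  then show ?thesis unfolding trivial_map_def using gate_group_compose[OF s(1) t(1)] by blast
qed

lemma onsite_gate:
  assumes "symplectic_aut (qudits M q) S"
    and "\<And>i. i \<in> M \<Longrightarrow> S ` pauli_space (qudits {i} q) \<subseteq> pauli_space (qudits {i} q)"
  shows "S \<in> single_layer_circuits M d q"
proof -
  have "partition_on M ((\<lambda>i. {i}) ` M)" by (auto simp: partition_on_def disjoint_def)
  moreover have "\<forall>B\<in>(\<lambda>i. {i}) ` M. \<forall>i\<in>B. \<forall>j\<in>B. d i j \<le> 0" by auto
  ultimately show ?thesis
    using assms unfolding single_layer_circuits_def by blast
qed

end


section \<open>Shears and the Fourier transform\<close>

text \<open>
  For symmetric \<open>A\<close> this is, modulo phases, the action of commuting gates that are diagonal in the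
  basis \<open>|c\<rangle>\<close>: controlled-Z gates for the entries off the diagonal, phase gates for those on it.
\<close>
definition shear ::
  "'l qudit set \<Rightarrow> (('l, 'd::nontriv) config \<Rightarrow> ('l, 'd) config) \<Rightarrow> ('l, 'd) pvec \<Rightarrow> ('l, 'd) pvec" where
  "shear Q A = (\<lambda>u\<in>pauli_space Q. (fst u, snd u + A (fst u)))"

definition fourier :: "'l qudit set \<Rightarrow> ('l, 'd::nontriv) pvec \<Rightarrow> ('l, 'd) pvec" where
  "fourier Q = (\<lambda>u\<in>pauli_space Q. (- snd u, fst u))"

definition inv_fourier :: "'l qudit set \<Rightarrow> ('l, 'd::nontriv) pvec \<Rightarrow> ('l, 'd) pvec" where
  "inv_fourier Q = (\<lambda>u\<in>pauli_space Q. (snd u, - fst u))"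

lemma shear_symplectic:
  fixes A :: "('l, 'd::nontriv) config \<Rightarrow> ('l, 'd) config"
  assumes A: "adj_on Q A A"
  shows "symplectic_aut Q (shear Q A)"
proof (rule symplectic_autI)
  fix u v :: "('l, 'd) pvec" assume u: "u \<in> pauli_space Q" and v: "v \<in> pauli_space Q"
  have Q: "fst u \<in> configs Q" "snd u \<in> configs Q" "fst v \<in> configs Q" "snd v \<in> configs Q"
    using u v by (auto simp: pauli_space_iff)
  show "shear Q A u \<in> pauli_space Q"
    using u Q adj_on_closed[OF A] by (auto simp: shear_def)
  show "shear Q A (u + v) = shear Q A u + shear Q A v"
    using u v adj_on_add[OF A Q(1,3)] by (simp add: shear_def pauli_space_add prod_eq_iff)
  show "symp_form (shear Q A u) (shear Q A v) = symp_form u v"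
    using u v adj_on_pairing[OF A Q(1,3)]
    by (simp add: shear_def symp_form_def pairing_add_left pairing_add_right)
  have w: "(fst u, snd u - A (fst u)) \<in> pauli_space Q" using Q adj_on_closed[OF A] by auto
  then have "shear Q A (fst u, snd u - A (fst u)) = u" by (simp add: shear_def)
  with w show "\<exists>v\<in>pauli_space Q. shear Q A v = u" by blast
qed (simp add: shear_def)

lemma fourier_symplectic: "symplectic_aut Q (fourier Q :: ('l, 'd::nontriv) pvec \<Rightarrow> ('l, 'd) pvec)"
proof (rule symplectic_autI)
  fix u v :: "('l, 'd) pvec" assume u: "u \<in> pauli_space Q" and v: "v \<in> pauli_space Q"
  show "fourier Q u \<in> pauli_space Q"
    using u by (auto simp: fourier_def pauli_space_iff)
  show "fourier Q (u + v) = fourier Q u + fourier Q v"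
    using u v by (simp add: fourier_def pauli_space_add prod_eq_iff)
  show "symp_form (fourier Q u) (fourier Q v) = symp_form u v"
    using u v by (simp add: fourier_def symp_form_def pairing_uminus pairing_commute)
  have w: "(snd u, - fst u) \<in> pauli_space Q" using u by (auto simp: pauli_space_iff)
  then have "fourier Q (snd u, - fst u) = u" by (simp add: fourier_def)
  with w show "\<exists>v\<in>pauli_space Q. fourier Q v = u" by blast
qed (simp add: fourier_def)

lemma inv_fourier_symplectic: "symplectic_aut Q (inv_fourier Q :: ('l, 'd::nontriv) pvec \<Rightarrow> ('l, 'd) pvec)"
proof (rule symplectic_autI)
  fix u v :: "('l, 'd) pvec" assume u: "u \<in> pauli_space Q" and v: "v \<in> pauli_space Q"
  show "inv_fourier Q u \<in> pauli_space Q"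
    using u by (auto simp: inv_fourier_def pauli_space_iff)
  show "inv_fourier Q (u + v) = inv_fourier Q u + inv_fourier Q v"
    using u v by (simp add: inv_fourier_def pauli_space_add prod_eq_iff)
  show "symp_form (inv_fourier Q u) (inv_fourier Q v) = symp_form u v"
    using u v by (simp add: inv_fourier_def symp_form_def pairing_uminus pairing_commute)
  have w: "(- snd u, fst u) \<in> pauli_space Q" using u by (auto simp: pauli_space_iff)
  then have "inv_fourier Q (- snd u, fst u) = u" by (simp add: inv_fourier_def)
  with w show "\<exists>v\<in>pauli_space Q. inv_fourier Q v = u" by blast
qed (simp add: inv_fourier_def)


section \<open>Splitting a symmetric map\<close>

text \<open>
  The matrix entries \<open>A\<^sub>k\<^sub>l\<close> with \<open>R k l\<close>, and zeros elsewhere.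
\<close>
definition part ::
  "('l qudit \<Rightarrow> 'l qudit \<Rightarrow> bool) \<Rightarrow> (('l, 'd::nontriv) config \<Rightarrow> ('l, 'd) config) \<Rightarrow> ('l, 'd) config \<Rightarrow> ('l, 'd) config"
where
  "part R A x = (\<Sum>l\<in>Poly_Mapping.keys x. restr {k. R k l} (A (Poly_Mapping.single l (Poly_Mapping.lookup x l))))"

lemma part_closed:
  fixes A :: "('l, 'd::nontriv) config \<Rightarrow> ('l, 'd) config"
  assumes A: "adj_on Q A A" and x: "x \<in> configs Q"
  shows "part R A x \<in> configs Q"
  unfolding part_def using x
  by (intro configs_sum restr_configs_mono adj_on_closed[OF A]) (auto simp: configs_def in_keys_iff)

lemma part_adjoint:
  fixes A :: "('l, 'd::nontriv) config \<Rightarrow> ('l, 'd) config"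
  assumes A: "adj_on Q A A"
  shows "adj_on Q (part R A) (part (\<lambda>k l. R l k) A)"
proof (rule adj_onI)
  have s: "Poly_Mapping.single l (Poly_Mapping.lookup x l) \<in> configs Q"
    if "x \<in> configs Q" for x :: "('l, 'd) config" and l
    using that by (auto simp: configs_def in_keys_iff)
  fix x y :: "('l, 'd) config" assume x: "x \<in> configs Q" and y: "y \<in> configs Q"
  have pairing_part: "pairing (part R A x) y =
    (\<Sum>l\<in>Poly_Mapping.keys x. \<Sum>k\<in>Poly_Mapping.keys y.
      (if R k l then pairing (A (Poly_Mapping.single l (Poly_Mapping.lookup x l)))
        (Poly_Mapping.single k (Poly_Mapping.lookup y k)) else 0))" for x y :: "('l, 'd) config" and R
    unfolding part_def pairing_sum_left
    by (intro sum.cong refl, subst pairing_commute, subst pairing_def)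
      (auto intro!: sum.cong simp: lookup_restr mult.commute)
  have sym: "pairing (A (Poly_Mapping.single l (Poly_Mapping.lookup x l)))
      (Poly_Mapping.single k (Poly_Mapping.lookup y k)) =
    pairing (A (Poly_Mapping.single k (Poly_Mapping.lookup y k)))
      (Poly_Mapping.single l (Poly_Mapping.lookup x l))" for k l
    using adj_on_pairing[OF A s[OF x] s[OF y], of l k] by (simp only: pairing_commute)
  have "pairing (part R A x) y = pairing (part (\<lambda>k l. R l k) A y) x"
    unfolding pairing_part by (subst sum.swap) (intro sum.cong refl if_cong sym)
  then show "pairing (part R A x) y = pairing x (part (\<lambda>k l. R l k) A y)"
    by (simp only: pairing_commute)
qed (rule part_closed[OF A]; assumption)+

lemma part_local:
  assumes "local_map D Q A"
  shows "local_map D Q (part R A)"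
proof -
  obtain r where r: "\<forall>x\<in>configs Q. \<forall>l\<in>Poly_Mapping.keys (A x). \<exists>k\<in>Poly_Mapping.keys x. D (fst k) (fst l) \<le> r"
    using assms unfolding local_map_def by blast
  show ?thesis
    unfolding local_map_def
  proof (intro exI ballI)
    fix x l assume x: "x \<in> configs Q" and l: "l \<in> Poly_Mapping.keys (part R A x)"
    obtain k where k: "k \<in> Poly_Mapping.keys x"
      "l \<in> Poly_Mapping.keys (A (Poly_Mapping.single k (Poly_Mapping.lookup x k)))"
      using l keys_sum[of "\<lambda>l. restr {k. R k l} (A (Poly_Mapping.single l (Poly_Mapping.lookup x l)))" "Poly_Mapping.keys x"]
      unfolding part_def keys_restr by blast
    have "Poly_Mapping.single k (Poly_Mapping.lookup x k) \<in> configs Q"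
      using x by (auto simp: configs_def in_keys_iff)
    then have "D (fst k) (fst l) \<le> r" using r[rule_format, OF _ k(2)] by (auto split: if_splits)
    then show "\<exists>k\<in>Poly_Mapping.keys x. D (fst k) (fst l) \<le> r" using k(1) by blast
  qed
qed

lemma part_diagonal:
  assumes "x \<in> configs K"
  shows "part (=) A x \<in> configs K"
  unfolding part_def
proof (rule configs_sum)
  fix l assume "l \<in> Poly_Mapping.keys x"
  then have "l \<in> K" using assms configs_keys by blast
  then show "restr {k. k = l} (A (Poly_Mapping.single l (Poly_Mapping.lookup x l))) \<in> configs K"
    by (auto simp: configs_lookup lookup_restr)
qed

text \<open>
  A symmetric matrix is the sum of its diagonal, of one half of the off-diagonal entries and of
  the transpose of that half. Multiplication of \<open>A\<close> by one half will not do, as \<open>d\<close> may be even.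
  Picking an arbitrary element of each pair \<open>{k, l}\<close> orients all the pairs.
\<close>
definition chosen_first :: "'k \<Rightarrow> 'k \<Rightarrow> bool" where
  "chosen_first k l \<longleftrightarrow> k \<noteq> l \<and> k = (SOME m. m = k \<or> m = l)"

lemma chosen_first_trichotomy:
  "k = l \<and> \<not> chosen_first k l \<and> \<not> chosen_first l k \<or>
   k \<noteq> l \<and> chosen_first k l \<and> \<not> chosen_first l k \<or>
   k \<noteq> l \<and> \<not> chosen_first k l \<and> chosen_first l k"
proof -
  have "(SOME m. m = k \<or> m = l) = k \<or> (SOME m. m = k \<or> m = l) = l"
    by (rule someI[of "\<lambda>m. m = k \<or> m = l" k]) simp
  moreover have "(SOME m. m = l \<or> m = k) = (SOME m. m = k \<or> m = l)"
    by (rule arg_cong[where f = Eps]) auto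
  ultimately show ?thesis unfolding chosen_first_def by metis
qed

lemma part_split:
  fixes A :: "('l, 'd::nontriv) config \<Rightarrow> ('l, 'd) config"
  assumes A: "adj_on Q A A" and x: "x \<in> configs Q"
  shows "A x = part chosen_first A x + part (\<lambda>k l. chosen_first l k) A x + part (=) A x"
proof -
  have split: "restr {k. chosen_first k l} c + restr {k. chosen_first l k} c + restr {k. k = l} c = c"
    for l and c :: "('l, 'd) config"
  proof (rule poly_mapping_eqI)
    fix k
    show "Poly_Mapping.lookup (restr {k. chosen_first k l} c + restr {k. chosen_first l k} c + restr {k. k = l} c) k
      = Poly_Mapping.lookup c k"
      using chosen_first_trichotomy[of k l] by (auto simp: lookup_add lookup_restr)
  qed
  have "A x = (\<Sum>l\<in>Poly_Mapping.keys x. A (Poly_Mapping.single l (Poly_Mapping.lookup x l)))"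
    by (rule additive_expand[OF adj_on_add[OF A] x])
  then show ?thesis unfolding part_def sum.distrib[symmetric] split .
qed


section \<open>Shears are trivial once separated automata are\<close>

text \<open>
  In the doubled system the copy of qudit \<open>(i, k)\<close> is \<open>(i, k + q i)\<close>. Outside the doubled system the
  identity makes this an involution of the whole type.
\<close>
definition swap_copy :: "('a \<Rightarrow> nat) \<Rightarrow> 'a qudit \<Rightarrow> 'a qudit" where
  "swap_copy q k = (fst k,
     if snd k < q (fst k) then snd k + q (fst k)
     else if snd k < q (fst k) + q (fst k) then snd k - q (fst k) else snd k)"

lemma swap_copy_involution: "swap_copy q (swap_copy q k) = k"
  by (cases k) (auto simp: swap_copy_def)

lemma swap_copy_qudits:
  "swap_copy q k \<in> qudits \<Lambda> (\<lambda>i. q i + q i) \<longleftrightarrow> k \<in> qudits \<Lambda> (\<lambda>i. q i + q i)"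
  "k \<in> qudits \<Lambda> q \<Longrightarrow> swap_copy q k \<notin> qudits \<Lambda> q"
  by (cases k; auto simp: swap_copy_def qudits_def)+

lemma lookup_swap_copy:
  "Poly_Mapping.lookup (Poly_Mapping.map_key (swap_copy q) x) k = Poly_Mapping.lookup x (swap_copy q k)"
proof -
  have "inj (swap_copy q)" by (metis injI swap_copy_involution)
  then show ?thesis using map_key.rep_eq[of "swap_copy q" x] by simp
qed

context Metric_space
begin

lemma trivial_onsite_shear:
  assumes A: "adj_on (qudits M q) A A"
    and on: "\<And>i x. i \<in> M \<Longrightarrow> x \<in> configs (qudits {i} q) \<Longrightarrow> A x \<in> configs (qudits {i} q)"
  shows "trivial_map M d q (shear (qudits M q) A)"
proof (rule trivial_map_gate, rule onsite_gate[OF shear_symplectic[OF A]])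
  fix i assume i: "i \<in> M"
  then have "qudits {i} q \<subseteq> qudits M q" by (auto simp: qudits_def)
  then show "shear (qudits M q) A ` pauli_space (qudits {i} q) \<subseteq> pauli_space (qudits {i} q)"
    using on[OF i] by (auto simp: shear_def pauli_space_iff configs_mono intro!: configs_add)
qed

lemma separated_trivial_map:
  fixes f g f' g' :: "('a, 'd::nontriv) config \<Rightarrow> ('a, 'd) config"
  assumes sep: "\<forall>q (\<alpha> :: ('a, 'd) oper \<Rightarrow> ('a, 'd) oper).
      clifford_qca M d q \<alpha> \<and> separated M q \<alpha> \<longrightarrow> trivial_qca M d q \<alpha>"
    and f: "adj_on (qudits M q) f g" and f': "adj_on (qudits M q) f' g'"
    and inv: "\<And>x. x \<in> configs (qudits M q) \<Longrightarrow> f (f' x) = x"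
      "\<And>x. x \<in> configs (qudits M q) \<Longrightarrow> f' (f x) = x"
    and loc: "local_map d (qudits M q) f" "local_map d (qudits M q) f'"
  shows "trivial_map M d q (\<lambda>u. (f (fst u), g' (snd u)))"
proof -
  obtain \<alpha> where \<alpha>: "clifford_qca M d q \<alpha>" "separated M q \<alpha>"
    and imp: "implements M q \<alpha> (\<lambda>u. (f (fst u), g' (snd u)))"
    by (rule separated_qca_exists[OF f f' inv loc])
  have "trivial_map M d q (mod_phases M q \<alpha>)"
    using sep \<alpha> trivial_qca_iff by blast
  then show ?thesis
    by (rule trivial_map_cong) (simp add: implements_mod_phases[OF imp])
qed

text \<open>
  With \<open>K\<close> exchanging the system and its copy, and \<open>b\<close> acting as \<open>B\<close> on the system and as \<open>0\<close> on the
  copy, \<open>G = K b\<close> maps the system into the copy. So \<open>1 + G\<close> has the inverse \<open>1 - G\<close>, and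
  \<open>(1 + G)\<^sup>T K (1 + G) - K = K G + G\<^sup>T K + G\<^sup>T K G = b + b\<^sup>T\<close>,
  since \<open>K K = 1\<close> and \<open>b\<^sup>T K b = 0\<close>. Conjugating the on-site shear by \<open>K\<close> with the separated map
  of \<open>1 + G\<close> and then applying the on-site shear by \<open>- K\<close> thus gives the shear by \<open>b + b\<^sup>T\<close>.
\<close>
lemma trivial_symmetrized_shear:
  fixes B Bt :: "('a, 'd::nontriv) config \<Rightarrow> ('a, 'd) config"
  assumes sep: "\<forall>q (\<alpha> :: ('a, 'd) oper \<Rightarrow> ('a, 'd) oper).
      clifford_qca M d q \<alpha> \<and> separated M q \<alpha> \<longrightarrow> trivial_qca M d q \<alpha>"
    and B: "adj_on (qudits M q) B Bt" and loc: "local_map d (qudits M q) B"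
  shows "trivial_map M d q (shear (qudits M q) (\<lambda>x. B x + Bt x))"
proof -
  let ?q2 = "\<lambda>i. q i + q i"
  let ?Q = "qudits M q" and ?Q2 = "qudits M ?q2"
  have QQ: "?Q \<subseteq> ?Q2" by (rule qudits_mono)
  define K :: "('a, 'd) config \<Rightarrow> ('a, 'd) config" where "K = Poly_Mapping.map_key (swap_copy q)"
  have lk: "Poly_Mapping.lookup (K x) k = Poly_Mapping.lookup x (swap_copy q k)" for x k
    by (simp add: K_def lookup_swap_copy)
  have KK: "K (K x) = x" for x by (rule poly_mapping_eqI) (simp add: lk swap_copy_involution)
  have keysK: "Poly_Mapping.keys (K x) = swap_copy q ` Poly_Mapping.keys x" for x
  proof (rule Set.set_eqI)
    fix k
    have "k \<in> Poly_Mapping.keys (K x) \<longleftrightarrow> swap_copy q k \<in> Poly_Mapping.keys x"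
      by (simp add: in_keys_iff lk)
    also have "\<dots> \<longleftrightarrow> k \<in> swap_copy q ` Poly_Mapping.keys x"
      using swap_copy_involution by (metis image_iff)
    finally show "k \<in> Poly_Mapping.keys (K x) \<longleftrightarrow> k \<in> swap_copy q ` Poly_Mapping.keys x" .
  qed
  have Kcl: "K x \<in> configs ?Q2" if "x \<in> configs ?Q2" for x
    using that by (simp add: configs_lookup lk swap_copy_qudits(1))
  have Kadj: "adj_on ?Q2 K K"
  proof (rule adj_onI)
    fix x y
    have "pairing (K x) y = (\<Sum>k\<in>Poly_Mapping.keys x. Poly_Mapping.lookup x k * Poly_Mapping.lookup y (swap_copy q k))"
      unfolding pairing_def keysK
      by (subst sum.reindex) (auto intro!: inj_onI simp: lk swap_copy_involution dest: arg_cong[where f = "swap_copy q"])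
    then show "pairing (K x) y = pairing x (K y)" by (simp add: pairing_def lk)
  qed (auto intro: Kcl)
  (* K moves the system into the copy. This makes all products with an inner K vanish. *)
  have KQ: "restr ?Q (K x) = 0" if "x \<in> configs ?Q" for x
    using that by (intro poly_mapping_eqI) (auto simp: lookup_restr lk configs_lookup swap_copy_qudits(2))
  define b where "b x = B (restr ?Q x)" for x
  define bt where "bt x = Bt (restr ?Q x)" for x
  have cl: "b x \<in> configs ?Q" "bt x \<in> configs ?Q" for x
    using adj_on_closed[OF B] adj_on_closed[OF adj_on_sym[OF B]] by (auto simp: b_def bt_def)
  have badj: "adj_on ?Q2 b bt"
  proof (rule adj_onI)
    fix x y
    have "pairing (b x) y = pairing (b x) (restr ?Q y)"
      using pairing_restr[of ?Q "b x" y] restr_id[OF cl(1)] by simp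
    also have "\<dots> = pairing (restr ?Q x) (bt y)"
      unfolding b_def bt_def by (rule adj_on_pairing[OF B]) auto
    also have "\<dots> = pairing x (bt y)"
      using pairing_restr[of ?Q x "bt y"] restr_id[OF cl(2)] by simp
    finally show "pairing (b x) y = pairing x (bt y)" .
  qed (use cl configs_mono[OF _ QQ] in auto)
  have zero: "b (K (b x)) = 0" "bt (K (b x)) = 0" "bt (K (bt x)) = 0" for x
    using KQ[OF cl(1)] KQ[OF cl(2)] adj_on_0[OF B] adj_on_0[OF adj_on_sym[OF B]]
    by (simp_all add: b_def bt_def)
  have Kloc: "local_map d ?Q2 K"
    unfolding local_map_def
  proof (intro exI ballI)
    fix x l assume x: "x \<in> configs ?Q2" and l: "l \<in> Poly_Mapping.keys (K x)"
    then obtain k where k: "k \<in> Poly_Mapping.keys x" "l = swap_copy q k" using keysK by blast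
    have "fst k \<in> M" using x k(1) configs_keys qudits_site by blast
    then have "d (fst k) (fst l) \<le> 0" using k(2) by (simp add: swap_copy_def)
    then show "\<exists>k\<in>Poly_Mapping.keys x. d (fst k) (fst l) \<le> 0" using k(1) by blast
  qed
  have bloc: "local_map d ?Q2 b"
  proof -
    obtain r where r: "\<forall>x\<in>configs ?Q. \<forall>l\<in>Poly_Mapping.keys (B x). \<exists>k\<in>Poly_Mapping.keys x. d (fst k) (fst l) \<le> r"
      using loc unfolding local_map_def by blast
    have "\<exists>k\<in>Poly_Mapping.keys x. d (fst k) (fst l) \<le> r" if "l \<in> Poly_Mapping.keys (b x)" for x l
      using r[rule_format, OF restr_configs that[unfolded b_def]] by (auto simp: keys_restr)
    then show ?thesis unfolding local_map_def by blast
  qed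
  define G where "G x = K (b x)" for x
  define Gt where "Gt x = bt (K x)" for x
  have G: "adj_on ?Q2 G Gt" unfolding G_def Gt_def by (rule adj_on_comp[OF Kadj badj])
  have Gloc: "local_map d ?Q2 G"
    unfolding G_def by (rule local_map_comp[OF Kloc bloc Kcl]) (auto intro: configs_mono[OF cl(1) QQ])
  define f where "f x = x + G x" for x
  define f' where "f' x = x + - G x" for x
  define g where "g x = x + Gt x" for x
  define g' where "g' x = x + - Gt x" for x
  have fadj: "adj_on ?Q2 f g" "adj_on ?Q2 f' g'"
    unfolding f_def g_def f'_def g'_def
    by (intro adj_on_plus adj_on_minus adj_on_id G)+
  have floc: "local_map d ?Q2 f" "local_map d ?Q2 f'"
    unfolding f_def f'_def by (intro local_map_plus local_map_minus local_map_id Gloc)+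
  have GG: "G (G x) = 0" "Gt (Gt x) = 0" for x
    using zero adj_on_0[OF Kadj] by (simp_all add: G_def Gt_def)
  have Gcl: "G x \<in> configs ?Q2" "Gt x \<in> configs ?Q2" if "x \<in> configs ?Q2" for x
    using that adj_on_closed[OF G] adj_on_closed[OF adj_on_sym[OF G]] by auto
  have inv: "f (f' x) = x" "f' (f x) = x" "g (g' x) = x" if "x \<in> configs ?Q2" for x
    using that adj_on_add[OF G that Gcl(1)[OF that]] adj_on_diff[OF G that Gcl(1)[OF that]]
      adj_on_diff[OF adj_on_sym[OF G] that Gcl(2)[OF that]] GG
    by (auto simp: f_def f'_def g_def g'_def)
  have T1: "trivial_map M d ?q2 (\<lambda>u. (f (fst u), g' (snd u)))"
    by (rule separated_trivial_map[OF sep fadj inv(1,2) floc])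
  have T2: "trivial_map M d ?q2 (\<lambda>u. (f' (fst u), g (snd u)))"
    by (rule separated_trivial_map[OF sep fadj(2,1) inv(2,1) floc(2,1)])
  have on: "K x \<in> configs (qudits {i} ?q2)" if "x \<in> configs (qudits {i} ?q2)" for i x
    using that by (simp add: configs_lookup lk swap_copy_qudits(1))
  have S1: "trivial_map M d ?q2 (shear ?Q2 K)"
    by (rule trivial_onsite_shear[OF Kadj on])
  have S2: "trivial_map M d ?q2 (shear ?Q2 (\<lambda>x. - K x))"
    by (rule trivial_onsite_shear[OF adj_on_minus[OF Kadj]]) (use on in blast)
  define V1 where "V1 u = shear ?Q2 K (f (fst u), g' (snd u))" for u
  define V2 where "V2 u = (f' (fst (V1 u)), g (snd (V1 u)))" for u
  define U where "U u = shear ?Q2 (\<lambda>x. - K x) (V2 u)" for u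
  note fcl = adj_on_closed[OF fadj(1)] adj_on_closed[OF fadj(2)]
    adj_on_closed[OF adj_on_sym[OF fadj(1)]] adj_on_closed[OF adj_on_sym[OF fadj(2)]]
  have M1: "(f (fst u), g' (snd u)) \<in> pauli_space ?Q2" if "u \<in> pauli_space ?Q2" for u
    using that fcl by (simp add: pauli_space_iff)
  have V1cl: "V1 u \<in> pauli_space ?Q2" if "u \<in> pauli_space ?Q2" for u
    unfolding V1_def by (rule symplectic_aut_closed[OF shear_symplectic[OF Kadj] M1[OF that]])
  have V2cl: "V2 u \<in> pauli_space ?Q2" if "u \<in> pauli_space ?Q2" for u
    using V1cl[OF that] fcl by (simp add: pauli_space_iff V2_def)
  have "trivial_map M d ?q2 V1"
    by (rule trivial_map_compose[OF S1 T1]) (simp_all only: M1 V1_def)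
  then have "trivial_map M d ?q2 V2"
    by (rule trivial_map_compose[OF T2]) (simp_all only: V1cl V2_def)
  then have Utriv: "trivial_map M d ?q2 U"
    by (rule trivial_map_compose[OF S2]) (simp_all only: V2cl U_def)
  (* The steps are (x, z), then (x + G x, z - Gt z), then the shear by K adds K x + b x to the second
     component, then the inverse of the first map, and last the shear by - K removes K x. *)
  have U: "U u = (fst u, snd u + (b (fst u) + bt (fst u)))" if u: "u \<in> pauli_space ?Q2" for u
  proof -
    have x: "fst u \<in> configs ?Q2" and z: "snd u \<in> configs ?Q2" using u by (auto simp: pauli_space_iff)
    have bQ2: "b y \<in> configs ?Q2" "bt y \<in> configs ?Q2" for y using configs_mono[OF cl(1) QQ] configs_mono[OF cl(2) QQ] by auto
    have "K (f (fst u)) = K (fst u) + b (fst u)"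
      using adj_on_add[OF Kadj x Gcl(1)[OF x]] by (simp add: f_def G_def KK)
    then have V1: "V1 u = (f (fst u), g' (snd u) + (K (fst u) + b (fst u)))"
      using M1[OF u] by (simp add: V1_def shear_def)
    note gadd = adj_on_add[OF adj_on_sym[OF fadj(1)]]
    have "g (g' (snd u) + (K (fst u) + b (fst u))) = snd u + (g (K (fst u)) + g (b (fst u)))"
      using gadd[OF fcl(4)[OF z] configs_add[OF Kcl[OF x] bQ2(1)]] gadd[OF Kcl[OF x] bQ2(1)] inv(3)[OF z]
      by simp
    also have "g (K (fst u)) = K (fst u) + bt (fst u)" by (simp add: g_def Gt_def KK)
    also have "g (b (fst u)) = b (fst u)" by (simp add: g_def Gt_def zero)
    finally have "V2 u = (fst u, snd u + (K (fst u) + bt (fst u) + b (fst u)))"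
      by (simp add: V2_def V1 inv(2)[OF x])
    then show ?thesis using V2cl[OF u] by (simp add: U_def shear_def algebra_simps)
  qed
  have "stabilization M q q (shear ?Q (\<lambda>x. B x + Bt x)) U"
    unfolding stabilization_def
  proof (intro ballI)
    fix u w :: "('a, 'd) pvec" assume u: "u \<in> pauli_space ?Q" and w: "w \<in> pauli_space (?Q2 - ?Q)"
    have "u + w \<in> pauli_space ?Q2"
      using pauli_space_mono[OF u QQ] pauli_space_mono[OF w Diff_subset] by (rule pauli_space_add)
    moreover have "restr ?Q (fst w) = 0"
      using w by (intro restr_disjoint[of _ "?Q2 - ?Q"]) (auto simp: pauli_space_iff)
    ultimately show "U (u + w) = shear ?Q (\<lambda>x. B x + Bt x) u + w"
      using u by (simp add: U shear_def b_def bt_def restr_add restr_id pauli_space_iff prod_eq_iff ac_simps)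
  qed
  then show ?thesis by (rule trivial_map_destabilize[OF Utriv])
qed

lemma trivial_local_shear:
  fixes A :: "('a, 'd::nontriv) config \<Rightarrow> ('a, 'd) config"
  assumes sep: "\<forall>q (\<alpha> :: ('a, 'd) oper \<Rightarrow> ('a, 'd) oper).
      clifford_qca M d q \<alpha> \<and> separated M q \<alpha> \<longrightarrow> trivial_qca M d q \<alpha>"
    and A: "adj_on (qudits M q) A A" and loc: "local_map d (qudits M q) A"
  shows "trivial_map M d q (shear (qudits M q) A)"
proof -
  let ?Q = "qudits M q"
  let ?B = "part chosen_first A" and ?Bt = "part (\<lambda>k l. chosen_first l k) A" and ?D = "part (=) A"
  have B: "adj_on ?Q ?B ?Bt" by (rule part_adjoint[OF A])
  have "adj_on ?Q ?D (part (\<lambda>k l. l = k) A)" by (rule part_adjoint[OF A])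
  moreover have "(\<lambda>k l :: 'a qudit. l = k) = (=)" by auto
  ultimately have D: "adj_on ?Q ?D ?D" by simp
  have 1: "trivial_map M d q (shear ?Q (\<lambda>x. ?B x + ?Bt x))"
    by (rule trivial_symmetrized_shear[OF sep B part_local[OF loc]])
  have 2: "trivial_map M d q (shear ?Q ?D)"
    by (rule trivial_onsite_shear[OF D part_diagonal])
  have cl: "shear ?Q (\<lambda>x. ?B x + ?Bt x) u \<in> pauli_space ?Q" if "u \<in> pauli_space ?Q" for u
    using that adj_on_closed[OF B] adj_on_closed[OF adj_on_sym[OF B]]
    by (auto simp: shear_def pauli_space_iff intro!: configs_add)
  show ?thesis
  proof (rule trivial_map_compose[OF 2 1 cl])
    fix u :: "('a, 'd) pvec" assume u: "u \<in> pauli_space ?Q"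
    then show "shear ?Q A u = shear ?Q ?D (shear ?Q (\<lambda>x. ?B x + ?Bt x) u)"
      using cl[OF u] part_split[OF A, of "fst u"] by (simp add: shear_def pauli_space_iff ac_simps)
  qed
qed


end


section \<open>Automorphisms that preserve the Z part or the X part\<close>

context Metric_space
begin

text \<open>
  The factorization of the triangular \<open>S\<close> into a shear and a separated map. The inverse of \<open>S\<close> is
  triangular as well: if \<open>S u = (0, z)\<close>, then \<open>u\<close> is orthogonal to all \<open>(0, y)\<close> because \<open>(0, z)\<close> is
  orthogonal to their images. Thus both diagonal blocks of \<open>S\<close> are invertible, and preservation of
  the form makes them inverse adjoints of each other and makes the matrix of the shear symmetric.
\<close>
lemma Z_preserving_trivial:
  fixes S :: "('a, 'd::nontriv) pvec \<Rightarrow> ('a, 'd) pvec"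
  assumes sep: "\<forall>q (\<alpha> :: ('a, 'd) oper \<Rightarrow> ('a, 'd) oper).
      clifford_qca M d q \<alpha> \<and> separated M q \<alpha> \<longrightarrow> trivial_qca M d q \<alpha>"
    and S: "local_symplectic M d q S"
    and Z: "\<And>z. z \<in> configs (qudits M q) \<Longrightarrow> fst (S (0, z)) = 0"
  shows "trivial_map M d q S"
proof -
  let ?Q = "qudits M q"
  let ?P = "pauli_space ?Q :: ('a, 'd) pvec set"
  define I where "I = restrict (inv_into ?P S) ?P"
  have I: "local_symplectic M d q I" unfolding I_def by (rule local_symplectic_inverse[OF S])
  have sym: "symplectic_aut ?Q S" "symplectic_aut ?Q I"
    using S I by (simp_all add: local_symplectic_def)
  have SI: "S (I u) = u" "I (S u) = u" if "u \<in> ?P" for u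
    using symplectic_aut_inv_into[OF sym(1) that] symplectic_aut_closed[OF sym(1) that] that
    by (simp_all add: I_def)
  have Scl: "S u \<in> ?P" "I u \<in> ?P" if "u \<in> ?P" for u
    using that symplectic_aut_closed sym by blast+
  have adj: "symp_form (S u) v = symp_form u (I v)" "symp_form (I u) v = symp_form u (S v)"
    if "u \<in> ?P" "v \<in> ?P" for u v
    using symplectic_aut_form[OF sym(1) that(1) Scl(2)[OF that(2)]]
      symplectic_aut_form[OF sym(2) that(1) Scl(1)[OF that(2)]] SI that by simp_all
  have IZ: "fst (I (0, z)) = 0" if z: "z \<in> configs ?Q" for z
  proof (rule pairing_nondegenerate[of _ ?Q])
    have zP: "(0, z) \<in> ?P" using z by simp
    show "fst (I (0, z)) \<in> configs ?Q" using Scl(2)[OF zP] by (simp add: pauli_space_iff)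
    fix y :: "('a, 'd) config" assume y: "y \<in> configs ?Q"
    then have yP: "(0, y) \<in> ?P" by simp
    show "pairing (fst (I (0, z))) y = pairing 0 y"
      using adj(2)[OF zP yP] Z[OF y] by (simp add: symp_form_def)
  qed simp
  (* S is [[f, 0], [C, g']] and I, its inverse, has the diagonal blocks f' and g. *)
  define f where "f x = fst (S (x, 0))" for x
  define C where "C x = snd (S (x, 0))" for x
  define g' where "g' z = snd (S (0, z))" for z
  define f' where "f' x = fst (I (x, 0))" for x
  define g where "g z = snd (I (0, z))" for z
  have SX: "S (x, 0) = (f x, C x)" for x by (simp add: f_def C_def)
  have SZ: "S (0, z) = (0, g' z)" if "z \<in> configs ?Q" for z using Z[OF that] by (simp add: g'_def prod_eq_iff)
  have IZ': "I (0, z) = (0, g z)" if "z \<in> configs ?Q" for z using IZ[OF that] by (simp add: g_def prod_eq_iff)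
  have cl: "f x \<in> configs ?Q" "C x \<in> configs ?Q" "g' x \<in> configs ?Q" "f' x \<in> configs ?Q" "g x \<in> configs ?Q"
    if "x \<in> configs ?Q" for x :: "('a, 'd) config"
    using Scl[of "(x, 0)"] Scl[of "(0, x)"] that
    by (auto simp: pauli_space_iff f_def C_def g'_def f'_def g_def)
  have split: "T (x, z) = T (x, 0) + T (0, z)" if "x \<in> configs ?Q" "z \<in> configs ?Q" "symplectic_aut ?Q T"
    for x z and T :: "('a, 'd) pvec \<Rightarrow> ('a, 'd) pvec"
    using symplectic_aut_add[OF that(3), of "(x, 0)" "(0, z)"] that by simp
  have fadj: "adj_on ?Q f g"
  proof (rule adj_onI)
    fix x y :: "('a, 'd) config" assume "x \<in> configs ?Q" "y \<in> configs ?Q"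
    then show "pairing (f x) y = pairing x (g y)"
      using adj(1)[of "(x, 0)" "(0, y)"] by (simp add: symp_form_def f_def g_def)
  qed (simp_all add: cl)
  have f'adj: "adj_on ?Q f' g'"
  proof (rule adj_onI)
    fix x y :: "('a, 'd) config" assume "x \<in> configs ?Q" "y \<in> configs ?Q"
    then show "pairing (f' x) y = pairing x (g' y)"
      using adj(2)[of "(x, 0)" "(0, y)"] by (simp add: symp_form_def f'_def g'_def)
  qed (simp_all add: cl)
  have ff': "f (f' x) = x" if x: "x \<in> configs ?Q" for x
  proof -
    have xP: "(x, 0) \<in> ?P" using x by simp
    then have c: "snd (I (x, 0)) \<in> configs ?Q" using Scl(2) by (simp add: pauli_space_iff)
    have "(x, 0) = S (f' x, snd (I (x, 0)))" using SI(1)[OF xP] by (simp add: f'_def)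
    also have "\<dots> = S (f' x, 0) + S (0, snd (I (x, 0)))" by (rule split[OF cl(4)[OF x] c sym(1)])
    finally show ?thesis using SZ[OF c] by (simp add: f_def prod_eq_iff)
  qed
  have f'f: "f' (f x) = x" if x: "x \<in> configs ?Q" for x
  proof -
    have xP: "(x, 0) \<in> ?P" using x by simp
    have "(x, 0) = I (f x, C x)" using SI(2)[OF xP] SX by simp
    also have "\<dots> = I (f x, 0) + I (0, C x)" by (rule split[OF cl(1)[OF x] cl(2)[OF x] sym(2)])
    finally show ?thesis using IZ'[OF cl(2)[OF x]] by (simp add: f'_def prod_eq_iff)
  qed
  have g'g: "g' (g z) = z" if z: "z \<in> configs ?Q" for z
    using SI(1)[of "(0, z)"] z IZ'[OF z] by (simp add: g'_def)
  have locS: "local_map d ?Q (\<lambda>x. fst (T (x, 0)))" "local_map d ?Q (\<lambda>x. snd (T (x, 0)))"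
    "local_map d ?Q (\<lambda>x. snd (T (0, x)))" if T: "local_symplectic M d q T" for T :: "('a, 'd) pvec \<Rightarrow> ('a, 'd) pvec"
  proof -
    obtain r where r: "\<forall>u\<in>?P. \<forall>l\<in>Poly_Mapping.keys (fst (T u)) \<union> Poly_Mapping.keys (snd (T u)).
        \<exists>k\<in>Poly_Mapping.keys (fst u) \<union> Poly_Mapping.keys (snd u). d (fst k) (fst l) \<le> r"
      using T unfolding local_symplectic_def by (elim conjE exE)
    have X: "\<exists>k\<in>Poly_Mapping.keys x. d (fst k) (fst l) \<le> r"
      if "x \<in> configs ?Q" "l \<in> Poly_Mapping.keys (fst (T (x, 0))) \<union> Poly_Mapping.keys (snd (T (x, 0)))" for x l
      using r[rule_format, OF _ that(2)] that(1) by simp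
    have Z: "\<exists>k\<in>Poly_Mapping.keys x. d (fst k) (fst l) \<le> r"
      if "x \<in> configs ?Q" "l \<in> Poly_Mapping.keys (fst (T (0, x))) \<union> Poly_Mapping.keys (snd (T (0, x)))" for x l
      using r[rule_format, OF _ that(2)] that(1) by simp
    show "local_map d ?Q (\<lambda>x. fst (T (x, 0)))" "local_map d ?Q (\<lambda>x. snd (T (x, 0)))"
      "local_map d ?Q (\<lambda>x. snd (T (0, x)))"
      unfolding local_map_def by (rule exI[of _ r]; use X Z in blast)+
  qed
  have loc: "local_map d ?Q f" "local_map d ?Q C" "local_map d ?Q f'" "local_map d ?Q g"
    using locS[OF S] locS[OF I] by (simp_all add: f_def[abs_def] C_def[abs_def] f'_def[abs_def] g_def[abs_def])
  define A where "A x = g (C x)" for x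
  have Acl: "A x \<in> configs ?Q" if "x \<in> configs ?Q" for x using that cl by (simp add: A_def)
  have "adj_on ?Q A A"
  proof (rule adj_onI)
    fix x y :: "('a, 'd) config" assume x: "x \<in> configs ?Q" and y: "y \<in> configs ?Q"
    have "symp_form (S (x, 0)) (S (y, 0)) = 0"
      using symplectic_aut_form[OF sym(1), of "(x, 0)" "(y, 0)"] x y by (simp add: symp_form_def)
    then have "pairing (C x) (f y) = pairing (f x) (C y)" by (simp add: SX symp_form_def)
    then show "pairing (A x) y = pairing x (A y)"
      using adj_on_pairing[OF adj_on_sym[OF fadj] cl(2)[OF x] y] adj_on_pairing[OF fadj x cl(2)[OF y]]
      by (simp add: A_def)
  qed (simp_all add: Acl)
  moreover have "local_map d ?Q A"
    unfolding A_def by (rule local_map_comp[OF loc(4,2)]) (simp_all add: cl)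
  ultimately have sh: "trivial_map M d q (shear ?Q A)" by (rule trivial_local_shear[OF sep])
  have N: "trivial_map M d q (\<lambda>u. (f (fst u), g' (snd u)))"
    by (rule separated_trivial_map[OF sep fadj f'adj ff' f'f loc(1,3)])
  show ?thesis
  proof (rule trivial_map_compose[OF N sh])
    fix u :: "('a, 'd) pvec" assume u: "u \<in> ?P"
    then show "shear ?Q A u \<in> ?P"
      using Acl by (auto simp: shear_def pauli_space_iff)
    have x: "fst u \<in> configs ?Q" and z: "snd u \<in> configs ?Q" using u by (auto simp: pauli_space_iff)
    have "g' (snd u + A (fst u)) = g' (snd u) + C (fst u)"
      using adj_on_add[OF adj_on_sym[OF f'adj] z Acl[OF x]] g'g[OF cl(2)[OF x]] by (simp add: A_def)
    moreover have "S u = (f (fst u), C (fst u) + g' (snd u))"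
      using split[OF x z sym(1)] SX SZ[OF z] by simp
    ultimately show "S u = (f (fst (shear ?Q A u)), g' (snd (shear ?Q A u)))"
      using u by (simp add: shear_def add.commute)
  qed
qed

lemma onsite_local_symplectic:
  assumes "symplectic_aut (qudits M q) S"
    and "\<And>u. u \<in> pauli_space (qudits M q) \<Longrightarrow>
      Poly_Mapping.keys (fst (S u)) \<union> Poly_Mapping.keys (snd (S u)) \<subseteq>
      Poly_Mapping.keys (fst u) \<union> Poly_Mapping.keys (snd u)"
  shows "local_symplectic M d q S" "S \<in> single_layer_circuits M d q"
proof -
  let ?keys = "\<lambda>u :: ('a, 'b) pvec. Poly_Mapping.keys (fst u) \<union> Poly_Mapping.keys (snd u)"
  have "\<exists>k\<in>?keys u. d (fst k) (fst l) \<le> 0" if u: "u \<in> pauli_space (qudits M q)" and l: "l \<in> ?keys (S u)" for u l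
  proof -
    have "l \<in> ?keys u" using assms(2)[OF u] l by blast
    moreover from this have "fst l \<in> M"
      using u configs_keys qudits_site unfolding pauli_space_iff by blast
    ultimately show ?thesis by (intro bexI[of _ l]) auto
  qed
  then show "local_symplectic M d q S"
    using assms(1) unfolding local_symplectic_def by blast
  show "S \<in> single_layer_circuits M d q"
  proof (rule onsite_gate[OF assms(1)], rule image_subsetI)
    fix i and u :: "('a, 'b) pvec" assume i: "i \<in> M" and u: "u \<in> pauli_space (qudits {i} q)"
    have "qudits {i} q \<subseteq> qudits M q" using i by (auto simp: qudits_def)
    then show "S u \<in> pauli_space (qudits {i} q)"
      using assms(2)[OF pauli_space_mono[OF u]] u by (auto simp: pauli_space_iff configs_def)
  qed
qed

text \<open>
  Conjugation by the Fourier transform exchanges the two components, up to a sign.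
\<close>
lemma X_preserving_trivial:
  fixes S :: "('a, 'd::nontriv) pvec \<Rightarrow> ('a, 'd) pvec"
  assumes sep: "\<forall>q (\<alpha> :: ('a, 'd) oper \<Rightarrow> ('a, 'd) oper).
      clifford_qca M d q \<alpha> \<and> separated M q \<alpha> \<longrightarrow> trivial_qca M d q \<alpha>"
    and S: "local_symplectic M d q S"
    and X: "\<And>x. x \<in> configs (qudits M q) \<Longrightarrow> snd (S (x, 0)) = 0"
  shows "trivial_map M d q S"
proof -
  let ?Q = "qudits M q"
  let ?P = "pauli_space ?Q :: ('a, 'd) pvec set"
  let ?J = "fourier ?Q :: ('a, 'd) pvec \<Rightarrow> ('a, 'd) pvec"
  let ?J' = "inv_fourier ?Q :: ('a, 'd) pvec \<Rightarrow> ('a, 'd) pvec"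
  have J: "local_symplectic M d q ?J" "?J \<in> single_layer_circuits M d q"
    by (rule onsite_local_symplectic[OF fourier_symplectic]; auto simp: fourier_def)+
  have J': "local_symplectic M d q ?J'" "?J' \<in> single_layer_circuits M d q"
    by (rule onsite_local_symplectic[OF inv_fourier_symplectic]; auto simp: inv_fourier_def)+
  have cl: "S u \<in> ?P" "?J u \<in> ?P" "?J' u \<in> ?P" if "u \<in> ?P" for u
    using that S J J' symplectic_aut_closed unfolding local_symplectic_def by blast+
  have JJ: "?J (?J' u) = u" if "u \<in> ?P" for u
    using that cl(3)[OF that] by (simp add: fourier_def inv_fourier_def)
  define T where "T = compose ?P ?J' (compose ?P S ?J)"
  have T: "T u = ?J' (S (?J u))" if "u \<in> ?P" for u using that by (simp add: T_def compose_def)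
  have "trivial_map M d q T"
  proof (rule Z_preserving_trivial[OF sep])
    show "local_symplectic M d q T" unfolding T_def by (intro local_symplectic_compose S J J')
    fix z :: "('a, 'd) config" assume z: "z \<in> configs ?Q"
    then have u: "(0, z) \<in> ?P" and mz: "- z \<in> configs ?Q" by auto
    have "?J (0, z) = (- z, 0)" using u by (simp add: fourier_def)
    then show "fst (T (0, z)) = 0"
      using T[OF u] X[OF mz] cl(1)[OF cl(2)[OF u]] by (simp add: inv_fourier_def)
  qed
  then have "trivial_map M d q (\<lambda>u. ?J (T u))"
    by (rule trivial_map_compose[OF trivial_map_gate[OF J(2)]]) (simp_all add: T cl)
  then show ?thesis
  proof (rule trivial_map_compose[OF _ trivial_map_gate[OF J'(2)]])
    fix u assume u: "u \<in> ?P"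
    then show "?J' u \<in> ?P" by (rule cl)
    show "S u = ?J (T (?J' u))" using u by (simp add: T cl JJ)
  qed
qed

end


section \<open>QCAs with the same stabilizer or flipper group\<close>

text \<open>
  The inverse of the identity in the definition of equivalence is the identity on local operators
  only, but these contain all images of Pauli operators.
\<close>
lemma equivalent_to_identity:
  fixes \<alpha> :: "('a, 'd::nontriv) oper \<Rightarrow> ('a, 'd) oper"
  assumes \<alpha>: "clifford_qca \<Lambda> D q \<alpha>" and eq: "equivalent_qca \<Lambda> D q \<alpha> (\<lambda>A. A)"
  shows "trivial_qca \<Lambda> D q \<alpha>"
proof -
  have "mod_phases \<Lambda> q (inv_into (local_ops \<Lambda> q) (\<lambda>A. A) \<circ> \<alpha>) u = mod_phases \<Lambda> q \<alpha> u"
    if u: "u \<in> pauli_space (qudits \<Lambda> q)" for u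
  proof (rule implements_mod_phases[OF _ u])
    have "inv_into (local_ops \<Lambda> q) (\<lambda>A. A) A = A" if "A \<in> local_ops \<Lambda> q" for A :: "('a, 'd) oper"
      using inv_into_f_f[of "\<lambda>A. A" "local_ops \<Lambda> q" A] that by (simp add: inj_on_def)
    moreover have "\<alpha> (pauli (qudits \<Lambda> q) u) \<in> local_ops \<Lambda> q" if "u \<in> pauli_space (qudits \<Lambda> q)" for u
      using \<alpha> pauli_local1[OF that] unfolding clifford_qca_def algebra_aut_def by (blast dest: bij_betwE)
    ultimately show "implements \<Lambda> q (inv_into (local_ops \<Lambda> q) (\<lambda>A. A) \<circ> \<alpha>) (mod_phases \<Lambda> q \<alpha>)"
      using clifford_implements[OF \<alpha>] unfolding implements_def by simp
  qed
  then show ?thesis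
    using eq trivial_map_cong[of \<Lambda> D q _ "mod_phases \<Lambda> q \<alpha>"]
    unfolding equivalent_qca_def trivial_qca_iff by metis
qed

text \<open>
  By injectivity of the labelling of Pauli operators, equality of the two image groups passes to
  exponent vectors.
\<close>
lemma same_image_of_pauli_group:
  fixes emb :: "('a, 'd::nontriv) config \<Rightarrow> ('a, 'd) pvec"
  assumes \<alpha>: "clifford_qca \<Lambda> D q \<alpha>" and \<beta>: "clifford_qca \<Lambda> D q \<beta>"
    and emb: "\<And>x. x \<in> configs (qudits \<Lambda> q) \<Longrightarrow> emb x \<in> pauli_space (qudits \<Lambda> q)"
    and eq: "\<alpha> ` {op_scale a (pauli (qudits \<Lambda> q) (emb x)) | a x. cmod a = 1 \<and> x \<in> configs (qudits \<Lambda> q)}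
      = \<beta> ` {op_scale a (pauli (qudits \<Lambda> q) (emb x)) | a x. cmod a = 1 \<and> x \<in> configs (qudits \<Lambda> q)}"
    and x: "x \<in> configs (qudits \<Lambda> q)"
  shows "\<exists>y\<in>configs (qudits \<Lambda> q). mod_phases \<Lambda> q (inv_into (local_ops \<Lambda> q) \<beta> \<circ> \<alpha>) (emb x) = emb y"
proof -
  let ?Q = "qudits \<Lambda> q"
  have "op_scale 1 (pauli ?Q (emb x)) \<in> {op_scale a (pauli ?Q (emb x)) | a x. cmod a = 1 \<and> x \<in> configs ?Q}"
    using x norm_one by blast
  then have "\<alpha> (op_scale 1 (pauli ?Q (emb x))) \<in> \<beta> ` {op_scale a (pauli ?Q (emb x)) | a x. cmod a = 1 \<and> x \<in> configs ?Q}"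
    unfolding eq[symmetric] by (rule imageI)
  then obtain b y where b: "cmod b = 1" "y \<in> configs ?Q"
    "\<alpha> (pauli ?Q (emb x)) = \<beta> (op_scale b (pauli ?Q (emb y)))" by auto
  obtain a where a: "cmod a = 1" "\<alpha> (pauli ?Q (emb x)) = op_scale a (pauli ?Q (mod_phases \<Lambda> q \<alpha> (emb x)))"
    and ax: "mod_phases \<Lambda> q \<alpha> (emb x) \<in> pauli_space ?Q"
    using clifford_implements[OF \<alpha>] emb[OF x] unfolding implements_def by blast
  obtain c where c: "cmod c = 1" "\<beta> (pauli ?Q (emb y)) = op_scale c (pauli ?Q (mod_phases \<Lambda> q \<beta> (emb y)))"
    and by': "mod_phases \<Lambda> q \<beta> (emb y) \<in> pauli_space ?Q"
    using clifford_implements[OF \<beta>] emb[OF b(2)] unfolding implements_def by blast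
  have "algebra_aut \<Lambda> q \<beta>" using \<beta> by (simp add: clifford_qca_def)
  then have "op_scale a (pauli ?Q (mod_phases \<Lambda> q \<alpha> (emb x))) = op_scale (b * c) (pauli ?Q (mod_phases \<Lambda> q \<beta> (emb y)))"
    using a(2) b(3) c(2) algebra_aut_scale[OF _ pauli_local1[OF emb[OF b(2)]]] by simp
  moreover have "a \<noteq> 0" using a(1) by auto
  ultimately have "mod_phases \<Lambda> q \<alpha> (emb x) = mod_phases \<Lambda> q \<beta> (emb y)"
    using pauli_phase_inject[OF _ _ ax by'] by blast
  then have "mod_phases \<Lambda> q (inv_into (local_ops \<Lambda> q) \<beta> \<circ> \<alpha>) (emb x) = emb y"
    using mod_phases_inverse_comp[OF \<alpha> \<beta> emb[OF x]]
      symplectic_aut_inv_into(3)[OF clifford_mod_phases_symplectic[OF \<beta>] emb[OF b(2)]] by simp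
  then show ?thesis using b(2) by blast
qed

context Metric_space
begin

lemma identity_clifford: "clifford_qca M d q (\<lambda>A :: ('a, 'd::nontriv) oper. A)"
proof -
  have "locality_preserving M d q (\<lambda>A :: ('a, 'd) oper. A)"
    unfolding locality_preserving_def
  proof (intro exI[of _ 0] ballI allI impI)
    fix A :: "('a, 'd) oper" and F assume "F \<subseteq> M" and sup: "supported_on (qudits M q) F A"
    have "F \<subseteq> neighbourhood M d 0 F"
    proof
      fix i assume i: "i \<in> F"
      then have "d i i \<le> 0" using \<open>F \<subseteq> M\<close> by auto
      then show "i \<in> neighbourhood M d 0 F" using i \<open>F \<subseteq> M\<close> unfolding neighbourhood_def by blast
    qed
    then show "supported_on (qudits M q) (neighbourhood M d 0 F) A" by (rule supported_on_mono[OF sup])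
  qed
  then show ?thesis by (auto simp: clifford_qca_def algebra_aut_def bij_betw_def)
qed

lemma inverse_comp_local_symplectic:
  fixes \<alpha> \<beta> :: "('a, 'd::nontriv) oper \<Rightarrow> ('a, 'd) oper"
  assumes \<alpha>: "clifford_qca M d q \<alpha>" and \<beta>: "clifford_qca M d q \<beta>"
  shows "local_symplectic M d q (mod_phases M q (inv_into (local_ops M q) \<beta> \<circ> \<alpha>))"
proof -
  let ?P = "pauli_space (qudits M q) :: ('a, 'd) pvec set"
  let ?T = "compose ?P (restrict (inv_into ?P (mod_phases M q \<beta>)) ?P) (mod_phases M q \<alpha>)"
  have "local_symplectic M d q ?T"
    by (intro local_symplectic_compose local_symplectic_inverse clifford_local_symplectic \<alpha> \<beta>)
  moreover have "mod_phases M q (inv_into (local_ops M q) \<beta> \<circ> \<alpha>) = ?T"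
  proof (rule extensionalityI[of _ ?P])
    fix u assume u: "u \<in> ?P"
    have "mod_phases M q \<alpha> u \<in> ?P"
      by (rule symplectic_aut_closed[OF clifford_mod_phases_symplectic[OF \<alpha>] u])
    then show "mod_phases M q (inv_into (local_ops M q) \<beta> \<circ> \<alpha>) u = ?T u"
      using mod_phases_inverse_comp[OF \<alpha> \<beta> u] u by (simp add: compose_def)
  qed (simp_all add: mod_phases_def)
  ultimately show ?thesis by simp
qed

lemma same_stabilizer_equivalent:
  fixes \<alpha> \<beta> :: "('a, 'd::nontriv) oper \<Rightarrow> ('a, 'd) oper"
  assumes sep: "\<forall>q (\<alpha> :: ('a, 'd) oper \<Rightarrow> ('a, 'd) oper).
      clifford_qca M d q \<alpha> \<and> separated M q \<alpha> \<longrightarrow> trivial_qca M d q \<alpha>"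
    and \<alpha>: "clifford_qca M d q \<alpha>" and \<beta>: "clifford_qca M d q \<beta>"
    and eq: "stabilizer_group M q \<alpha> = stabilizer_group M q \<beta>"
  shows "equivalent_qca M d q \<alpha> \<beta>"
  unfolding equivalent_qca_def trivial_qca_iff
proof (rule Z_preserving_trivial[OF sep inverse_comp_local_symplectic[OF \<alpha> \<beta>]])
  fix z :: "('a, 'd) config" assume z: "z \<in> configs (qudits M q)"
  have "\<exists>y\<in>configs (qudits M q). mod_phases M q (inv_into (local_ops M q) \<beta> \<circ> \<alpha>) (0, z) = (0, y)"
    using eq z unfolding stabilizer_group_def Z_group_eq
    by (intro same_image_of_pauli_group[OF \<alpha> \<beta>, of "\<lambda>z. (0, z)"]) simp_all
  then show "fst (mod_phases M q (inv_into (local_ops M q) \<beta> \<circ> \<alpha>) (0, z)) = 0" by auto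
qed

lemma same_flipper_equivalent:
  fixes \<alpha> \<beta> :: "('a, 'd::nontriv) oper \<Rightarrow> ('a, 'd) oper"
  assumes sep: "\<forall>q (\<alpha> :: ('a, 'd) oper \<Rightarrow> ('a, 'd) oper).
      clifford_qca M d q \<alpha> \<and> separated M q \<alpha> \<longrightarrow> trivial_qca M d q \<alpha>"
    and \<alpha>: "clifford_qca M d q \<alpha>" and \<beta>: "clifford_qca M d q \<beta>"
    and eq: "flipper_group M q \<alpha> = flipper_group M q \<beta>"
  shows "equivalent_qca M d q \<alpha> \<beta>"
  unfolding equivalent_qca_def trivial_qca_iff
proof (rule X_preserving_trivial[OF sep inverse_comp_local_symplectic[OF \<alpha> \<beta>]])
  fix x :: "('a, 'd) config" assume x: "x \<in> configs (qudits M q)"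
  have "\<exists>y\<in>configs (qudits M q). mod_phases M q (inv_into (local_ops M q) \<beta> \<circ> \<alpha>) (x, 0) = (y, 0)"
    using eq x unfolding flipper_group_def X_group_eq
    by (intro same_image_of_pauli_group[OF \<alpha> \<beta>, of "\<lambda>x. (x, 0)"]) simp_all
  then show "snd (mod_phases M q (inv_into (local_ops M q) \<beta> \<circ> \<alpha>) (x, 0)) = 0" by auto
qed

end

theorem theorem2:
  fixes \<Lambda> :: "'l set" and D :: "'l \<Rightarrow> 'l \<Rightarrow> real"
  assumes "Metric_space \<Lambda> D"
  shows
    "((\<forall>q (\<alpha> :: ('l, 'd::nontriv) oper \<Rightarrow> ('l, 'd) oper) \<beta>.
         clifford_qca \<Lambda> D q \<alpha> \<and> clifford_qca \<Lambda> D q \<beta> \<and>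
         stabilizer_group \<Lambda> q \<alpha> = stabilizer_group \<Lambda> q \<beta> \<longrightarrow> equivalent_qca \<Lambda> D q \<alpha> \<beta>)
      \<longleftrightarrow>
      (\<forall>q (\<alpha> :: ('l, 'd) oper \<Rightarrow> ('l, 'd) oper).
         clifford_qca \<Lambda> D q \<alpha> \<and> separated \<Lambda> q \<alpha> \<longrightarrow> trivial_qca \<Lambda> D q \<alpha>))
     \<and>
     ((\<forall>q (\<alpha> :: ('l, 'd) oper \<Rightarrow> ('l, 'd) oper) \<beta>.
         clifford_qca \<Lambda> D q \<alpha> \<and> clifford_qca \<Lambda> D q \<beta> \<and>
         flipper_group \<Lambda> q \<alpha> = flipper_group \<Lambda> q \<beta> \<longrightarrow> equivalent_qca \<Lambda> D q \<alpha> \<beta>)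
      \<longleftrightarrow>
      (\<forall>q (\<alpha> :: ('l, 'd) oper \<Rightarrow> ('l, 'd) oper).
         clifford_qca \<Lambda> D q \<alpha> \<and> separated \<Lambda> q \<alpha> \<longrightarrow> trivial_qca \<Lambda> D q \<alpha>))"
proof -
  interpret Metric_space \<Lambda> D by (rule assms)
  note id = identity_clifford
  show ?thesis
  proof (intro conjI iffI)
    assume equiv: "\<forall>q (\<alpha> :: ('l, 'd) oper \<Rightarrow> ('l, 'd) oper) \<beta>.
         clifford_qca \<Lambda> D q \<alpha> \<and> clifford_qca \<Lambda> D q \<beta> \<and>
         stabilizer_group \<Lambda> q \<alpha> = stabilizer_group \<Lambda> q \<beta> \<longrightarrow> equivalent_qca \<Lambda> D q \<alpha> \<beta>"
    show "\<forall>q (\<alpha> :: ('l, 'd) oper \<Rightarrow> ('l, 'd) oper).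
         clifford_qca \<Lambda> D q \<alpha> \<and> separated \<Lambda> q \<alpha> \<longrightarrow> trivial_qca \<Lambda> D q \<alpha>"
    proof (intro allI impI, elim conjE)
      fix q and \<alpha> :: "('l, 'd) oper \<Rightarrow> ('l, 'd) oper"
      assume \<alpha>: "clifford_qca \<Lambda> D q \<alpha>" "separated \<Lambda> q \<alpha>"
      have "stabilizer_group \<Lambda> q \<alpha> = stabilizer_group \<Lambda> q (\<lambda>A. A)"
        using \<alpha>(2) by (simp add: separated_def stabilizer_group_def)
      then have "equivalent_qca \<Lambda> D q \<alpha> (\<lambda>A. A)" using equiv \<alpha>(1) id by blast
      then show "trivial_qca \<Lambda> D q \<alpha>" by (rule equivalent_to_identity[OF \<alpha>(1)])
    qed
  next
    assume equiv: "\<forall>q (\<alpha> :: ('l, 'd) oper \<Rightarrow> ('l, 'd) oper) \<beta>.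
         clifford_qca \<Lambda> D q \<alpha> \<and> clifford_qca \<Lambda> D q \<beta> \<and>
         flipper_group \<Lambda> q \<alpha> = flipper_group \<Lambda> q \<beta> \<longrightarrow> equivalent_qca \<Lambda> D q \<alpha> \<beta>"
    show "\<forall>q (\<alpha> :: ('l, 'd) oper \<Rightarrow> ('l, 'd) oper).
         clifford_qca \<Lambda> D q \<alpha> \<and> separated \<Lambda> q \<alpha> \<longrightarrow> trivial_qca \<Lambda> D q \<alpha>"
    proof (intro allI impI, elim conjE)
      fix q and \<alpha> :: "('l, 'd) oper \<Rightarrow> ('l, 'd) oper"
      assume \<alpha>: "clifford_qca \<Lambda> D q \<alpha>" "separated \<Lambda> q \<alpha>"
      have "flipper_group \<Lambda> q \<alpha> = flipper_group \<Lambda> q (\<lambda>A. A)"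
        using \<alpha>(2) by (simp add: separated_def flipper_group_def)
      then have "equivalent_qca \<Lambda> D q \<alpha> (\<lambda>A. A)" using equiv \<alpha>(1) id by blast
      then show "trivial_qca \<Lambda> D q \<alpha>" by (rule equivalent_to_identity[OF \<alpha>(1)])
    qed
  qed (use same_stabilizer_equivalent same_flipper_equivalent in blast)+
qed

end
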